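(* Let $f\in L^2(\mathbb{R}^2)$ have compact support, let $a,b\in\mathbb{R}\setminus\{0\}$, and let $2\psi\in(0,\pi)$. Then the weighted V-line transform $\mathcal{V}_{a,b}f$, viewed as a distribution in $(\mathbf{x},\phi)\in\mathbb{R}^2\times\mathbb{R}$, satisfies $$\mathrm{WF}(\mathcal{V}_{a,b}f)\subset W\cup W'.$$
   Context: The weighted V-line transform with opening angle $2\psi$ is $$\mathcal{V}_{a,b}f(\mathbf{x},\phi)=a\int_0^\infty f(\mathbf{x}+t\Phi)\,dt+b\int_0^\infty f(\mathbf{x}+t\Phi')\,dt,$$ where $\Phi=\Phi(\phi)=(\cos(\phi+2\psi-\pi/2),\sin(\phi+2\psi-\pi/2))$ and $\Phi'=\Phi'(\phi)=(\cos(\phi-\pi/2),\sin(\phi-\pi/2))$. Put $\Phi_\perp=(-\sin(\phi+2\psi-\pi/2),\cos(\phi+2\psi-\pi/2))$ and $\Phi'_\perp=(-\sin(\phi-\pi/2),\cos(\phi-\pi/2))$. $\mathrm{WF}$ denotes the ($C^\infty$) wavefront set. Cotangent spaces are identified with Euclidean space, so covectors at $(\mathbf{x},\phi)$ are written $(v,\tau)\in\mathbb{R}^2\times\mathbb{R}$, standing for $v\cdot d\mathbf{x}+\tau\,d\phi$. Define $$W=\{(\mathbf{x},\phi;v,0):(\mathbf{x};v)\in \mathrm{WF}(f)\}\cup\{(\mathbf{x},\phi;v,\alpha(\Phi_\perp\cdot v)):(\mathbf{x}+\alpha\Phi;v)\in\mathrm{WF}(f),\ \Phi\cdot v=0,\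 \alpha\ge 0\},$$ and let $W'$ be the same set with $\Phi,\Phi_\perp$ replaced by $\Phi',\Phi'_\perp$. *)

theory Defs
  imports "HOL-Analysis.Analysis"
begin

section \<open>Test functions, regular distributions and the wavefront set\<close>

primrec Ck :: "nat \<Rightarrow> ('a::euclidean_space \<Rightarrow> complex) \<Rightarrow> bool" where
  "Ck 0 g \<longleftrightarrow> continuous_on UNIV g"
| "Ck (Suc k) g \<longleftrightarrow> (\<forall>x. g differentiable (at x)) \<and>
     (\<forall>v. Ck k (\<lambda>x. frechet_derivative g (at x) v))"

definition test_function :: "('a::euclidean_space \<Rightarrow> complex) \<Rightarrow> bool" where
  "test_function g \<longleftrightarrow> (\<forall>k. Ck k g) \<and> compact (closure {x. g x \<noteq> 0})"

text \<open>Distributions are represented as functionals on functions; only their values at test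
  functions are ever used. A locally integrable \<open>u\<close> induces \<open>g \<mapsto> \<integral> u g\<close>. The integral
  is over the completed measure, so that \<open>u\<close> may be any Lebesgue measurable representative.\<close>

definition regular_distribution ::
    "('a::euclidean_space \<Rightarrow> complex) \<Rightarrow> ('a \<Rightarrow> complex) \<Rightarrow> complex" where
  "regular_distribution u = (\<lambda>g. LINT x|lebesgue. u x * g x)"

text \<open>The Fourier transform of the compactly supported distribution \<open>\<rho> u\<close> at \<open>\<eta>\<close> is
  \<open>u\<close> applied to \<open>y \<mapsto> \<rho> y * exp (- \<i> y \<bullet> \<eta>)\<close>.\<close>

definition fourier_localized ::
    "(('a::euclidean_space \<Rightarrow> complex) \<Rightarrow> complex) \<Rightarrow> ('a \<Rightarrow> complex) \<Rightarrow> 'a \<Rightarrow> complex" where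
  "fourier_localized u \<rho> \<eta> = u (\<lambda>y. \<rho> y * exp (- \<i> * complex_of_real (y \<bullet> \<eta>)))"

text \<open>Conic neighbourhoods are invariant under positive scalars only; the library's
  \<^const>\<open>conic\<close> allows the scalar 0 and is unsuitable, since the only open conic
  sets in that sense are the empty set and the whole space.\<close>

definition microlocally_smooth ::
    "(('a::euclidean_space \<Rightarrow> complex) \<Rightarrow> complex) \<Rightarrow> 'a \<Rightarrow> 'a \<Rightarrow> bool" where
  "microlocally_smooth u x \<xi> \<longleftrightarrow>
     (\<exists>\<rho> \<Gamma>. test_function \<rho> \<and> \<rho> x \<noteq> 0 \<and>
        open \<Gamma> \<and> \<xi> \<in> \<Gamma> \<and> (\<forall>\<eta>\<in>\<Gamma>. \<forall>c>0. c *\<^sub>R \<eta> \<in> \<Gamma>) \<and>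
        (\<forall>N::nat. \<exists>C::real. \<forall>\<eta>\<in>\<Gamma>.
           cmod (fourier_localized u \<rho> \<eta>) \<le> C / (1 + norm \<eta>) ^ N))"

definition wavefront_set ::
    "(('a::euclidean_space \<Rightarrow> complex) \<Rightarrow> complex) \<Rightarrow> ('a \<times> 'a) set" where
  "wavefront_set u = {(x, \<xi>). \<xi> \<noteq> 0 \<and> \<not> microlocally_smooth u x \<xi>}"

abbreviation WF :: "('a::euclidean_space \<Rightarrow> complex) \<Rightarrow> ('a \<times> 'a) set" where
  "WF u \<equiv> wavefront_set (regular_distribution u)"

section \<open>Square-integrable functions of compact support\<close>

definition square_integrable :: "('a::euclidean_space \<Rightarrow> complex) \<Rightarrow> bool" where
  "square_integrable f \<longleftrightarrow>
     f \<in> borel_measurable lebesgue \<and> integrable lebesgue (\<lambda>x. (cmod (f x))\<^sup>2)"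

text \<open>Support is understood for the class of \<open>f\<close> modulo null sets.\<close>

definition compactly_supported :: "('a::euclidean_space \<Rightarrow> complex) \<Rightarrow> bool" where
  "compactly_supported f \<longleftrightarrow> (\<exists>K. compact K \<and> (AE x in lebesgue. x \<notin> K \<longrightarrow> f x = 0))"

section \<open>The weighted V-line transform\<close>

definition Phi :: "real \<Rightarrow> real \<Rightarrow> real^2" where
  "Phi \<psi> \<phi> = vector [cos (\<phi> + 2 * \<psi> - pi / 2), sin (\<phi> + 2 * \<psi> - pi / 2)]"

definition Phi_perp :: "real \<Rightarrow> real \<Rightarrow> real^2" where
  "Phi_perp \<psi> \<phi> = vector [- sin (\<phi> + 2 * \<psi> - pi / 2), cos (\<phi> + 2 * \<psi> - pi / 2)]"

definition Phi' :: "real \<Rightarrow> real^2" where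
  "Phi' \<phi> = vector [cos (\<phi> - pi / 2), sin (\<phi> - pi / 2)]"

definition Phi'_perp :: "real \<Rightarrow> real^2" where
  "Phi'_perp \<phi> = vector [- sin (\<phi> - pi / 2), cos (\<phi> - pi / 2)]"

text \<open>For square-integrable \<open>f\<close> of compact support both ray integrals converge absolutely for
  almost every \<open>(x, \<phi>)\<close>; on the exceptional null set the library integral is 0, which does not
  affect the induced distribution.\<close>

definition V_line ::
    "real \<Rightarrow> real \<Rightarrow> real \<Rightarrow> (real^2 \<Rightarrow> complex) \<Rightarrow> (real^2) \<times> real \<Rightarrow> complex" where
  "V_line \<psi> a b f = (\<lambda>(x, \<phi>).
     a *\<^sub>R (LINT t:{0..}|lebesgue. f (x + t *\<^sub>R Phi \<psi> \<phi>)) +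
     b *\<^sub>R (LINT t:{0..}|lebesgue. f (x + t *\<^sub>R Phi' \<phi>)))"

text \<open>Elements are \<open>((x, \<phi>), (v, \<tau>))\<close>, with \<open>(v, \<tau>)\<close> the covector \<open>v \<cdot> dx + \<tau> d\<phi>\<close>; this agrees
  with the inner product on \<open>(real^2) \<times> real\<close> used in the Fourier transform there.\<close>

definition W_set ::
    "(real \<Rightarrow> real^2) \<Rightarrow> (real \<Rightarrow> real^2) \<Rightarrow> (real^2 \<Rightarrow> complex) \<Rightarrow>
       (((real^2) \<times> real) \<times> ((real^2) \<times> real)) set" where
  "W_set \<Theta> \<Theta>_perp f =
     {((x, \<phi>), (v, 0)) | x \<phi> v. (x, v) \<in> WF f} \<union>
     {((x, \<phi>), (v, \<alpha> * (\<Theta>_perp \<phi> \<bullet> v))) | x \<phi> v \<alpha>.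
        (x + \<alpha> *\<^sub>R \<Theta> \<phi>, v) \<in> WF f \<and> \<Theta> \<phi> \<bullet> v = 0 \<and> \<alpha> \<ge> 0}"

end

(*
  Substituting y = x + t Theta(phi), the Fourier transform of the ray transform of f, localized at
  (x0, phi0), becomes an oscillatory integral over (y, phi, t) with phase
  t Theta(phi) . xi - phi tau apart from the factor exp(-i y . xi). The phase is stationary in phi only
  if tau = t (Theta_perp . xi), and stationary in t only if Theta . xi = 0. Near a value of t where
  (x0 + t Theta, v) is not in WF f, the y-integral decays rapidly, because multiplication by a smooth
  cutoff acts on Fourier transforms as convolution with a rapidly decreasing function. At the remaining
  values of t one integrates by parts in phi, where the cutoff leaves no boundary terms, or in t. The
  latter is needed only for t > 0: a phase stationary in phi at t = 0 has tau = 0, which is the case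
  covered by the covectors (v, 0) of W.
*)
theory Submission
  imports Defs "HOL-Probability.Characteristic_Functions" "HOL-Probability.Sinc_Integral"
begin

section \<open>Smooth functions on open sets\<close>

text \<open>Integration by parts never touches y, because f has no regularity: in the angular and
  radial estimates y is a parameter confined to the support of f. Only the radial estimate asks for
  a weight smooth in t, so the obstacle is the sharp endpoint t = 0; the upper end is harmless,
  since the spatial cutoff has vanished on the support of f before it. A smooth step splits off a
  short interval at 0, where the angular or the local estimate applies; both tolerate discontinuous
  weights. If Theta . v = 0 with v nonzero, then Theta_perp . v is nonzero, so at most one t is
  stationary for the angular phase; one local piece suffices and the ray need not be covered.
  Frequencies are written l z with l > 0 and z near the covector, and decay is measured in l:
  passing from z to its spatial part then keeps the same l. A single product cutoff must serve both
  branches and all pieces in t, so each estimate is proved for every sufficiently small radius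
  \<delta>.\<close>

primrec Ck_on :: "'a set \<Rightarrow> nat \<Rightarrow> ('a::euclidean_space \<Rightarrow> 'b::real_normed_vector) \<Rightarrow> bool" where
  "Ck_on S 0 g \<longleftrightarrow> continuous_on S g"
| "Ck_on S (Suc k) g \<longleftrightarrow> (\<forall>x\<in>S. g differentiable (at x)) \<and>
     (\<forall>v. Ck_on S k (\<lambda>x. frechet_derivative g (at x) v))"

lemma Ck_on_UNIV: "Ck_on UNIV k g \<longleftrightarrow> Ck k g"
  by (induction k arbitrary: g) auto

lemma Ck_on_cong:
  assumes "open S" "\<And>x. x \<in> S \<Longrightarrow> g x = h x" "Ck_on S k g"
  shows "Ck_on S k h"
  using assms(2,3)
proof (induction k arbitrary: g h)
  case 0
  then show ?case by (metis Ck_on.simps(1) continuous_on_cong)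
next
  case (Suc k)
  have "(h has_derivative frechet_derivative g (at x)) (at x)" if "x \<in> S" for x
  proof (rule has_derivative_transform_within_open[OF _ \<open>open S\<close> that])
    show "(g has_derivative frechet_derivative g (at x)) (at x)"
      using Suc.prems(2) that by (simp add: frechet_derivative_works[symmetric])
  qed (use Suc.prems in auto)
  note D = this
  have "frechet_derivative g (at x) = frechet_derivative h (at x)" if "x \<in> S" for x
    using D[OF that] by (rule frechet_derivative_at)
  note E = this
  have "Ck_on S k (\<lambda>x. frechet_derivative h (at x) v)" for v
  proof (rule Suc.IH)
    show "Ck_on S k (\<lambda>x. frechet_derivative g (at x) v)" using Suc.prems(2) by simp
  qed (simp add: E)
  then show ?case using differentiableI[OF D] by simp
qed

text \<open>Derivatives at a point are unique, so any explicit one may stand in for the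
  \<open>frechet_derivative\<close> of the definition. The calculus rules below exhibit the textbook
  derivative and recurse on its directional values.\<close>

lemma Ck_on_SucI:
  assumes S: "open S" and D: "\<And>x. x \<in> S \<Longrightarrow> (g has_derivative g' x) (at x)"
    and C: "\<And>v. Ck_on S k (\<lambda>x. g' x v)"
  shows "Ck_on S (Suc k) g"
proof -
  have "Ck_on S k (\<lambda>x. frechet_derivative g (at x) v)" for v
    using C[of v] by (rule Ck_on_cong[OF S, rotated]) (metis D frechet_derivative_at)
  then show ?thesis using differentiableI[OF D] by simp
qed

lemma Ck_on_SucD:
  assumes "Ck_on S (Suc k) g"
  shows "\<And>x. x \<in> S \<Longrightarrow> (g has_derivative frechet_derivative g (at x)) (at x)"
    and "\<And>v. Ck_on S k (\<lambda>x. frechet_derivative g (at x) v)"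
  using assms by (auto simp: frechet_derivative_works[symmetric])

lemma Ck_on_cont: "open S \<Longrightarrow> Ck_on S k g \<Longrightarrow> continuous_on S g"
  by (cases k) (auto simp: continuous_on_eq_continuous_at intro!: differentiable_imp_continuous_within)

lemma Ck_on_Suc_imp:
  assumes "open S" shows "Ck_on S (Suc k) g \<Longrightarrow> Ck_on S k g"
proof (induction k arbitrary: g)
  case 0
  then show ?case using Ck_on_cont[OF assms 0] by simp
next
  case (Suc k)
  show ?case
    by (rule Ck_on_SucI[OF assms Ck_on_SucD(1)[OF Suc.prems]])
       (use Suc.IH[OF Ck_on_SucD(2)[OF Suc.prems]] in auto)
qed

lemma Ck_on_subset: "Ck_on S k g \<Longrightarrow> T \<subseteq> S \<Longrightarrow> Ck_on T k g"
  by (induction k arbitrary: g) (auto intro: continuous_on_subset)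

lemma Ck_on_Un:
  assumes "open S" "open T" shows "Ck_on S k g \<Longrightarrow> Ck_on T k g \<Longrightarrow> Ck_on (S \<union> T) k g"
  by (induction k arbitrary: g) (auto intro: continuous_on_open_Un assms)

lemma Ck_on_const: "open S \<Longrightarrow> Ck_on S k (\<lambda>x. c)"
proof (induction k arbitrary: c)
  case (Suc k)
  show ?case by (rule Ck_on_SucI[where g' = "\<lambda>x v. 0"]) (use Suc in auto)
qed auto

lemma Ck_on_linear:
  assumes "open S" "bounded_linear L" shows "Ck_on S k L"
proof (cases k)
  case 0 then show ?thesis using assms linear_continuous_on by auto
next
  case (Suc k')
  show ?thesis unfolding Suc
    by (rule Ck_on_SucI[where g' = "\<lambda>x. L"])
      (use assms in \<open>auto intro: Ck_on_const bounded_linear_imp_has_derivative\<close>)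
qed

lemma Ck_on_add:
  assumes "open S" shows "Ck_on S k f \<Longrightarrow> Ck_on S k g \<Longrightarrow> Ck_on S k (\<lambda>x. f x + g x)"
proof (induction k arbitrary: f g)
  case (Suc k)
  note D = Ck_on_SucD[OF Suc.prems(1)] Ck_on_SucD[OF Suc.prems(2)]
  show ?case
    by (rule Ck_on_SucI[OF assms has_derivative_add[OF D(1) D(3)] Suc.IH[OF D(2) D(4)]])
qed (auto intro: continuous_intros)

lemma Ck_on_bilinear:
  assumes "open S" "bounded_bilinear b"
  shows "Ck_on S k f \<Longrightarrow> Ck_on S k g \<Longrightarrow> Ck_on S k (\<lambda>x. b (f x) (g x))"
proof (induction k arbitrary: f g)
  case 0 then show ?case using bounded_bilinear.continuous_on[OF assms(2)] by simp
next
  case (Suc k)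
  note D = Ck_on_SucD[OF Suc.prems(1)] Ck_on_SucD[OF Suc.prems(2)]
  note E = Suc.prems[THEN Ck_on_Suc_imp[OF assms(1)]]
  show ?case
    by (rule Ck_on_SucI[OF assms(1) bounded_bilinear.FDERIV[OF assms(2) D(1) D(3)]])
      (assumption | intro Ck_on_add assms Suc.IH D E)+
qed

lemma Ck_on_comp_linear:
  assumes S: "open S" and L: "bounded_linear L"
  shows "Ck_on S k f \<Longrightarrow> Ck_on S k (\<lambda>x. L (f x))"
proof (induction k arbitrary: f)
  case 0 then show ?case using bounded_linear.continuous_on[OF L] by simp
next
  case (Suc k)
  note D = Ck_on_SucD[OF Suc.prems]
  show ?case
    by (rule Ck_on_SucI[OF S bounded_linear.has_derivative[OF L D(1)] Suc.IH[OF D(2)]])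
qed

lemma Ck_on_sum:
  assumes "open S" "\<And>i. i \<in> I \<Longrightarrow> Ck_on S k (f i)"
  shows "Ck_on S k (\<lambda>x. \<Sum>i\<in>I. f i x)"
  using assms(2)
  by (induction I rule: infinite_finite_induct) (auto intro: Ck_on_const Ck_on_add assms(1))

text \<open>In the chain rule the derivative of \<open>f\<close> is applied to a direction that
  varies with x, while the induction hypothesis covers fixed directions only. Expanding that
  direction in the basis leaves a finite sum of products to which the hypothesis applies.\<close>

lemma Ck_on_compose:
  fixes f :: "'b::euclidean_space \<Rightarrow> 'c::real_normed_vector" and g :: "'a::euclidean_space \<Rightarrow> 'b"
  assumes S: "open S"
  shows "Ck_on UNIV k f \<Longrightarrow> Ck_on S k g \<Longrightarrow> Ck_on S k (\<lambda>x. f (g x))"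
proof (induction k arbitrary: f)
  case 0 then show ?case using continuous_on_compose2[of UNIV f S g] by simp
next
  case (Suc k)
  let ?f' = "\<lambda>y. frechet_derivative f (at y)" and ?g' = "\<lambda>x. frechet_derivative g (at x)"
  note D = Ck_on_SucD[OF Suc.prems(1)] Ck_on_SucD[OF Suc.prems(2)]
  show ?case
  proof (rule Ck_on_SucI[OF S])
    fix x assume "x \<in> S"
    have "?f' (g x) (?g' x v) = (\<Sum>b\<in>Basis. (?g' x v \<bullet> b) *\<^sub>R ?f' (g x) b)" for v
      using has_derivative_linear[OF D(1), of "g x"]
      by (subst euclidean_representation[symmetric]) (simp only: linear_sum linear_scale UNIV_I)
    with has_derivative_compose[OF D(3)[OF \<open>x \<in> S\<close>] D(1)[OF UNIV_I]]
    show "((\<lambda>x. f (g x)) has_derivative (\<lambda>v. \<Sum>b\<in>Basis. (?g' x v \<bullet> b) *\<^sub>R ?f' (g x) b)) (at x)"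
      by simp
  next
    show "Ck_on S k (\<lambda>x. \<Sum>b\<in>Basis. (?g' x v \<bullet> b) *\<^sub>R ?f' (g x) b)" for v
      by (intro Ck_on_sum S Ck_on_bilinear[OF S bounded_bilinear_scaleR] Suc.IH D(2)
          Ck_on_comp_linear[OF S bounded_linear_inner_left D(4)] Ck_on_Suc_imp[OF S Suc.prems(2)])
  qed
qed

text \<open>One induction settles functions whose successive derivatives have a closed form: shifts
  by pi/2 for \<open>cos\<close>, a recursion on polynomials for \<open>flat_exp\<close>.\<close>

lemma Ck_on_derivative_sequence:
  fixes H :: "nat \<Rightarrow> real \<Rightarrow> real"
  assumes H: "\<And>j x. (H j has_real_derivative H (Suc j) x) (at x)"
  shows "Ck_on UNIV k (H j)"
proof (induction k arbitrary: j)
  case 0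
  show ?case using DERIV_continuous_on[of UNIV "H j"] H by auto
next
  case (Suc k)
  show ?case
    by (rule Ck_on_SucI[OF _ H[unfolded has_field_derivative_def]])
       (auto intro!: Ck_on_bilinear[OF _ bounded_bilinear_mult] Suc.IH Ck_on_const)
qed

text \<open>The derivative of 1/f contains 1/f again, but there one order of smoothness less
  suffices, so the induction closes with \<open>f\<close> fixed.\<close>

lemma Ck_on_inverse:
  fixes f :: "'a::euclidean_space \<Rightarrow> 'b::real_normed_field"
  assumes S: "open S" and nz: "\<And>x. x \<in> S \<Longrightarrow> f x \<noteq> 0"
  shows "Ck_on S k f \<Longrightarrow> Ck_on S k (\<lambda>x. inverse (f x))"
proof (induction k)
  case 0 then show ?case using nz by (auto intro: continuous_on_inverse)
next
  case (Suc k)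
  note D = Ck_on_SucD[OF Suc.prems]
  have E: "Ck_on S k (\<lambda>x. inverse (f x))" by (intro Suc.IH Ck_on_Suc_imp[OF S Suc.prems])
  show ?case
  proof (rule Ck_on_SucI[OF S])
    show "((\<lambda>x. inverse (f x)) has_derivative
        (\<lambda>v. - (inverse (f x) * frechet_derivative f (at x) v * inverse (f x)))) (at x)"
      if "x \<in> S" for x
      using has_derivative_inverse'[OF nz[OF that]] D(1)[OF that]
      by (rule has_derivative_compose[rotated])
    show "Ck_on S k (\<lambda>x. - (inverse (f x) * frechet_derivative f (at x) v * inverse (f x)))" for v
      by (intro Ck_on_comp_linear[OF S bounded_linear_minus[OF bounded_linear_ident]]
          Ck_on_bilinear[OF S bounded_bilinear_mult] D E)
  qed
qed

text \<open>Locality matters twice: the amplitudes of repeated integration by parts are smooth only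
  where the phase derivative is nonzero, and a cutoff glued from two formulas is smooth because two
  open sets cover the space. Openness belongs to the notion, as derivatives are taken in the whole
  space.\<close>

definition smooth_on :: "'a set \<Rightarrow> ('a::euclidean_space \<Rightarrow> 'b::real_normed_vector) \<Rightarrow> bool" where
  "smooth_on S g \<longleftrightarrow> open S \<and> (\<forall>k. Ck_on S k g)"

lemma smooth_onD: "smooth_on S g \<Longrightarrow> open S" "smooth_on S g \<Longrightarrow> Ck_on S k g"
  by (auto simp: smooth_on_def)

lemma smooth_on_deriv:
  assumes "smooth_on S g"
  shows "\<And>x. x \<in> S \<Longrightarrow> (g has_derivative frechet_derivative g (at x)) (at x)"
    and "\<And>v. smooth_on S (\<lambda>x. frechet_derivative g (at x) v)"
  using assms Ck_on_SucD unfolding smooth_on_def by blast+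

lemma smooth_on_cont: "smooth_on S g \<Longrightarrow> continuous_on S g"
  by (metis smooth_on_def Ck_on_cont)

lemma smooth_on_subset: "smooth_on S g \<Longrightarrow> open T \<Longrightarrow> T \<subseteq> S \<Longrightarrow> smooth_on T g"
  by (auto simp: smooth_on_def intro: Ck_on_subset)

lemma smooth_on_Un: "smooth_on S g \<Longrightarrow> smooth_on T g \<Longrightarrow> smooth_on (S \<union> T) g"
  by (auto simp: smooth_on_def intro: Ck_on_Un)

lemma smooth_on_cong: "smooth_on S g \<Longrightarrow> (\<And>x. x \<in> S \<Longrightarrow> g x = h x) \<Longrightarrow> smooth_on S h"
  unfolding smooth_on_def by (metis Ck_on_cong)

lemma smooth_on_const: "open S \<Longrightarrow> smooth_on S (\<lambda>x. c)"
  by (auto simp: smooth_on_def intro: Ck_on_const)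

lemma smooth_on_linear: "open S \<Longrightarrow> bounded_linear L \<Longrightarrow> smooth_on S L"
  by (auto simp: smooth_on_def intro: Ck_on_linear)

lemma smooth_on_add: "smooth_on S f \<Longrightarrow> smooth_on S g \<Longrightarrow> smooth_on S (\<lambda>x. f x + g x)"
  by (auto simp: smooth_on_def intro: Ck_on_add)

lemma smooth_on_bilinear:
  "bounded_bilinear b \<Longrightarrow> smooth_on S f \<Longrightarrow> smooth_on S g \<Longrightarrow> smooth_on S (\<lambda>x. b (f x) (g x))"
  by (auto simp: smooth_on_def intro: Ck_on_bilinear)

lemma smooth_on_comp_linear:
  "bounded_linear L \<Longrightarrow> smooth_on S f \<Longrightarrow> smooth_on S (\<lambda>x. L (f x))"
  by (auto simp: smooth_on_def intro: Ck_on_comp_linear)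

lemma smooth_on_compose:
  fixes f :: "'b::euclidean_space \<Rightarrow> 'c::real_normed_vector"
  shows "smooth_on UNIV f \<Longrightarrow> smooth_on S g \<Longrightarrow> smooth_on S (\<lambda>x. f (g x))"
  by (auto simp: smooth_on_def intro: Ck_on_compose)

lemmas smooth_on_mult = smooth_on_bilinear[OF bounded_bilinear_mult]
lemmas smooth_on_scaleR = smooth_on_bilinear[OF bounded_bilinear_scaleR]
lemmas smooth_on_inner = smooth_on_bilinear[OF bounded_bilinear_inner]
lemmas smooth_on_of_real = smooth_on_comp_linear[OF bounded_linear_of_real]
lemmas smooth_on_fst = smooth_on_comp_linear[OF bounded_linear_fst]
lemmas smooth_on_snd = smooth_on_comp_linear[OF bounded_linear_snd]

lemma smooth_on_minus: "smooth_on S f \<Longrightarrow> smooth_on S (\<lambda>x. - f x)"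
  by (rule smooth_on_comp_linear[OF bounded_linear_minus[OF bounded_linear_ident]])

lemma smooth_on_diff: "smooth_on S f \<Longrightarrow> smooth_on S g \<Longrightarrow> smooth_on S (\<lambda>x. f x - g x)"
  using smooth_on_add[OF _ smooth_on_minus] by fastforce

lemma smooth_on_id: "open S \<Longrightarrow> smooth_on S (\<lambda>x. x)"
  by (rule smooth_on_linear[OF _ bounded_linear_ident])

lemma smooth_on_inverse:
  fixes f :: "'a::euclidean_space \<Rightarrow> 'b::real_normed_field"
  shows "smooth_on S f \<Longrightarrow> (\<And>x. x \<in> S \<Longrightarrow> f x \<noteq> 0) \<Longrightarrow> smooth_on S (\<lambda>x. inverse (f x))"
  by (auto simp: smooth_on_def intro: Ck_on_inverse)

lemma smooth_on_divide:
  fixes f :: "'a::euclidean_space \<Rightarrow> 'b::real_normed_field"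
  shows "smooth_on S f \<Longrightarrow> smooth_on S g \<Longrightarrow> (\<And>x. x \<in> S \<Longrightarrow> g x \<noteq> 0) \<Longrightarrow> smooth_on S (\<lambda>x. f x / g x)"
  unfolding divide_inverse by (intro smooth_on_mult smooth_on_inverse)

lemma smooth_on_derivative_sequence:
  fixes H :: "nat \<Rightarrow> real \<Rightarrow> real"
  assumes "\<And>j x. (H j has_real_derivative H (Suc j) x) (at x)"
  shows "smooth_on UNIV (H j)"
  using Ck_on_derivative_sequence[of H] assms by (auto simp: smooth_on_def)

lemma smooth_on_cos:
  fixes p :: "'a::euclidean_space \<Rightarrow> real"
  assumes "smooth_on S p"
  shows "smooth_on S (\<lambda>x. cos (p x))"
proof -
  have "((\<lambda>x. cos (x + real j * (pi/2))) has_real_derivative cos (x + real (Suc j) * (pi/2))) (at x)" for x j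
    using minus_sin_cos_eq[of "x + real j * (pi/2)"]
    by (auto intro!: derivative_eq_intros simp: algebra_simps add_divide_distrib)
  from smooth_on_derivative_sequence[of "\<lambda>j x. cos (x + real j * (pi/2))" 0, OF this]
  have "smooth_on UNIV (cos :: real \<Rightarrow> real)" by simp
  then show ?thesis using assms by (rule smooth_on_compose)
qed

lemma smooth_on_sin:
  fixes p :: "'a::euclidean_space \<Rightarrow> real"
  assumes "smooth_on S p"
  shows "smooth_on S (\<lambda>x. sin (p x))"
proof -
  have "smooth_on S (\<lambda>x. cos (p x + (- (pi/2))))"
    by (intro smooth_on_cos smooth_on_add assms smooth_on_const) (use assms smooth_onD in auto)
  then show ?thesis by (simp add: cos_diff)
qed

lemma test_function_iff:
  "test_function g \<longleftrightarrow> smooth_on UNIV g \<and> compact (closure {x. g x \<noteq> 0})"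
  by (auto simp: test_function_def smooth_on_def Ck_on_UNIV)

section \<open>A smooth function flat at the origin\<close>

text \<open>All derivatives of exp(-1/x), extended by 0, lie in this family, so the polynomial
  factor is carried along from the start.\<close>

definition flat_poly :: "real poly \<Rightarrow> real \<Rightarrow> real" where
  "flat_poly p x = (if x > 0 then poly p (1 / x) * exp (- (1 / x)) else 0)"

lemma poly_times_exp_tendsto_0: "((\<lambda>y::real. poly p y * exp (- y)) \<longlongrightarrow> 0) at_top"
proof -
  have "((\<lambda>y. \<Sum>i\<le>degree p. coeff p i * (y ^ i / exp y)) \<longlongrightarrow> (\<Sum>i\<le>degree p. coeff p i * 0)) at_top"
    by (intro tendsto_intros tendsto_power_div_exp_0)
  then show ?thesis
    by (simp add: poly_altdef sum_distrib_right exp_minus divide_inverse mult.assoc)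
qed

lemma flat_poly_tendsto_0: "(flat_poly p \<longlongrightarrow> 0) (at 0)"
proof -
  have "(flat_poly p \<longlongrightarrow> 0) (at_left 0)"
    by (rule tendsto_eventually) (auto simp: flat_poly_def eventually_at_filter)
  moreover have "((\<lambda>x. poly p (1 / x) * exp (- (1 / x))) \<longlongrightarrow> 0) (at_right 0)"
    using filterlim_compose[OF poly_times_exp_tendsto_0 filterlim_inverse_at_top_right]
    by (simp add: divide_inverse)
  then have "(flat_poly p \<longlongrightarrow> 0) (at_right 0)"
    by (rule Lim_transform_eventually) (auto simp: flat_poly_def eventually_at_filter)
  ultimately show ?thesis by (simp add: filterlim_split_at)
qed

text \<open>With y = 1/x one has d/dx = - y^2 d/dy, which sends p(y) exp(-y) to y^2 (p - p')(y)
  exp(-y); \<open>[:0, 0, 1:]\<close> is y^2.\<close>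

lemma flat_poly_deriv:
  "(flat_poly p has_real_derivative flat_poly ([:0, 0, 1:] * (p - pderiv p)) x) (at x)"
proof -
  consider "x < 0" | "x = 0" | "x > 0" by linarith
  then show ?thesis
  proof cases
    case 1
    have "((\<lambda>x. 0) has_real_derivative 0) (at x)" by simp
    then have "(flat_poly p has_real_derivative 0) (at x)"
      by (rule DERIV_cong_ev[THEN iffD1, rotated -1])
         (use 1 eventually_nhds_in_open[of "{..<0}" x] in \<open>auto simp: flat_poly_def elim: eventually_mono\<close>)
    then show ?thesis using 1 by (simp add: flat_poly_def)
  next
    case 2
    \<comment> \<open>Dividing by h multiplies the polynomial in 1/h by its variable
      \<open>[:0, 1:]\<close>, so the difference quotient at 0 is again a member of the family and
      tends to 0.\<close>
    have "((\<lambda>h. flat_poly ([:0, 1:] * p) h) \<longlongrightarrow> 0) (at 0)" by (rule flat_poly_tendsto_0)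
    then have "((\<lambda>h. (flat_poly p (0 + h) - flat_poly p 0) / h) \<longlongrightarrow> 0) (at 0)"
      by (rule Lim_transform_eventually) (auto simp: flat_poly_def eventually_at_filter)
    then show ?thesis using 2 by (simp add: DERIV_def flat_poly_def)
  next
    case 3
    have "((\<lambda>x. poly p (1 / x) * exp (- (1 / x))) has_real_derivative
        flat_poly ([:0, 0, 1:] * (p - pderiv p)) x) (at x)"
      using 3 by (auto intro!: derivative_eq_intros poly_DERIV[THEN DERIV_chain2]
          simp: flat_poly_def field_simps power2_eq_square)
    then show ?thesis
      by (rule DERIV_cong_ev[THEN iffD1, rotated -1])
         (use 3 eventually_nhds_in_open[of "{0<..}" x] in \<open>auto simp: flat_poly_def elim: eventually_mono\<close>)
  qed
qed

definition flat_exp :: "real \<Rightarrow> real" where "flat_exp = flat_poly 1"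

lemma flat_exp_pos: "x > 0 \<Longrightarrow> flat_exp x > 0"
  and flat_exp_0: "x \<le> 0 \<Longrightarrow> flat_exp x = 0"
  by (auto simp: flat_exp_def flat_poly_def)

lemma flat_exp_nonneg: "flat_exp x \<ge> 0"
  using flat_exp_pos[of x] flat_exp_0[of x] by linarith

lemma smooth_on_flat_exp:
  assumes "smooth_on S p" shows "smooth_on S (\<lambda>x. flat_exp (p x))"
proof -
  have "(flat_poly (((\<lambda>q. [:0, 0, 1:] * (q - pderiv q)) ^^ j) 1) has_real_derivative
      flat_poly (((\<lambda>q. [:0, 0, 1:] * (q - pderiv q)) ^^ Suc j) 1) x) (at x)" for j x
    using flat_poly_deriv by simp
  from smooth_on_derivative_sequence[of "\<lambda>j. flat_poly (((\<lambda>q. [:0, 0, 1:] * (q - pderiv q)) ^^ j) 1)" 0, OF this]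
  have "smooth_on UNIV flat_exp" by (simp add: flat_exp_def)
  then show ?thesis using assms by (rule smooth_on_compose)
qed

section \<open>Nonstationary phase with parameters\<close>

text \<open>The partial derivative in the last variable is the full derivative in direction (0, 1),
  so it stays smooth in all variables jointly and integration by parts can be iterated.\<close>

lemma smooth_on_slice_deriv:
  fixes b :: "'z::euclidean_space \<times> real \<Rightarrow> 'b::real_normed_vector"
  assumes "smooth_on S b" "(z, s) \<in> S"
  shows "((\<lambda>s. b (z, s)) has_vector_derivative frechet_derivative b (at (z, s)) (0, 1)) (at s)"
proof -
  let ?D = "frechet_derivative b (at (z, s))"
  have D: "(b has_derivative ?D) (at (z, s))" using smooth_on_deriv(1)[OF assms] .
  have "((\<lambda>s. (z, s)) has_derivative (\<lambda>h. (0, h))) (at s)"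
    by (auto intro!: derivative_eq_intros)
  then have "((\<lambda>s. b (z, s)) has_derivative (\<lambda>h. ?D (0, h))) (at s)"
    using D by (rule has_derivative_compose)
  moreover have "(\<lambda>h. ?D (0, h)) = (\<lambda>h. h *\<^sub>R ?D (0, 1))"
  proof
    fix h
    have "(0, h) = h *\<^sub>R (0::'z, 1::real)" by simp
    then show "?D (0, h) = h *\<^sub>R ?D (0, 1)"
      by (simp only: linear_scale[OF has_derivative_linear[OF D]])
  qed
  ultimately show ?thesis unfolding has_vector_derivative_def by simp
qed

text \<open>Since exp(i l p) = (exp(i l p))' / (i l q), one integration by parts gains a factor 1/(i
  l) and replaces the amplitude a by -(a/q)', which is again smooth with the same support condition
  in s. Compactness of the parameter set makes the constant uniform in z.\<close>

lemma nonstationary_phase: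
  fixes a :: "'z::euclidean_space \<times> real \<Rightarrow> complex" and p q :: "'z \<times> real \<Rightarrow> real"
  assumes q: "smooth_on S q" and nz: "\<And>x. x \<in> S \<Longrightarrow> q x \<noteq> 0"
    and p: "\<And>z s. (z, s) \<in> S \<Longrightarrow> ((\<lambda>s. p (z, s)) has_real_derivative q (z, s)) (at s)"
    and Z: "compact Z" "Z \<times> {c..d} \<subseteq> S" and cd: "c < c'" "c \<le> d" "d' < d"
  shows "smooth_on S a \<Longrightarrow> (\<And>z s. (z, s) \<in> S \<Longrightarrow> s \<notin> {c'..d'} \<Longrightarrow> a (z, s) = 0) \<Longrightarrow>
    \<exists>C. \<forall>z\<in>Z. \<forall>l>0. cmod (integral {c..d} (\<lambda>s. a (z, s) * exp (\<i> * of_real (l * p (z, s))))) * l ^ N \<le> C"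
proof (induction N arbitrary: a)
  case 0
  have "compact (a ` (Z \<times> {c..d}))"
    by (intro compact_continuous_image compact_Times Z compact_Icc
        continuous_on_subset[OF smooth_on_cont[OF 0(1)]])
  then obtain B where B: "\<And>x. x \<in> Z \<times> {c..d} \<Longrightarrow> cmod (a x) \<le> B"
    by (meson compact_imp_bounded bounded_iff imageI)
  have "cmod (integral {c..d} (\<lambda>s. a (z, s) * exp (\<i> * of_real (l * p (z, s))))) \<le> \<bar>B\<bar> * (d - c)"
    if "z \<in> Z" for z l
  proof (cases "(\<lambda>s. a (z, s) * exp (\<i> * of_real (l * p (z, s)))) integrable_on cbox c d")
    case True
    have "cmod (integral (cbox c d) (\<lambda>s. a (z, s) * exp (\<i> * of_real (l * p (z, s))))) \<le> \<bar>B\<bar> * measure lborel (cbox c d)"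
      using B that
      by (intro has_integral_bound[OF _ integrable_integral[OF True]])
         (fastforce simp: norm_mult norm_exp_i_times)+
    then show ?thesis using cd by simp
  next
    \<comment> \<open>A non-integrable integrand has integral 0 by convention, so the bound holds
      here as well.\<close>
    case False
    then show ?thesis using cd by (simp add: not_integrable_integral)
  qed
  then show ?case by auto
next
  case (Suc N)
  define b where "b = (\<lambda>x. a x / of_real (q x))"
  define b' where "b' = (\<lambda>x. frechet_derivative b (at x) (0, 1))"
  have S: "open S" using q by (rule smooth_onD)
  have b: "smooth_on S b"
    unfolding b_def by (intro smooth_on_divide Suc.prems smooth_on_of_real q) (use nz in auto)
  have b': "smooth_on S b'" unfolding b'_def by (rule smooth_on_deriv(2)[OF b])
  have D: "((\<lambda>s. b (z, s)) has_vector_derivative b' (z, s)) (at s)" if "(z, s) \<in> S" for z s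
    unfolding b'_def by (rule smooth_on_slice_deriv[OF b that])
  have b0: "b (z, s) = 0" if "(z, s) \<in> S" "s \<notin> {c'..d'}" for z s
    using Suc.prems(2)[OF that] by (simp add: b_def)
  \<comment> \<open>The complement of {c'..d'} is open, so vanishing there passes from
    \<open>b\<close> to its derivative, and \<open>b'\<close> meets the support condition of the
    induction hypothesis.\<close>
  have b'0: "b' (z, s) = 0" if *: "(z, s) \<in> S" "s \<notin> {c'..d'}" for z s
  proof -
    let ?U = "(\<lambda>s. (z, s)) -` S \<inter> - {c'..d'}"
    have U: "open ?U"
      by (intro open_Int open_Compl closed_atLeastAtMost open_vimage S) (auto intro: continuous_intros)
    have "((\<lambda>s. b (z, s)) has_vector_derivative 0) (at s)"
      by (rule has_vector_derivative_transform_within_open[OF has_vector_derivative_const U])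
         (use * b0 in auto)
    then show ?thesis using D[OF *(1)] vector_derivative_unique_at by blast
  qed
  obtain C where C: "\<And>z l. z \<in> Z \<Longrightarrow> l > 0 \<Longrightarrow>
      cmod (integral {c..d} (\<lambda>s. b' (z, s) * exp (\<i> * of_real (l * p (z, s))))) * l ^ N \<le> C"
    using Suc.IH[OF b' b'0] by blast
  have "cmod (integral {c..d} (\<lambda>s. a (z, s) * exp (\<i> * of_real (l * p (z, s))))) * l ^ Suc N \<le> C"
    if zl: "z \<in> Z" "l > 0" for z l
  proof -
    define e where "e = (\<lambda>s. exp (\<i> * of_real (l * p (z, s))))"
    have zS: "(z, s) \<in> S" if "s \<in> {c..d}" for s using Z zl that by auto
    have e: "(e has_vector_derivative \<i> * of_real (l * q (z, s)) * e s) (at s)" if "s \<in> {c..d}" for s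
    proof -
      have "((\<lambda>s. l * p (z, s)) has_vector_derivative l * q (z, s)) (at s)"
        using DERIV_cmult[OF p[OF zS[OF that]], of l]
        by (simp add: has_real_derivative_iff_has_vector_derivative)
      then have "((\<lambda>s. complex_of_real (l * p (z, s))) has_vector_derivative of_real (l * q (z, s))) (at s)"
        by (rule bounded_linear.has_vector_derivative[OF bounded_linear_of_real])
      then have "((\<lambda>s. \<i> * complex_of_real (l * p (z, s))) has_vector_derivative \<i> * of_real (l * q (z, s))) (at s)"
        by (rule has_vector_derivative_mult_right)
      from field_vector_diff_chain_at[OF this DERIV_exp]
      show ?thesis by (simp add: e_def o_def mult_ac)
    qed
    have cont: "continuous_on {c..d} (\<lambda>s. g (z, s))" if "smooth_on S g" for g :: "_ \<Rightarrow> complex"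
      by (rule continuous_on_compose2[OF smooth_on_cont[OF that]]) (use zS in \<open>auto intro!: continuous_intros\<close>)
    have ce: "continuous_on {c..d} e"
      using e by (intro continuous_at_imp_continuous_on ballI has_vector_derivative_continuous)
    have "((\<lambda>s. b (z, s) * (\<i> * of_real (l * q (z, s)) * e s) + b' (z, s) * e s)
       has_integral b (z, d) * e d - b (z, c) * e c) {c..d}"
    proof (rule fundamental_theorem_of_calculus[OF cd(2)])
      fix s assume s: "s \<in> {c..d}"
      show "((\<lambda>s. b (z, s) * e s) has_vector_derivative
         b (z, s) * (\<i> * of_real (l * q (z, s)) * e s) + b' (z, s) * e s) (at s within {c..d})"
        using has_vector_derivative_mult[OF D[OF zS[OF s]] e[OF s]]
        by (rule has_vector_derivative_at_within)
    qed
    \<comment> \<open>\<open>c < c'\<close> and \<open>d' < d\<close> put both endpoints outside the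
      support, hence no boundary terms.\<close>
    moreover have "b (z, c) = 0" "b (z, d) = 0" using cd zS by (auto intro!: b0)
    ultimately have 0: "((\<lambda>s. b (z, s) * (\<i> * of_real (l * q (z, s)) * e s) + b' (z, s) * e s) has_integral 0) {c..d}"
      by simp
    have eq: "b (z, s) * (\<i> * of_real (l * q (z, s)) * e s) = \<i> * of_real l * (a (z, s) * e s)"
      if "s \<in> {c..d}" for s
      using nz[OF zS[OF that]] by (simp add: b_def)
    have 1: "((\<lambda>s. \<i> * of_real l * (a (z, s) * e s) + b' (z, s) * e s) has_integral 0) {c..d}"
      by (rule has_integral_eq[OF _ 0]) (simp only: eq)
    have ia: "(\<lambda>s. a (z, s) * e s) integrable_on {c..d}" and ib: "(\<lambda>s. b' (z, s) * e s) integrable_on {c..d}"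
      by (intro integrable_continuous_real continuous_intros cont ce Suc.prems b')+
    have "\<i> * of_real l * integral {c..d} (\<lambda>s. a (z, s) * e s) + integral {c..d} (\<lambda>s. b' (z, s) * e s) = 0"
      using has_integral_unique[OF has_integral_add[OF has_integral_mult_right[OF integrable_integral[OF ia]]
          integrable_integral[OF ib]] 1] .
    then have "integral {c..d} (\<lambda>s. b' (z, s) * e s) = - (\<i> * of_real l * integral {c..d} (\<lambda>s. a (z, s) * e s))"
      by (simp add: add_eq_0_iff)
    then have "cmod (integral {c..d} (\<lambda>s. b' (z, s) * e s)) = l * cmod (integral {c..d} (\<lambda>s. a (z, s) * e s))"
      using zl by (simp add: norm_mult)
    with C[OF zl] show ?thesis by (simp add: e_def mult_ac)
  qed
  then show ?case by blast
qed

section \<open>The Fourier transform of test functions\<close>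

definition ft :: "('a::euclidean_space \<Rightarrow> complex) \<Rightarrow> 'a \<Rightarrow> complex" where
  "ft g \<eta> = (LINT y|lborel. g y * exp (- \<i> * of_real (y \<bullet> \<eta>)))"

lemma norm_exp_minus_i [simp]: "cmod (exp (- (\<i> * of_real t))) = 1"
  using norm_exp_i_times[of "- t"] by simp

lemma exp_minus_i_measurable [measurable]:
  "(\<lambda>y. exp (- (\<i> * complex_of_real (y \<bullet> \<eta>)))) \<in> borel_measurable borel"
  by (intro borel_measurable_continuous_onI continuous_intros)

lemma integrable_compact_support:
  fixes g :: "'a::euclidean_space \<Rightarrow> 'b::{banach,second_countable_topology}"
  assumes "continuous_on UNIV g" "compact K" "\<And>x. x \<notin> K \<Longrightarrow> g x = 0"
  shows "integrable lborel g"
proof -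
  have "integrable lborel (\<lambda>x. indicator K x *\<^sub>R g x)"
    using borel_integrable_compact[OF assms(2)] continuous_on_subset[OF assms(1)] by blast
  then show ?thesis
    by (rule Bochner_Integration.integrable_cong[OF refl, THEN iffD1, rotated])
       (use assms(3) in \<open>auto split: split_indicator\<close>)
qed

lemma bounded_compact_support:
  fixes g :: "'a::euclidean_space \<Rightarrow> complex"
  assumes c: "continuous_on UNIV g" and K: "compact K" "\<And>x. x \<notin> K \<Longrightarrow> g x = 0"
  obtains B where "\<And>x. cmod (g x) \<le> B"
proof -
  have "bounded (g ` K)" by (intro compact_imp_bounded compact_continuous_image K continuous_on_subset[OF c]) auto
  then obtain B where "\<And>x. x \<in> K \<Longrightarrow> cmod (g x) \<le> B" by (auto simp: bounded_iff)
  then have "cmod (g x) \<le> \<bar>B\<bar>" for x using K(2)[of x] by (cases "x \<in> K") force+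
  then show thesis by (rule that)
qed

lemma integrable_times_unimodular:
  fixes f u :: "'a \<Rightarrow> complex"
  assumes "integrable M f" "u \<in> borel_measurable M" "\<And>x. cmod (u x) = 1"
  shows "integrable M (\<lambda>x. f x * u x)"
  using assms by (subst integrable_norm_iff[symmetric]) (auto simp: norm_mult)

lemma integrable_pair_mult:
  fixes f :: "'a::euclidean_space \<Rightarrow> complex" and g :: "'b::euclidean_space \<Rightarrow> complex"
  assumes f: "integrable lborel f" and g: "integrable lborel g"
  shows "integrable (lborel \<Otimes>\<^sub>M lborel) (\<lambda>(x, y). f x * g y)"
proof (rule lborel_pair.Fubini_integrable)
  have [measurable]: "f \<in> borel_measurable borel" "g \<in> borel_measurable borel"
    using assms by auto
  show "(\<lambda>(x, y). f x * g y) \<in> borel_measurable (lborel \<Otimes>\<^sub>M lborel)" by measurable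
  show "integrable lborel (\<lambda>x. \<integral> y. norm (case (x, y) of (x, y) \<Rightarrow> f x * g y) \<partial>lborel)"
    using f by (simp add: norm_mult)
qed (use g in auto)

lemma has_derivative_zero_outside:
  fixes g :: "'a::euclidean_space \<Rightarrow> complex"
  assumes "(g has_derivative D) (at x)" "compact K" "\<And>x. x \<notin> K \<Longrightarrow> g x = 0" "x \<notin> K"
  shows "D v = 0"
proof -
  have "(g has_derivative (\<lambda>_. 0)) (at x)"
    by (rule has_derivative_transform_within_open[OF has_derivative_const, of "-K"])
       (use assms compact_imp_closed in auto)
  then show ?thesis using has_derivative_unique[OF assms(1)] by metis
qed

text \<open>By translation invariance the integral equals its average over the shifts y + s v with s
  in [0, 1]. Exchanging the integrals and applying the fundamental theorem along each segment leaves
  the integral of g(y + v) - g(y), which is 0.\<close>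

lemma integral_deriv_compact_support:
  fixes g :: "'a::euclidean_space \<Rightarrow> complex"
  assumes D: "\<And>x. (g has_derivative g' x) (at x)" and c: "continuous_on UNIV (\<lambda>x. g' x v)"
    and K: "compact K" and 0: "\<And>x. x \<notin> K \<Longrightarrow> g x = 0"
  shows "(LINT x|lborel. g' x v) = 0"
proof -
  define G where "G = (\<lambda>x. g' x v)"
  have G0: "G x = 0" if "x \<notin> K" for x
    unfolding G_def by (rule has_derivative_zero_outside[OF D K 0 that])
  have cG: "continuous_on UNIV G" using c by (simp add: G_def)
  have intG: "integrable lborel G" by (rule integrable_compact_support[OF cG K G0])
  have gc: "continuous_on UNIV g"
    by (intro continuous_at_imp_continuous_on ballI has_derivative_continuous[OF D])
  have intg: "integrable lborel g" by (rule integrable_compact_support[OF gc K 0])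
  have shift: "integrable lborel (\<lambda>y. h (y + w))" "(LINT y|lborel. h (y + w)) = integral\<^sup>L lborel h"
    if "integrable lborel h" for h :: "'a \<Rightarrow> complex" and w
  proof -
    have e: "integrable (distr lborel borel ((+) w)) h" using that lborel_distr_plus[of w] by simp
    then show "integrable lborel (\<lambda>y. h (y + w))"
      by (subst (asm) integrable_distr_eq) (use that in \<open>auto simp: add.commute\<close>)
    show "(LINT y|lborel. h (y + w)) = integral\<^sup>L lborel h"
      by (subst (2) lborel_distr_plus[of w, symmetric], subst integral_distr)
         (use that in \<open>auto simp: add.commute\<close>)
  qed
  have inner: "(\<integral>s. indicator {0..1::real} s *\<^sub>R G (y + s *\<^sub>R v) \<partial>lborel) = g (y + v) - g y" for y
  proof -
    have "(\<integral>s. indicator {0..1::real} s *\<^sub>R G (y + s *\<^sub>R v) \<partial>lborel) = g (y + 1 *\<^sub>R v) - g (y + 0 *\<^sub>R v)"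
    proof (rule integral_FTC_Icc)
      show "continuous_on {0..1} (\<lambda>s. G (y + s *\<^sub>R v))"
        by (intro continuous_on_compose2[OF cG] continuous_intros) auto
      fix s :: real
      have "((\<lambda>s. y + s *\<^sub>R v) has_derivative (\<lambda>h. h *\<^sub>R v)) (at s within {0..1})"
        by (auto intro!: derivative_eq_intros)
      from has_derivative_compose[OF this D]
      show "((\<lambda>s. g (y + s *\<^sub>R v)) has_vector_derivative G (y + s *\<^sub>R v)) (at s within {0..1})"
        unfolding has_vector_derivative_def G_def
        using linear_scale[OF has_derivative_linear[OF D]] by (simp del: scaleR_complex.simps)
    qed simp
    then show ?thesis by simp
  qed
  have "integrable (lborel \<Otimes>\<^sub>M lborel) (\<lambda>(s, y). indicator {0..1::real} s *\<^sub>R G (y + s *\<^sub>R v))"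
  proof (rule lborel_pair.Fubini_integrable)
    have [measurable]: "G \<in> borel_measurable borel" using intG by auto
    show "(\<lambda>(s, y). indicator {0..1::real} s *\<^sub>R G (y + s *\<^sub>R v)) \<in> borel_measurable (lborel \<Otimes>\<^sub>M lborel)"
      by measurable
    have "(\<integral>y. norm (G (y + s *\<^sub>R v)) \<partial>lborel) = (\<integral>y. norm (G y) \<partial>lborel)" for s
      using shift(2)[of "\<lambda>y. of_real (norm (G y))" "s *\<^sub>R v"] intG by simp
    then show "integrable lborel (\<lambda>s. \<integral>y. norm (case (s, y) of (s, y) \<Rightarrow> indicator {0..1::real} s *\<^sub>R G (y + s *\<^sub>R v)) \<partial>lborel)"
      by (simp add: norm_scaleR)
  qed (use shift[OF intG] in auto)
  from lborel_pair.Fubini_integral[OF this]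
  have "(\<integral>y. (\<integral>s. indicator {0..1::real} s *\<^sub>R G (y + s *\<^sub>R v) \<partial>lborel) \<partial>lborel) =
        (\<integral>s. (\<integral>y. indicator {0..1::real} s *\<^sub>R G (y + s *\<^sub>R v) \<partial>lborel) \<partial>lborel)"
    by simp
  also have "\<dots> = integral\<^sup>L lborel G"
    by (simp add: shift[OF intG])
  finally have "integral\<^sup>L lborel G = (\<integral>y. g (y + v) - g y \<partial>lborel)"
    by (simp only: inner)
  also have "\<dots> = 0" using shift[OF intg, of v] intg by simp
  finally show ?thesis by (simp add: G_def)
qed

text \<open>The derivative of g times the exponential integrates to 0, and the product rule splits
  this integral into the two sides.\<close>

lemma ft_deriv:
  fixes g :: "'a::euclidean_space \<Rightarrow> complex"
  assumes D: "\<And>x. (g has_derivative g' x) (at x)" and c: "continuous_on UNIV (\<lambda>x. g' x v)"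
    and K: "compact K" and 0: "\<And>x. x \<notin> K \<Longrightarrow> g x = 0"
  shows "ft (\<lambda>x. g' x v) \<eta> = \<i> * of_real (v \<bullet> \<eta>) * ft g \<eta>"
proof -
  let ?e = "\<lambda>y. exp (- \<i> * of_real (y \<bullet> \<eta>))"
  have gc: "continuous_on UNIV g"
    by (intro continuous_at_imp_continuous_on ballI has_derivative_continuous[OF D])
  have ec: "continuous_on UNIV ?e" by (intro continuous_intros)
  have "((\<lambda>x. - \<i> * complex_of_real (x \<bullet> \<eta>)) has_derivative (\<lambda>h. - \<i> * of_real (h \<bullet> \<eta>))) (at x)" for x
    by (intro bounded_linear_imp_has_derivative bounded_linear_const_mult
        bounded_linear_compose[OF bounded_linear_of_real bounded_linear_inner_left])
  from has_derivative_compose[OF this DERIV_exp[unfolded has_field_derivative_def]]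
  have De: "(?e has_derivative (\<lambda>h. ?e x * (- \<i> * of_real (h \<bullet> \<eta>)))) (at x)" for x .
  have "(LINT x|lborel. g x * (?e x * (- \<i> * of_real (v \<bullet> \<eta>))) + g' x v * ?e x) = 0"
  proof (rule integral_deriv_compact_support[OF has_derivative_mult[OF D De] _ K])
    show "continuous_on UNIV (\<lambda>x. g x * (?e x * (- \<i> * of_real (v \<bullet> \<eta>))) + g' x v * ?e x)"
      by (intro continuous_intros gc ec c)
  qed (use 0 in auto)
  note 1 = this
  have "g' x v = 0" if "x \<notin> K" for x
    by (rule has_derivative_zero_outside[OF D K 0 that])
  then have i1: "integrable lborel (\<lambda>x. g' x v * ?e x)" and i2: "integrable lborel (\<lambda>x. g x * ?e x)"
    using 0 by (auto intro!: integrable_compact_support[OF _ K] continuous_intros gc c)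
  have "(LINT x|lborel. g x * (?e x * (- \<i> * of_real (v \<bullet> \<eta>))) + g' x v * ?e x)
     = (LINT x|lborel. (- \<i> * of_real (v \<bullet> \<eta>)) * (g x * ?e x) + g' x v * ?e x)"
    by (simp only: mult_ac)
  also have "\<dots> = (- \<i> * of_real (v \<bullet> \<eta>)) * ft g \<eta> + ft (\<lambda>x. g' x v) \<eta>"
    unfolding ft_def
    by (subst Bochner_Integration.integral_add[OF integrable_mult_right[OF i2] i1])
       (simp only: integral_mult_right_zero)
  finally show ?thesis using 1 by (simp add: add_eq_0_iff)
qed

lemma ft_norm_le: "cmod (ft g \<eta>) \<le> (LINT y|lborel. cmod (g y))"
  unfolding ft_def
  by (rule order_trans[OF integral_norm_bound]) (simp add: norm_mult)

lemma ft_decay_direction: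
  fixes g :: "'a::euclidean_space \<Rightarrow> complex"
  assumes K: "compact K"
  shows "smooth_on UNIV g \<Longrightarrow> (\<And>x. x \<notin> K \<Longrightarrow> g x = 0) \<Longrightarrow>
    \<exists>C. \<forall>\<eta>. \<bar>v \<bullet> \<eta>\<bar> ^ N * cmod (ft g \<eta>) \<le> C"
proof (induction N arbitrary: g)
  case 0 then show ?case using ft_norm_le by auto
next
  case (Suc N)
  let ?g' = "\<lambda>x. frechet_derivative g (at x)"
  note D = smooth_on_deriv[OF Suc.prems(1)]
  have "?g' x v = 0" if "x \<notin> K" for x
    by (rule has_derivative_zero_outside[OF D(1)[OF UNIV_I] K Suc.prems(2) that])
  from Suc.IH[OF D(2) this] obtain C where C: "\<And>\<eta>. \<bar>v \<bullet> \<eta>\<bar> ^ N * cmod (ft (\<lambda>x. ?g' x v) \<eta>) \<le> C"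
    by blast
  have "ft (\<lambda>x. ?g' x v) \<eta> = \<i> * of_real (v \<bullet> \<eta>) * ft g \<eta>" for \<eta>
    by (rule ft_deriv[OF D(1)[OF UNIV_I] smooth_on_cont[OF D(2)] K Suc.prems(2)])
  with C show ?case by (auto simp: norm_mult mult_ac intro!: exI[of _ C])
qed

lemma one_plus_power_le: "(1 + l) ^ N \<le> 2 ^ N * (1 + l ^ N)" if "l \<ge> 0" for l :: real
proof -
  have "(1 + l) ^ N \<le> (2 * max 1 l) ^ N" using that by (intro power_mono) auto
  also have "\<dots> \<le> 2 ^ N * (1 + l ^ N)" using that by (auto simp: power_mult_distrib max_def)
  finally show ?thesis .
qed

lemma ft_decay:
  fixes g :: "'a::euclidean_space \<Rightarrow> complex"
  assumes K: "compact K" and g: "smooth_on UNIV g" "\<And>x. x \<notin> K \<Longrightarrow> g x = 0"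
  shows "\<exists>C. \<forall>\<eta>. cmod (ft g \<eta>) * (1 + norm \<eta>) ^ N \<le> C"
proof -
  let ?n = "real DIM('a)"
  have "\<forall>v. \<exists>C. \<forall>\<eta>. \<bar>v \<bullet> \<eta>\<bar> ^ N * cmod (ft g \<eta>) \<le> C"
    using ft_decay_direction[OF K g(1)] g(2) by blast
  then obtain C where C: "\<And>v \<eta>. \<bar>v \<bullet> \<eta>\<bar> ^ N * cmod (ft g \<eta>) \<le> C v"
    by metis
  obtain C0 where C0: "\<And>\<eta>. cmod (ft g \<eta>) \<le> C0" using ft_norm_le by blast
  have "cmod (ft g \<eta>) * (1 + norm \<eta>) ^ N \<le> 2 ^ N * C0 + 2 ^ N * (?n ^ N * (\<Sum>b\<in>Basis. \<bar>C b\<bar>))" for \<eta> :: 'a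
  proof -
    \<comment> \<open>Some coordinate carries at least the fraction 1/n of the norm, since the norm
      is at most the sum of the n absolute coordinates; decay along that basis direction is then
      decay in \<open>norm \<eta>\<close>.\<close>
    obtain b :: 'a where b: "b \<in> Basis" "norm \<eta> \<le> ?n * \<bar>b \<bullet> \<eta>\<bar>"
    proof (rule ccontr)
      assume "\<not> thesis"
      with that have "\<And>b. b \<in> Basis \<Longrightarrow> \<bar>\<eta> \<bullet> b\<bar> < norm \<eta> / ?n"
        by (fastforce simp: field_simps inner_commute)
      then have "(\<Sum>b\<in>Basis. \<bar>\<eta> \<bullet> b\<bar>) < (\<Sum>b\<in>(Basis::'a set). norm \<eta> / ?n)"
        by (intro sum_strict_mono) auto
      then show False using norm_le_l1[of \<eta>] by simp
    qed
    have "norm \<eta> ^ N * cmod (ft g \<eta>) \<le> (?n * \<bar>b \<bullet> \<eta>\<bar>) ^ N * cmod (ft g \<eta>)"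
      by (intro mult_right_mono power_mono b) auto
    also have "\<dots> = ?n ^ N * (\<bar>b \<bullet> \<eta>\<bar> ^ N * cmod (ft g \<eta>))" by (simp add: power_mult_distrib)
    also have "\<dots> \<le> ?n ^ N * \<bar>C b\<bar>" by (intro mult_left_mono order_trans[OF C]) auto
    also have "\<dots> \<le> ?n ^ N * (\<Sum>b\<in>Basis. \<bar>C b\<bar>)"
      using b by (intro mult_left_mono member_le_sum) auto
    finally have 1: "norm \<eta> ^ N * cmod (ft g \<eta>) \<le> ?n ^ N * (\<Sum>b\<in>Basis. \<bar>C b\<bar>)" .
    have "cmod (ft g \<eta>) * (1 + norm \<eta>) ^ N \<le> cmod (ft g \<eta>) * (2 ^ N * (1 + norm \<eta> ^ N))"
      by (intro mult_left_mono one_plus_power_le) auto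
    also have "\<dots> = 2 ^ N * cmod (ft g \<eta>) + 2 ^ N * (norm \<eta> ^ N * cmod (ft g \<eta>))"
      by (simp add: algebra_simps)
    also have "\<dots> \<le> 2 ^ N * C0 + 2 ^ N * (?n ^ N * (\<Sum>b\<in>Basis. \<bar>C b\<bar>))"
      by (intro add_mono mult_left_mono C0 1) auto
    finally show ?thesis .
  qed
  then show ?thesis by blast
qed

lemma borel_measurable_pair_continuous:
  fixes f :: "'a::euclidean_space \<times> 'b::euclidean_space \<Rightarrow> 'c::topological_space"
  assumes "continuous_on UNIV f"
  shows "f \<in> borel_measurable (lborel \<Otimes>\<^sub>M lborel)"
  unfolding lborel_prod using borel_measurable_continuous_onI[OF assms] by simp

section \<open>Product integrals, Gaussians and Fourier inversion\<close>

lemma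
  fixes F :: "'a::euclidean_space \<Rightarrow> real \<Rightarrow> 'c::{real_normed_field,banach,second_countable_topology}"
  assumes F: "\<And>b. b \<in> Basis \<Longrightarrow> integrable lborel (F b)"
  shows integrable_prod_Basis: "integrable lborel (\<lambda>x::'a. \<Prod>b\<in>Basis. F b (x \<bullet> b))"
    and integral_prod_Basis: "(LINT x|lborel. (\<Prod>b\<in>Basis. F b (x \<bullet> b))) = (\<Prod>b\<in>Basis. integral\<^sup>L lborel (F b))"
proof -
  interpret product_sigma_finite "\<lambda>_::'a. lborel :: real measure" by standard
  let ?T = "\<lambda>f. \<Sum>b\<in>Basis. f b *\<^sub>R (b::'a)"
  have [measurable]: "\<And>b. b \<in> Basis \<Longrightarrow> F b \<in> borel_measurable borel" using F by auto
  have m: "(\<lambda>x::'a. \<Prod>b\<in>Basis. F b (x \<bullet> b)) \<in> borel_measurable borel" by measurable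
  have T: "?T \<in> (\<Pi>\<^sub>M b\<in>Basis. lborel) \<rightarrow>\<^sub>M borel" by measurable
  have e: "(\<Prod>b\<in>Basis. F b (?T f \<bullet> b)) = (\<Prod>b\<in>Basis. F b (f b))" for f
    by (rule prod.cong[OF refl]) (simp add: inner_sum_left_Basis)
  show "integrable lborel (\<lambda>x::'a. \<Prod>b\<in>Basis. F b (x \<bullet> b))"
    unfolding lborel_eq[where 'a='a] using product_integrable_prod[of "Basis :: 'a set" F] F
    by (simp add: integrable_distr_eq[OF T m] e)
  show "(LINT x|lborel. (\<Prod>b\<in>Basis. F b (x \<bullet> b))) = (\<Prod>b\<in>Basis. integral\<^sup>L lborel (F b))"
    unfolding lborel_eq[where 'a='a] using product_integral_prod[of "Basis :: 'a set" F] F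
    by (simp add: integral_distr[OF T m] e)
qed

lemma integrable_inverse_1_plus_square_lborel: "integrable lborel (\<lambda>t::real. inverse (1 + t\<^sup>2))"
  using integrable_inverse_1_plus_square by (simp add: set_integrable_def einterval_def)

text \<open>Each coordinate satisfies 1 + (x . b)^2 <= (1 + |x|)^2, so one square per coordinate
  accounts for the exponent \<open>2 * DIM('a)\<close> and the majorant is a product of
  one-dimensional integrable functions.\<close>

lemma integrable_inverse_1_plus_norm:
  "integrable lborel (\<lambda>x::'a::euclidean_space. inverse ((1 + norm x) ^ (2 * DIM('a))))"
proof (rule Bochner_Integration.integrable_bound)
  show "integrable lborel (\<lambda>x::'a. \<Prod>b\<in>Basis. inverse (1 + (x \<bullet> b)\<^sup>2))"
    by (rule integrable_prod_Basis[OF integrable_inverse_1_plus_square_lborel])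
  have "inverse ((1 + norm x) ^ (2 * DIM('a))) \<le> (\<Prod>b\<in>Basis. inverse (1 + (x \<bullet> b)\<^sup>2))" for x :: 'a
  proof -
    have "(\<Prod>b\<in>(Basis::'a set). inverse ((1 + norm x)\<^sup>2)) \<le> (\<Prod>b\<in>Basis. inverse (1 + (x \<bullet> b)\<^sup>2))"
    proof (intro prod_mono conjI le_imp_inverse_le)
      fix b :: 'a assume "b \<in> Basis"
      then have "\<bar>x \<bullet> b\<bar>\<^sup>2 \<le> (norm x)\<^sup>2" by (intro power_mono Basis_le_norm) auto
      then show "1 + (x \<bullet> b)\<^sup>2 \<le> (1 + norm x)\<^sup>2" 
        using norm_ge_zero[of x] unfolding power2_sum power2_abs one_power2 by linarith
    qed (auto intro: add_pos_nonneg)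
    then show ?thesis by (simp add: power_mult power_inverse)
  qed
  then show "AE x::'a in lborel. norm (inverse ((1 + norm x) ^ (2 * DIM('a)))) \<le> norm (\<Prod>b\<in>Basis. inverse (1 + (x \<bullet> b)\<^sup>2))"
    by (intro AE_I2) (smt (verit) norm_ge_zero real_norm_def zero_le_power inverse_nonnegative_iff_nonnegative)
qed simp

definition gauss :: "'a::euclidean_space \<Rightarrow> complex" where
  "gauss x = of_real (exp (- (norm x)\<^sup>2 / 2))"

lemma gauss_prod: "gauss x = (\<Prod>b\<in>Basis. of_real (exp (- (x \<bullet> b)\<^sup>2 / 2)))"
proof -
  have "(norm x)\<^sup>2 = (\<Sum>b\<in>Basis. (x \<bullet> b)\<^sup>2)"
    unfolding power2_norm_eq_inner euclidean_inner[of x x] by (simp add: power2_eq_square)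
  then have "exp (- (norm x)\<^sup>2 / 2) = (\<Prod>b\<in>Basis. exp (- (x \<bullet> b)\<^sup>2 / 2))"
    by (simp add: exp_sum[symmetric] sum_negf sum_divide_distrib)
  then show ?thesis by (simp add: gauss_def)
qed

text \<open>Up to normalisation this is the characteristic function of the standard normal
  distribution, taken at -w because of the sign in the exponent.\<close>

lemma
  fixes w :: real
  shows integrable_gauss_real: "integrable lborel (\<lambda>t. complex_of_real (exp (- t\<^sup>2 / 2)) * exp (- \<i> * of_real (t * w)))"
    and integral_gauss_real: "(LINT t|lborel. complex_of_real (exp (- t\<^sup>2 / 2)) * exp (- \<i> * of_real (t * w)))
      = of_real (sqrt (2 * pi) * exp (- w\<^sup>2 / 2))"
proof -
  have n: "integrable lborel (\<lambda>t. std_normal_density t)" using integrable_std_normal_moment[of 0] by simp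
  have eq: "complex_of_real (exp (- t\<^sup>2 / 2)) * exp (- \<i> * of_real (t * w)) =
      of_real (sqrt (2 * pi)) * (std_normal_density t *\<^sub>R exp (\<i> * of_real ((- w) * t)))" for t
    by (simp add: std_normal_density_def scaleR_conv_of_real mult_ac)
  have "integrable lborel (\<lambda>t. std_normal_density t *\<^sub>R exp (\<i> * complex_of_real ((- w) * t)))"
    by (rule Bochner_Integration.integrable_bound[OF n]) (auto simp: norm_exp_i_times)
  then show "integrable lborel (\<lambda>t. complex_of_real (exp (- t\<^sup>2 / 2)) * exp (- \<i> * of_real (t * w)))"
    unfolding eq by (rule integrable_mult_right)
  have "(LINT t|lborel. std_normal_density t *\<^sub>R exp (\<i> * complex_of_real ((- w) * t)))
     = char std_normal_distribution (- w)"
    unfolding char_def by (subst integral_density) (auto simp: normal_density_nonneg)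
  then show "(LINT t|lborel. complex_of_real (exp (- t\<^sup>2 / 2)) * exp (- \<i> * of_real (t * w)))
      = of_real (sqrt (2 * pi) * exp (- w\<^sup>2 / 2))"
    unfolding eq integral_mult_right_zero by (simp add: char_std_normal_distribution)
qed

lemma gauss_exp_prod:
  "gauss x * exp (- \<i> * of_real (x \<bullet> \<eta>)) =
    (\<Prod>b\<in>Basis. complex_of_real (exp (- (x \<bullet> b)\<^sup>2 / 2)) * exp (- \<i> * of_real ((x \<bullet> b) * (\<eta> \<bullet> b))))"
proof -
  have "exp (- \<i> * of_real (x \<bullet> \<eta>)) = (\<Prod>b\<in>Basis. exp (- \<i> * complex_of_real ((x \<bullet> b) * (\<eta> \<bullet> b))))"
    by (simp add: euclidean_inner[of x \<eta>] sum_distrib_left sum_negf[symmetric] exp_sum[symmetric])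
  then show ?thesis by (simp only: gauss_prod prod.distrib)
qed

lemma ft_gauss: "ft gauss (\<eta>::'a::euclidean_space) = of_real (sqrt (2 * pi)) ^ DIM('a) * gauss \<eta>"
  unfolding ft_def gauss_exp_prod
  unfolding integral_prod_Basis[OF integrable_gauss_real] integral_gauss_real
  by (simp add: prod.distrib gauss_prod)

lemma integrable_gauss: "integrable lborel (gauss :: 'a::euclidean_space \<Rightarrow> complex)"
  using integrable_prod_Basis[OF integrable_gauss_real, of "\<lambda>_. 0"]
  by (simp add: gauss_prod[abs_def])

lemma norm_gauss_le: "cmod (gauss x) \<le> 1" by (simp add: gauss_def)

lemma continuous_gauss: "continuous_on UNIV gauss"
  unfolding gauss_def by (intro continuous_intros) auto

lemma gauss_measurable [measurable]: "gauss \<in> borel_measurable borel"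
  by (intro borel_measurable_continuous_onI continuous_gauss)

lemma lborel_integral_affine:
  fixes f :: "'a::euclidean_space \<Rightarrow> complex"
  assumes [measurable]: "f \<in> borel_measurable borel" and c: "c \<noteq> 0"
  shows "integral\<^sup>L lborel f = of_real (\<bar>c\<bar> ^ DIM('a)) * (LINT x|lborel. f (t + c *\<^sub>R x))"
  by (subst lborel_affine[OF c, of t], subst integral_density)
     (auto simp: integral_distr scaleR_conv_of_real)

text \<open>Inversion by Gaussian regularisation. The factor gauss(\<eta>/r) makes the double
  integral absolutely convergent, and Fubini with \<open>ft_gauss\<close> turns it into an average
  of g against a Gaussian of width 1/r around y. Dominated convergence as r tends to infinity,
  applied to both expressions, gives the formula.\<close>

lemma fourier_inversion:
  fixes g :: "'a::euclidean_space \<Rightarrow> complex"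
  assumes c: "continuous_on UNIV g" and K: "compact K" and 0: "\<And>x. x \<notin> K \<Longrightarrow> g x = 0"
    and i: "integrable lborel (ft g)"
  shows "(LINT \<eta>|lborel. ft g \<eta> * exp (\<i> * of_real (y \<bullet> \<eta>))) = of_real (2 * pi) ^ DIM('a) * g y"
proof -
  let ?n = "DIM('a)"
  let ?e = "\<lambda>y \<eta>. exp (\<i> * complex_of_real (y \<bullet> \<eta>))"
  define c0 where "c0 = complex_of_real (sqrt (2 * pi)) ^ ?n"
  have [measurable]: "g \<in> borel_measurable borel" by (rule borel_measurable_continuous_onI[OF c])
  have [measurable]: "ft g \<in> borel_measurable borel" using i by auto
  have [measurable]: "?e y \<in> borel_measurable borel" for y
    by (intro borel_measurable_continuous_onI continuous_intros)
  have e1: "cmod (?e y \<eta>) = 1" for y \<eta> by (rule norm_exp_i_times)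
  have ig: "integrable lborel g" by (rule integrable_compact_support[OF c K 0])
  obtain B where B: "\<And>x. cmod (g x) \<le> B" using bounded_compact_support[OF c K 0] by blast
  \<comment> \<open>The scale is r = k + 1, so that 1/r is a genuine inverse already for k =
    0.\<close>
  define L where "L = (\<lambda>k. LINT \<eta>|lborel. ft g \<eta> * ?e y \<eta> * gauss (inverse (real (Suc k)) *\<^sub>R \<eta>))"
  have k0: "(\<lambda>k. inverse (real (Suc k))) \<longlonglongrightarrow> 0" by (rule LIMSEQ_inverse_real_of_nat)
  have "L \<longlonglongrightarrow> (LINT \<eta>|lborel. ft g \<eta> * ?e y \<eta> * gauss (0 *\<^sub>R \<eta>))"
    unfolding L_def
  proof (rule integral_dominated_convergence[where w = "\<lambda>\<eta>. cmod (ft g \<eta>)"])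
    show "AE \<eta> in lborel. (\<lambda>k. ft g \<eta> * ?e y \<eta> * gauss (inverse (real (Suc k)) *\<^sub>R \<eta>)) \<longlonglongrightarrow> ft g \<eta> * ?e y \<eta> * gauss (0 *\<^sub>R \<eta>)"
      by (intro AE_I2 tendsto_mult tendsto_const continuous_on_tendsto_compose[OF continuous_gauss] tendsto_scaleR k0) auto
    show "AE \<eta> in lborel. cmod (ft g \<eta> * ?e y \<eta> * gauss (inverse (real (Suc k)) *\<^sub>R \<eta>)) \<le> cmod (ft g \<eta>)" for k
      by (intro AE_I2) (simp add: norm_mult e1 mult_right_le_one_le norm_gauss_le)
  qed (use i in auto)
  then have lim1: "L \<longlonglongrightarrow> (LINT \<eta>|lborel. ft g \<eta> * ?e y \<eta>)" by (simp add: gauss_def)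
  have L: "L k = c0 * (LINT z|lborel. g (y + inverse (real (Suc k)) *\<^sub>R z) * gauss z)" for k
  proof -
    define r where "r = real (Suc k)"
    have r: "r > 0" by (simp add: r_def)
    have rg: "integrable lborel (\<lambda>\<eta>::'a. gauss (inverse r *\<^sub>R \<eta>))"
    proof -
      have "integrable (density (distr lborel borel (\<lambda>x::'a. 0 + r *\<^sub>R x)) (\<lambda>_. ennreal (\<bar>r\<bar> ^ ?n))) (\<lambda>\<eta>::'a. gauss (inverse r *\<^sub>R \<eta>))"
        using r integrable_gauss by (subst integrable_density) (auto simp: integrable_distr_eq)
      then show ?thesis using lborel_affine[of r "0::'a"] r by simp
    qed
    have "integrable (lborel \<Otimes>\<^sub>M lborel) (\<lambda>z. (case z of (x, \<eta>) \<Rightarrow> g x * gauss (inverse r *\<^sub>R \<eta>)) * (\<lambda>(x, \<eta>). ?e (y - x) \<eta>) z)"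
    proof (rule integrable_times_unimodular[OF integrable_pair_mult[OF ig rg]])
      show "(\<lambda>(x, \<eta>). ?e (y - x) \<eta>) \<in> borel_measurable (lborel \<Otimes>\<^sub>M lborel)"
        unfolding case_prod_beta
        by (intro borel_measurable_pair_continuous continuous_intros)
    qed (auto simp: e1)
    then have ii: "integrable (lborel \<Otimes>\<^sub>M lborel) (\<lambda>(x, \<eta>). g x * gauss (inverse r *\<^sub>R \<eta>) * ?e (y - x) \<eta>)"
      by (simp add: case_prod_unfold)
    have "L k = (LINT \<eta>|lborel. LINT x|lborel. g x * gauss (inverse r *\<^sub>R \<eta>) * ?e (y - x) \<eta>)"
      unfolding L_def ft_def r_def[symmetric]
    proof (rule Bochner_Integration.integral_cong[OF refl])
      fix \<eta>
      have "exp (- \<i> * of_real (x \<bullet> \<eta>)) * ?e y \<eta> = ?e (y - x) \<eta>" for x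
        unfolding exp_add[symmetric] by (simp add: inner_diff_left algebra_simps)
      then have "g x * exp (- \<i> * of_real (x \<bullet> \<eta>)) * ?e y \<eta> * gauss (inverse r *\<^sub>R \<eta>)
         = g x * gauss (inverse r *\<^sub>R \<eta>) * ?e (y - x) \<eta>" for x
        by (metis mult.assoc mult.commute)
      then show "(LINT x|lborel. g x * exp (- \<i> * of_real (x \<bullet> \<eta>))) * ?e y \<eta> * gauss (inverse r *\<^sub>R \<eta>)
         = (LINT x|lborel. g x * gauss (inverse r *\<^sub>R \<eta>) * ?e (y - x) \<eta>)"
        by (simp only: integral_mult_left_zero[symmetric])
    qed
    also have "\<dots> = (LINT x|lborel. LINT \<eta>|lborel. g x * gauss (inverse r *\<^sub>R \<eta>) * ?e (y - x) \<eta>)"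
      by (rule lborel_pair.Fubini_integral[OF ii])
    also have "\<dots> = (LINT x|lborel. g x * (of_real (r ^ ?n) * (c0 * gauss (r *\<^sub>R (x - y)))))"
    proof (rule Bochner_Integration.integral_cong[OF refl])
      fix x
      have "(LINT \<eta>|lborel. g x * gauss (inverse r *\<^sub>R \<eta>) * ?e (y - x) \<eta>)
         = g x * (LINT \<eta>|lborel. gauss (inverse r *\<^sub>R \<eta>) * ?e (y - x) \<eta>)"
        by (simp add: mult.assoc)
      also have "(LINT \<eta>|lborel. gauss (inverse r *\<^sub>R \<eta>) * ?e (y - x) \<eta>)
         = of_real (r ^ ?n) * (LINT \<eta>|lborel. gauss \<eta> * exp (- \<i> * of_real (\<eta> \<bullet> (r *\<^sub>R (x - y)))))"
        using r by (subst lborel_integral_affine[of _ r 0])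
          (auto simp: inner_diff_left inner_diff_right inner_commute algebra_simps)
      also have "(LINT \<eta>|lborel. gauss \<eta> * exp (- \<i> * of_real (\<eta> \<bullet> (r *\<^sub>R (x - y))))) = c0 * gauss (r *\<^sub>R (x - y))"
        using ft_gauss[of "r *\<^sub>R (x - y)"] by (simp add: ft_def c0_def)
      finally show "(LINT \<eta>|lborel. g x * gauss (inverse r *\<^sub>R \<eta>) * ?e (y - x) \<eta>) =
        g x * (of_real (r ^ ?n) * (c0 * gauss (r *\<^sub>R (x - y))))" .
    qed
    \<comment> \<open>The substitution x = y + z/r has Jacobian r^(-n), which cancels the r^n left
      by rescaling the frequency variable.\<close>
    also have "\<dots> = of_real (\<bar>inverse r\<bar> ^ ?n) * (LINT z|lborel. g (y + inverse r *\<^sub>R z) * (of_real (r ^ ?n) * (c0 * gauss z)))"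
      using r by (subst lborel_integral_affine[of _ "inverse r" y]) auto
    also have "\<dots> = of_real (\<bar>inverse r\<bar> ^ ?n) * ((LINT z|lborel. g (y + inverse r *\<^sub>R z) * gauss z) * (of_real (r ^ ?n) * c0))"
      by (subst integral_mult_left_zero[symmetric]) (simp only: mult_ac)
    also have "\<dots> = c0 * (LINT z|lborel. g (y + inverse r *\<^sub>R z) * gauss z)"
      using r by (simp add: power_inverse)
    finally show ?thesis by (simp add: r_def)
  qed
  have "(\<lambda>k. LINT z|lborel. g (y + inverse (real (Suc k)) *\<^sub>R z) * gauss z) \<longlonglongrightarrow> (LINT z|lborel. g (y + 0 *\<^sub>R z) * gauss z)"
  proof (rule integral_dominated_convergence[where w = "\<lambda>z. B * cmod (gauss z)"])
    show "AE z in lborel. (\<lambda>k. g (y + inverse (real (Suc k)) *\<^sub>R z) * gauss z) \<longlonglongrightarrow> g (y + 0 *\<^sub>R z) * gauss z"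
      by (intro AE_I2 tendsto_mult tendsto_const continuous_on_tendsto_compose[OF c] tendsto_add tendsto_scaleR k0) auto
    show "AE z in lborel. cmod (g (y + inverse (real (Suc k)) *\<^sub>R z) * gauss z) \<le> B * cmod (gauss z)" for k
      using B by (auto simp: norm_mult intro!: mult_right_mono)
  qed (use integrable_gauss in auto)
  \<comment> \<open>The mass of the Gaussian is its transform at 0, a second factor
    \<open>c0\<close>; the two factors multiply to (2 pi)^n.\<close>
  also have "(LINT z|lborel. g (y + 0 *\<^sub>R z) * gauss z) = g y * ft gauss (0::'a)"
    by (simp add: ft_def)
  also have "\<dots> = g y * c0" by (simp add: ft_gauss c0_def gauss_def)
  finally have "L \<longlonglongrightarrow> c0 * (g y * c0)" unfolding L by (intro tendsto_mult tendsto_const)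
  from LIMSEQ_unique[OF lim1 this]
  have "(LINT \<eta>|lborel. ft g \<eta> * ?e y \<eta>) = (c0 * c0) * g y" by simp
  also have "c0 * c0 = of_real (2 * pi) ^ ?n"
    unfolding c0_def power_mult_distrib[symmetric] of_real_mult[symmetric] by simp
  finally show ?thesis .
qed


lemma continuous_ft:
  fixes g :: "'a::euclidean_space \<Rightarrow> complex"
  assumes "integrable lborel g"
  shows "continuous_on UNIV (ft g)"
  unfolding ft_def
proof (rule continuous_on_sequentiallyI)
  fix u :: "nat \<Rightarrow> 'a" and a assume u: "u \<longlonglongrightarrow> a"
  have [measurable]: "g \<in> borel_measurable borel" using assms by auto
  have "(\<lambda>n. LINT y|lborel. g y * exp (- \<i> * of_real (y \<bullet> u n))) \<longlonglongrightarrow> (LINT y|lborel. g y * exp (- \<i> * of_real (y \<bullet> a)))"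
    by (rule integral_dominated_convergence[where w = "\<lambda>y. cmod (g y)"])
       (use assms u in \<open>auto simp: norm_mult intro!: tendsto_intros\<close>)
  then show "(\<lambda>n. LINT y|lborel. g y * exp (- \<i> * of_real (y \<bullet> u n))) \<longlonglongrightarrow> (LINT y|lborel. g y * exp (- \<i> * of_real (y \<bullet> a)))" .
qed

lemma integrable_ft:
  fixes g :: "'a::euclidean_space \<Rightarrow> complex"
  assumes g: "smooth_on UNIV g" "compact K" "\<And>x. x \<notin> K \<Longrightarrow> g x = 0"
  shows "integrable lborel (\<lambda>\<eta>. cmod (ft g \<eta>) * (1 + norm \<eta>) ^ N)"
proof -
  let ?n = "2 * DIM('a)"
  obtain C where C: "\<And>\<eta>. cmod (ft g \<eta>) * (1 + norm \<eta>) ^ (N + ?n) \<le> C"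
    using ft_decay[OF g(2,1,3)] by blast
  have ig: "integrable lborel g" by (rule integrable_compact_support[OF smooth_on_cont[OF g(1)] g(2,3)])
  have [measurable]: "ft g \<in> borel_measurable borel"
    by (rule borel_measurable_continuous_onI[OF continuous_ft[OF ig]])
  show ?thesis
  proof (rule Bochner_Integration.integrable_bound)
    show "integrable lborel (\<lambda>\<eta>::'a. C * inverse ((1 + norm \<eta>) ^ ?n))"
      by (intro integrable_mult_right integrable_inverse_1_plus_norm)
    have "norm (cmod (ft g \<eta>) * (1 + norm \<eta>) ^ N) \<le> norm (C * inverse ((1 + norm \<eta>) ^ ?n))" for \<eta>
    proof -
      have "1 + norm \<eta> > 0" by (smt (verit) norm_ge_zero)
      then have "cmod (ft g \<eta>) * (1 + norm \<eta>) ^ N \<le> C * inverse ((1 + norm \<eta>) ^ ?n)"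
        using C[of \<eta>] by (simp add: power_add field_simps)
      then show ?thesis using abs_ge_self[of "C * inverse ((1 + norm \<eta>) ^ ?n)"]
        unfolding real_norm_def by (subst abs_of_nonneg) auto
    qed
    then show "AE \<eta> in lborel. norm (cmod (ft g \<eta>) * (1 + norm \<eta>) ^ N) \<le> norm (C * inverse ((1 + norm \<eta>) ^ ?n))"
      by simp
  qed measurable
qed

text \<open>If \<open>f\<close> is not integrable its integral is 0, and the bound holds because
  \<open>g\<close> is nonnegative. This covers the inner integrals of iterated integrals, whose
  measurability is left open.\<close>

lemma integral_norm_le_integral:
  fixes f :: "'a \<Rightarrow> 'b::{banach,second_countable_topology}"
  assumes "integrable M g" "\<And>x. norm (f x) \<le> g x"
  shows "norm (integral\<^sup>L M f) \<le> integral\<^sup>L M g"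
proof (cases "integrable M f")
  case True
  have "norm (integral\<^sup>L M f) \<le> (LINT x|M. norm (f x))" by (rule integral_norm_bound)
  also have "\<dots> \<le> integral\<^sup>L M g"
    by (intro Bochner_Integration.integral_mono integrable_norm True assms)
  finally show ?thesis .
next
  case False
  have "0 \<le> g x" for x using assms(2)[of x] norm_ge_zero order_trans by blast
  then show ?thesis using False by (simp add: not_integrable_integral_eq)
qed

text \<open>Inserting the inversion formula for g and exchanging integrals gives a convolution, with
  \<open>w\<close> merely integrable. Shifting g by s contributes only the unimodular factor exp(-i
  s . \<eta>), so norm estimates under the integral are uniform in s.\<close>

lemma ft_mult:
  fixes g w :: "'a::euclidean_space \<Rightarrow> complex"
  assumes g: "smooth_on UNIV g" "compact K" "\<And>x. x \<notin> K \<Longrightarrow> g x = 0" and w: "integrable lborel w"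
  shows "of_real (2 * pi) ^ DIM('a) * ft (\<lambda>y. g (y - s) * w y) \<xi> =
    (LINT \<eta>|lborel. ft g \<eta> * exp (- \<i> * of_real (s \<bullet> \<eta>)) * ft w (\<xi> - \<eta>))"
proof -
  have i: "integrable lborel (ft g)"
    proof -
    have "integrable lborel g" by (rule integrable_compact_support[OF smooth_on_cont[OF g(1)] g(2,3)])
    then have "ft g \<in> borel_measurable lborel"
      using continuous_ft borel_measurable_continuous_onI by auto
    then show ?thesis using integrable_ft[OF g, of 0] by (simp add: integrable_norm_iff)
  qed
  let ?e = "\<lambda>y \<eta>. exp (\<i> * complex_of_real (y \<bullet> \<eta>))"
  have c: "continuous_on UNIV g" by (rule smooth_on_cont[OF g(1)])
  have inv: "(LINT \<eta>|lborel. ft g \<eta> * ?e y \<eta>) = of_real (2 * pi) ^ DIM('a) * g y" for y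
    by (rule fourier_inversion[OF c g(2) _ i]) (rule g(3))
  have [measurable]: "w \<in> borel_measurable borel" using w by auto
  have "integrable (lborel \<Otimes>\<^sub>M lborel) (\<lambda>z. (case z of (y, \<eta>) \<Rightarrow> w y * ft g \<eta>) * (\<lambda>(y, \<eta>). ?e (y - s) \<eta> * ?e (- y) \<xi>) z)"
  proof (rule integrable_times_unimodular[OF integrable_pair_mult[OF w i]])
    show "(\<lambda>(y, \<eta>). ?e (y - s) \<eta> * ?e (- y) \<xi>) \<in> borel_measurable (lborel \<Otimes>\<^sub>M lborel)"
      unfolding case_prod_beta
      by (intro borel_measurable_pair_continuous continuous_intros)
  qed (auto simp: norm_mult simp del: of_real_minus)
  then have ii: "integrable (lborel \<Otimes>\<^sub>M lborel) (\<lambda>(y, \<eta>). w y * ft g \<eta> * ?e (y - s) \<eta> * ?e (- y) \<xi>)"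
    by (simp add: case_prod_unfold mult.assoc)
  have "of_real (2 * pi) ^ DIM('a) * ft (\<lambda>y. g (y - s) * w y) \<xi> =
      (LINT y|lborel. (of_real (2 * pi) ^ DIM('a) * g (y - s)) * (w y * ?e (- y) \<xi>))"
    unfolding ft_def by (subst integral_mult_right_zero[symmetric]) (simp add: mult_ac)
  also have "\<dots> = (LINT y|lborel. LINT \<eta>|lborel. w y * ft g \<eta> * ?e (y - s) \<eta> * ?e (- y) \<xi>)"
  proof (rule Bochner_Integration.integral_cong[OF refl])
    fix y
    have "(of_real (2 * pi) ^ DIM('a) * g (y - s)) * (w y * ?e (- y) \<xi>)
       = (LINT \<eta>|lborel. (ft g \<eta> * ?e (y - s) \<eta>) * (w y * ?e (- y) \<xi>))"
      by (simp only: inv integral_mult_left_zero)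
    also have "\<dots> = (LINT \<eta>|lborel. w y * ft g \<eta> * ?e (y - s) \<eta> * ?e (- y) \<xi>)"
      by (simp only: mult_ac)
    finally show "(of_real (2 * pi) ^ DIM('a) * g (y - s)) * (w y * ?e (- y) \<xi>) = \<dots>" .
  qed
  also have "\<dots> = (LINT \<eta>|lborel. LINT y|lborel. w y * ft g \<eta> * ?e (y - s) \<eta> * ?e (- y) \<xi>)"
    by (rule lborel_pair.Fubini_integral[OF ii, symmetric])
  also have "\<dots> = (LINT \<eta>|lborel. ft g \<eta> * exp (- \<i> * of_real (s \<bullet> \<eta>)) * ft w (\<xi> - \<eta>))"
  proof (rule Bochner_Integration.integral_cong[OF refl])
    fix \<eta>
    have "w y * ft g \<eta> * ?e (y - s) \<eta> * ?e (- y) \<xi> =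
      (ft g \<eta> * exp (- \<i> * of_real (s \<bullet> \<eta>))) * (w y * exp (- \<i> * of_real (y \<bullet> (\<xi> - \<eta>))))" for y
    proof -
      have "?e (y - s) \<eta> * ?e (- y) \<xi> = exp (- \<i> * of_real (s \<bullet> \<eta>)) * exp (- \<i> * of_real (y \<bullet> (\<xi> - \<eta>)))"
        unfolding exp_add[symmetric] by (simp add: inner_diff_left inner_diff_right algebra_simps)
      then show ?thesis by (simp only: mult.assoc) (simp only: mult_ac)
    qed
    then show "(LINT y|lborel. w y * ft g \<eta> * ?e (y - s) \<eta> * ?e (- y) \<xi>) = ft g \<eta> * exp (- \<i> * of_real (s \<bullet> \<eta>)) * ft w (\<xi> - \<eta>)"
      by (simp only: integral_mult_right_zero ft_def)
  qed
  finally show ?thesis .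
qed

text \<open>The points \<open>l *\<^sub>R z\<close> fill a conic neighbourhood of \<open>v\<close>.\<close>

definition rapid :: "'a::euclidean_space \<Rightarrow> real \<Rightarrow> ('a \<Rightarrow> complex) \<Rightarrow> bool" where
  "rapid v r F \<longleftrightarrow> (\<forall>N. \<exists>C. \<forall>z\<in>cball v r. \<forall>l>0. cmod (F (l *\<^sub>R z)) * (1 + l) ^ N \<le> C)"

text \<open>Split the convolution at |\<eta>| = l r / 2. For smaller \<eta> the point z - \<eta>/l
  is still in the ball where \<open>ft w\<close> decays; for larger \<eta> a power of 1 + |\<eta>|
  dominates that of 1 + l and is absorbed by the rapid decay of \<open>ft g\<close>. Uniformity in
  the shift is essential: it will be the ray point t Theta(s), which moves with both
  parameters.\<close>

lemma rapid_ft_mult: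
  fixes g w :: "'a::euclidean_space \<Rightarrow> complex"
  assumes g: "smooth_on UNIV g" "compact K" "\<And>x. x \<notin> K \<Longrightarrow> g x = 0" and w: "integrable lborel w"
    and r: "r > 0" and rapid: "rapid v r (ft w)"
  shows "\<exists>C. \<forall>s. \<forall>z\<in>cball v (r/2). \<forall>l>0. cmod (ft (\<lambda>y. g (y - s) * w y) (l *\<^sub>R z)) * (1 + l) ^ N \<le> C"
proof -
  define M where "M = (LINT y|lborel. cmod (w y))"
  have M: "cmod (ft w \<eta>) \<le> M" for \<eta> unfolding M_def by (rule ft_norm_le)
  have M0: "M \<ge> 0" unfolding M_def by simp
  \<comment> \<open>Chosen for m (1 + l) <= 1 + l r / 2, which is at most 1 + |\<eta>| in the far
    range.\<close>
  define m where "m = min 1 (r/2)"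
  have m: "m > 0" "m \<le> 1" "m \<le> r/2" using r by (auto simp: m_def)
  obtain C where C: "\<And>z l. z \<in> cball v r \<Longrightarrow> l > 0 \<Longrightarrow> cmod (ft w (l *\<^sub>R z)) * (1 + l) ^ N \<le> C"
    using rapid unfolding rapid_def by metis
  define D where "D = max \<bar>C\<bar> (M / m ^ N)"
  have bound: "cmod (ft w (l *\<^sub>R z - \<eta>)) * (1 + l) ^ N \<le> D * (1 + norm \<eta>) ^ N"
    if z: "z \<in> cball v (r/2)" and l: "l > 0" for z l \<eta>
  proof (cases "norm \<eta> \<le> l * (r/2)")
    case True
    have "z - inverse l *\<^sub>R \<eta> \<in> cball v r"
    proof -
      have "norm (inverse l *\<^sub>R \<eta>) \<le> r/2" using True l by (simp add: field_simps)
      with z show ?thesis unfolding mem_cball dist_norm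
        using norm_triangle_ineq[of "v - z" "inverse l *\<^sub>R \<eta>"] by (simp add: algebra_simps)
    qed
    from C[OF this l] have "cmod (ft w (l *\<^sub>R z - \<eta>)) * (1 + l) ^ N \<le> C"
      using l by (simp add: scaleR_diff_right)
    also have "\<dots> \<le> D * 1" by (simp add: D_def)
    also have "\<dots> \<le> D * (1 + norm \<eta>) ^ N" by (intro mult_left_mono one_le_power) (auto simp: D_def)
    finally show ?thesis .
  next
    case False
    have "m * (1 + l) \<le> 1 + l * (r/2)"
    proof -
      have "l * m \<le> l * (r/2)" using m l by (intro mult_left_mono) auto
      then show ?thesis using m by (simp only: distrib_left mult.commute[of m] mult_1_right)
    qed
    also have "\<dots> \<le> 1 + norm \<eta>" using False by simp
    finally have "(m * (1 + l)) ^ N \<le> (1 + norm \<eta>) ^ N" using m l by (intro power_mono) auto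
    then have "(1 + l) ^ N \<le> (1 + norm \<eta>) ^ N / m ^ N"
      using m unfolding power_mult_distrib by (simp add: field_simps)
    then have "cmod (ft w (l *\<^sub>R z - \<eta>)) * (1 + l) ^ N \<le> M * ((1 + norm \<eta>) ^ N / m ^ N)"
      using l M0 by (intro mult_mono M) auto
    also have "\<dots> = (M / m ^ N) * (1 + norm \<eta>) ^ N" by simp
    also have "\<dots> \<le> D * (1 + norm \<eta>) ^ N" by (intro mult_right_mono) (auto simp: D_def)
    finally show ?thesis .
  qed
  define J where "J = (LINT \<eta>|lborel. cmod (ft g \<eta>) * (1 + norm \<eta>) ^ N)"
  have "cmod (ft (\<lambda>y. g (y - s) * w y) (l *\<^sub>R z)) * (1 + l) ^ N \<le> D * J"
    if z: "z \<in> cball v (r/2)" and l: "l > 0" for z l s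
  proof -
    have "cmod (ft (\<lambda>y. g (y - s) * w y) (l *\<^sub>R z)) \<le> (2 * pi) ^ DIM('a) * cmod (ft (\<lambda>y. g (y - s) * w y) (l *\<^sub>R z))"
    proof -
      have "1 \<le> (2 * pi) ^ DIM('a)" using pi_gt3 by (intro one_le_power) linarith
      from mult_right_mono[OF this norm_ge_zero] show ?thesis by simp
    qed
    also have "\<dots> = cmod (of_real (2 * pi) ^ DIM('a) * ft (\<lambda>y. g (y - s) * w y) (l *\<^sub>R z))"
      by (simp add: norm_mult norm_power)
    also have "\<dots> = cmod (LINT \<eta>|lborel. ft g \<eta> * exp (- \<i> * of_real (s \<bullet> \<eta>)) * ft w (l *\<^sub>R z - \<eta>))"
      using ft_mult[OF g(1,2) _ w, of s] g(3) by simp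
    also have "\<dots> \<le> (LINT \<eta>|lborel. cmod (ft g \<eta>) * (1 + norm \<eta>) ^ N * (D / (1 + l) ^ N))"
    proof (rule integral_norm_le_integral)
      show "integrable lborel (\<lambda>\<eta>. cmod (ft g \<eta>) * (1 + norm \<eta>) ^ N * (D / (1 + l) ^ N))"
        by (intro integrable_mult_left integrable_ft[OF g])
      fix \<eta>
      have "cmod (ft w (l *\<^sub>R z - \<eta>)) \<le> (1 + norm \<eta>) ^ N * (D / (1 + l) ^ N)"
        using bound[OF z l, of \<eta>] l by (simp add: field_simps)
      from mult_left_mono[OF this, of "cmod (ft g \<eta>)"]
      show "cmod (ft g \<eta> * exp (- \<i> * of_real (s \<bullet> \<eta>)) * ft w (l *\<^sub>R z - \<eta>))
          \<le> cmod (ft g \<eta>) * (1 + norm \<eta>) ^ N * (D / (1 + l) ^ N)"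
        by (simp add: norm_mult)
    qed
    also have "\<dots> = D * J / (1 + l) ^ N" by (simp add: J_def)
    finally show ?thesis using l by (simp add: field_simps)
  qed
  then show ?thesis by blast
qed

section \<open>Ray integrals and Fubini\<close>

text \<open>For the complete Lebesgue measure, measurability is itself invariant under changes on
  null sets; if it fails, both integrals are 0.\<close>

lemma integral_cong_AE_lebesgue:
  fixes u v :: "'a::euclidean_space \<Rightarrow> complex"
  assumes "AE x in lebesgue. u x = v x"
  shows "integral\<^sup>L lebesgue u = integral\<^sup>L lebesgue v"
proof (cases "u \<in> borel_measurable lebesgue")
  case True
  then have "v \<in> borel_measurable lebesgue" by (rule borel_measurable_AE[OF _ assms])
  with True show ?thesis by (intro integral_cong_AE assms)
next
  case False
  moreover have "v \<notin> borel_measurable lebesgue"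
    using False borel_measurable_AE[of v u] assms by (auto simp: eq_commute)
  ultimately show ?thesis
    by (metis borel_measurable_integrable not_integrable_integral_eq)
qed

lemma lebesgue_measurable_ex_borel:
  fixes f :: "'a::euclidean_space \<Rightarrow> complex"
  assumes "f \<in> borel_measurable lebesgue"
  shows "\<exists>g\<in>borel_measurable borel. AE x in lborel. f x = g x"
proof -
  have "(\<lambda>x. Re (f x)) \<in> borel_measurable lebesgue" "(\<lambda>x. Im (f x)) \<in> borel_measurable lebesgue"
    using assms by measurable
  from this[THEN completion_ex_borel_measurable_real]
  obtain p q where p[measurable]: "p \<in> borel_measurable lborel" "AE x in lborel. Re (f x) = p x"
    and q[measurable]: "q \<in> borel_measurable lborel" "AE x in lborel. Im (f x) = q x" by blast
  show ?thesis
  proof (rule bexI)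
    show "AE x in lborel. f x = Complex (p x) (q x)"
      using p(2) q(2) by eventually_elim (simp add: complex_eq_iff)
    have "(\<lambda>x. of_real (p x) + \<i> * of_real (q x)) \<in> borel_measurable lborel" by measurable
    then show "(\<lambda>x. Complex (p x) (q x)) \<in> borel_measurable borel" by (simp add: Complex_eq)
  qed
qed

text \<open>Passes to a representative that vanishes everywhere, not just almost everywhere, outside
  a ball, because later arguments use the support pointwise. On the ball, |h| <= 1 + |h|^2 turns
  square integrability into integrability.\<close>

lemma square_integrable_ex_borel:
  fixes f :: "'a::euclidean_space \<Rightarrow> complex"
  assumes f: "square_integrable f" "compactly_supported f"
  obtains g R where "integrable lborel g" "AE x in lebesgue. f x = g x" "\<And>x. x \<notin> cball 0 R \<Longrightarrow> g x = 0" "R > 0"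
proof -
  obtain h where h[measurable]: "h \<in> borel_measurable borel" and fh: "AE x in lborel. f x = h x"
    using lebesgue_measurable_ex_borel f(1) unfolding square_integrable_def by blast
  obtain K where K: "compact K" "AE x in lebesgue. x \<notin> K \<longrightarrow> f x = 0"
    using f(2) unfolding compactly_supported_def by blast
  obtain R where R: "R > 0" "K \<subseteq> cball 0 R"
    using compact_imp_bounded[OF K(1)] unfolding bounded_pos by (auto simp: subset_iff)
  define g where "g = (\<lambda>x. indicator (cball 0 R) x * h x)"
  have fh': "AE x in lebesgue. f x = h x" using fh by (rule AE_completion)
  have "integrable lebesgue (\<lambda>x. (cmod (f x))\<^sup>2)" using f(1) by (simp add: square_integrable_def)
  then have "integrable lebesgue (\<lambda>x. (cmod (h x))\<^sup>2)"
    by (rule integrable_cong_AE_imp) (use fh' in \<open>auto intro: measurable_completion\<close>)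
  then have h2: "integrable lborel (\<lambda>x. (cmod (h x))\<^sup>2)" by (simp add: integrable_completion)
  have ind: "integrable lborel (indicator (cball (0::'a) R) :: _ \<Rightarrow> real)"
    using emeasure_bounded_finite[OF bounded_cball, of "0::'a" R] by (simp add: integrable_indicator_iff)
  have ig: "integrable lborel g"
  proof (rule Bochner_Integration.integrable_bound[OF Bochner_Integration.integrable_add[OF ind h2]])
    have "cmod (g x) \<le> indicator (cball 0 R) x + (cmod (h x))\<^sup>2" for x
    proof -
      have "0 \<le> (cmod (h x) - 1/2)\<^sup>2" by simp
      then have "cmod (h x) \<le> 1 + (cmod (h x))\<^sup>2"
        by (simp add: power2_eq_square algebra_simps)
      then show ?thesis by (auto simp: g_def norm_mult split: split_indicator)
    qed
    then show "AE x in lborel. norm (g x) \<le> norm (indicator (cball 0 R) x + (cmod (h x))\<^sup>2 :: real)"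
      by (intro AE_I2) (smt (verit) real_norm_def norm_ge_zero)
  qed (auto simp: g_def intro!: borel_measurable_times borel_measurable_indicator)
  have "AE x in lebesgue. f x = g x"
    using fh' K(2) by eventually_elim (use R in \<open>auto simp: g_def split: split_indicator\<close>)
  moreover have "g x = 0" if "x \<notin> cball 0 R" for x using that by (simp add: g_def)
  ultimately show thesis using that ig R by blast
qed

lemma nn_integral_lborel_triple:
  fixes h :: "('a::euclidean_space \<times> 'b::euclidean_space) \<times> 'c::euclidean_space \<Rightarrow> ennreal"
  assumes "h \<in> borel_measurable borel"
  shows "(\<integral>\<^sup>+p. h p \<partial>lborel) = (\<integral>\<^sup>+t. \<integral>\<^sup>+s. \<integral>\<^sup>+x. h ((x, s), t) \<partial>lborel \<partial>lborel \<partial>lborel)"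
proof -
  have [measurable]: "h \<in> borel_measurable (borel \<Otimes>\<^sub>M borel)" using assms by (simp add: borel_prod)
  have "(\<integral>\<^sup>+p. h p \<partial>lborel) = (\<integral>\<^sup>+t. \<integral>\<^sup>+q. h (q, t) \<partial>lborel \<partial>lborel)"
    unfolding lborel_prod[symmetric, where 'a="'a \<times> 'b" and 'b='c]
    by (rule lborel_pair.nn_integral_snd[symmetric]) simp
  also have "\<dots> = (\<integral>\<^sup>+t. \<integral>\<^sup>+s. \<integral>\<^sup>+x. h ((x, s), t) \<partial>lborel \<partial>lborel \<partial>lborel)"
  proof (rule nn_integral_cong)
    fix t
    have "(\<lambda>q. h (q, t)) \<in> borel_measurable borel" by measurable
    then have "(\<lambda>q. h (q, t)) \<in> borel_measurable (lborel \<Otimes>\<^sub>M lborel)" by (simp add: lborel_prod)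
    from lborel_pair.nn_integral_snd[OF this]
    show "(\<integral>\<^sup>+q. h (q, t) \<partial>lborel) = (\<integral>\<^sup>+s. \<integral>\<^sup>+x. h ((x, s), t) \<partial>lborel \<partial>lborel)"
      by (simp add: lborel_prod)
  qed
  finally show ?thesis .
qed

definition shear :: "(real \<Rightarrow> 'a::euclidean_space) \<Rightarrow> ('a \<times> real) \<times> real \<Rightarrow> ('a \<times> real) \<times> real" where
  "shear \<Theta> = (\<lambda>((x, s), t). ((x + t *\<^sub>R \<Theta> s, s), t))"

lemma shear_measurable [measurable]:
  assumes "continuous_on UNIV \<Theta>" shows "shear \<Theta> \<in> borel_measurable borel"
  unfolding shear_def case_prod_unfold
  by (intro borel_measurable_continuous_onI continuous_intros continuous_on_compose2[OF assms]) auto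

text \<open>For fixed s and t the shear is a translation in x, so integrating over x innermost
  reduces the claim to translation invariance of Lebesgue measure.\<close>

lemma distr_shear:
  fixes \<Theta> :: "real \<Rightarrow> 'a::euclidean_space"
  assumes c: "continuous_on UNIV \<Theta>" shows "distr lborel borel (shear \<Theta>) = lborel"
proof (rule measure_eqI)
  fix A assume "A \<in> sets (distr lborel borel (shear \<Theta>))"
  then have A[measurable]: "A \<in> sets borel" by simp
  note m[measurable] = shear_measurable[OF c]
  have shift: "(\<integral>\<^sup>+x. h (x + w) \<partial>lborel) = (\<integral>\<^sup>+x. h x \<partial>lborel)" if "h \<in> borel_measurable borel"
    for h :: "'a \<Rightarrow> ennreal" and w
    using that by (subst (2) lborel_distr_plus[of w, symmetric]) (simp add: nn_integral_distr add.commute)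
  have "emeasure (distr lborel borel (shear \<Theta>)) A = (\<integral>\<^sup>+p. indicator A (shear \<Theta> p) \<partial>lborel)"
  proof -
    have "shear \<Theta> -` A \<in> sets borel" using measurable_sets[OF m A] by simp
    then have "emeasure lborel (shear \<Theta> -` A) = (\<integral>\<^sup>+p. indicator (shear \<Theta> -` A) p \<partial>lborel)"
      by (subst nn_integral_indicator) auto
    then show ?thesis by (simp add: emeasure_distr indicator_vimage[abs_def] o_def)
  qed
  also have "\<dots> = (\<integral>\<^sup>+t. \<integral>\<^sup>+s. \<integral>\<^sup>+x. indicator A (shear \<Theta> ((x, s), t)) \<partial>lborel \<partial>lborel \<partial>lborel)"
    by (rule nn_integral_lborel_triple) measurable
  also have "\<dots> = (\<integral>\<^sup>+t. \<integral>\<^sup>+s. \<integral>\<^sup>+x. indicator A ((x, s), t) \<partial>lborel \<partial>lborel \<partial>lborel)"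
  proof -
    have "(\<lambda>x::'a. indicator A ((x, s), t) :: ennreal) \<in> borel_measurable borel" for s t
    proof -
      have "(\<lambda>x::'a. ((x, s), t)) \<in> borel_measurable borel"
        by (intro borel_measurable_continuous_onI continuous_intros)
      then show ?thesis by measurable
    qed
    from shift[OF this] show ?thesis by (simp add: shear_def)
  qed
  also have "\<dots> = (\<integral>\<^sup>+p. indicator A p \<partial>lborel)"
    by (rule nn_integral_lborel_triple[symmetric]) measurable
  finally show "emeasure (distr lborel borel (shear \<Theta>)) A = emeasure lborel A" by simp
qed simp

definition ray :: "(real \<Rightarrow> 'a::euclidean_space) \<Rightarrow> ('a \<Rightarrow> complex) \<Rightarrow> 'a \<times> real \<Rightarrow> complex" where
  "ray \<Theta> f = (\<lambda>(x, s). LINT t:{0..}|lebesgue. f (x + t *\<^sub>R \<Theta> s))"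

text \<open>A change of f on a null set can alter individual ray integrals. Since the shear
  preserves measure, the set of (x, s, t) whose point x + t Theta(s) hits the exceptional set is
  null, so for almost every (x, s) this happens only for a null set of t.\<close>

lemma ray_cong_AE:
  fixes f g :: "'a::euclidean_space \<Rightarrow> complex"
  assumes c: "continuous_on UNIV \<Theta>" and eq: "AE x in lebesgue. f x = g x"
  shows "AE q in lebesgue. ray \<Theta> f q = ray \<Theta> g q"
proof -
  have "AE x in lborel. f x = g x" using eq AE_completion_iff by blast
  then obtain N where N: "{x. f x \<noteq> g x} \<subseteq> N" "N \<in> sets borel" "emeasure lborel N = 0"
    by (auto elim: AE_E)
  note [measurable] = N(2) shear_measurable[OF c]
  have mN[measurable]: "(fst \<circ> fst) -` N \<in> sets (borel :: (('a \<times> real) \<times> real) measure)"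
    by (intro measurable_sets_borel[OF _ N(2)] borel_measurable_continuous_onI)
       (auto simp: o_def intro!: continuous_intros)
  have "AE p in lborel. p \<notin> (fst \<circ> fst) -` (N :: 'a set) \<and> (p :: ('a \<times> real) \<times> real) = p"
  proof -
    have "emeasure lborel ((fst \<circ> fst) -` N :: (('a \<times> real) \<times> real) set) = (\<integral>\<^sup>+p. indicator ((fst \<circ> fst) -` N :: (('a \<times> real) \<times> real) set) p \<partial>lborel)"
      using mN by (subst nn_integral_indicator) simp_all
    also have "\<dots> = (\<integral>\<^sup>+t. \<integral>\<^sup>+s. \<integral>\<^sup>+x. indicator ((fst \<circ> fst) -` N) ((x, s::real), t::real) \<partial>lborel \<partial>lborel \<partial>lborel)"
      by (rule nn_integral_lborel_triple) measurable
    also have "\<dots> = (\<integral>\<^sup>+t. \<integral>\<^sup>+s. \<integral>\<^sup>+x. indicator N x \<partial>lborel \<partial>(lborel :: real measure) \<partial>(lborel :: real measure))"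
      by (intro nn_integral_cong) (auto split: split_indicator)
    also have "\<dots> = 0" using N by simp
    finally have "(fst \<circ> fst) -` N \<in> null_sets (lborel :: (('a \<times> real) \<times> real) measure)"
      by (auto simp: null_sets_def)
    from AE_not_in[OF this] show ?thesis by simp
  qed
  then have "AE p in distr lborel borel (shear \<Theta>). (fst \<circ> fst) p \<notin> N"
    unfolding distr_shear[OF c] by simp
  then have "AE p in lborel. (fst \<circ> fst) (shear \<Theta> p) \<notin> N"
    by (rule AE_distrD[rotated]) measurable
  then have "AE p in lborel \<Otimes>\<^sub>M lborel. (fst \<circ> fst) (shear \<Theta> p) \<notin> N"
    unfolding lborel_prod .
  from lborel_pair.AE_pair[OF this]
  have "AE q in lborel. AE t in lborel. (fst \<circ> fst) (shear \<Theta> (q, t)) \<notin> N" .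
  then have "AE q in lborel. ray \<Theta> f q = ray \<Theta> g q"
  proof eventually_elim
    fix q :: "'a \<times> real"
    assume "AE t in lborel. (fst \<circ> fst) (shear \<Theta> (q, t)) \<notin> N"
    then have "AE t in lebesgue. (fst \<circ> fst) (shear \<Theta> (q, t)) \<notin> N" by (rule AE_completion)
    then have "AE t in lebesgue. f (fst q + t *\<^sub>R \<Theta> (snd q)) = g (fst q + t *\<^sub>R \<Theta> (snd q))"
      by eventually_elim (use N(1) in \<open>auto simp: shear_def case_prod_unfold\<close>)
    then show "ray \<Theta> f q = ray \<Theta> g q"
      unfolding ray_def case_prod_unfold set_lebesgue_integral_def
      by (intro integral_cong_AE_lebesgue) (erule eventually_mono, simp)
  qed
  then show ?thesis by (rule AE_completion)
qed


lemma integrable_times_bounded: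
  fixes f u :: "'a \<Rightarrow> complex"
  assumes f: "integrable M f" and u: "u \<in> borel_measurable M" "\<And>x. cmod (u x) \<le> B"
  shows "integrable M (\<lambda>x. f x * u x)"
proof (rule Bochner_Integration.integrable_bound[where f = "\<lambda>x. B * cmod (f x)"])
  show "integrable M (\<lambda>x. B * cmod (f x))" using f by simp
  show "(\<lambda>x. f x * u x) \<in> borel_measurable M" using f u by measurable
  have "cmod (f x * u x) \<le> norm (B * cmod (f x))" for x
  proof -
    have "0 \<le> B" using u(2)[of x] norm_ge_zero order_trans by blast
    then show ?thesis using mult_right_mono[OF u(2)[of x] norm_ge_zero[of "f x"]]
      by (simp add: norm_mult mult.commute)
  qed
  then show "AE x in M. cmod (f x * u x) \<le> norm (B * cmod (f x))" by simp
qed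

text \<open>The integrand after the substitution \<open>y = x + t \<Theta>(s)\<close>, with a weight \<open>h\<close> along the ray.\<close>

definition osc :: "(real \<Rightarrow> 'a::euclidean_space) \<Rightarrow> ('a \<Rightarrow> complex) \<Rightarrow> ('a \<Rightarrow> complex) \<Rightarrow> (real \<Rightarrow> complex) \<Rightarrow>
    (real \<Rightarrow> complex) \<Rightarrow> 'a \<times> real \<Rightarrow> ('a \<times> real) \<times> real \<Rightarrow> complex" where
  "osc \<Theta> f \<rho> \<kappa> h = (\<lambda>(\<xi>, \<tau>) ((y, s), t). f y * \<kappa> s * h t *
     (\<rho> (y - t *\<^sub>R \<Theta> s) * exp (- \<i> * of_real ((y - t *\<^sub>R \<Theta> s) \<bullet> \<xi> + s * \<tau>))))"

lemma integrable_osc: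
  fixes \<Theta> :: "real \<Rightarrow> 'a::euclidean_space"
  assumes \<Theta>: "continuous_on UNIV \<Theta>" and f: "integrable lborel f"
    and \<rho>: "continuous_on UNIV \<rho>" "compact K" "\<And>x. x \<notin> K \<Longrightarrow> \<rho> x = 0"
    and \<kappa>: "integrable lborel \<kappa>" and h: "integrable lborel h"
  shows "integrable lborel (osc \<Theta> f \<rho> \<kappa> h \<zeta>)"
    and "\<And>t. integrable lborel (\<lambda>q. osc \<Theta> f \<rho> \<kappa> h \<zeta> (q, t))"
proof -
  obtain \<xi> \<tau> where \<zeta>: "\<zeta> = (\<xi>, \<tau>)" by force
  obtain B where B: "\<And>x. cmod (\<rho> x) \<le> B" using bounded_compact_support[OF \<rho>] by blast
  define u where "u = (\<lambda>(y, s, t). \<rho> (y - t *\<^sub>R \<Theta> s) * exp (- \<i> * of_real ((y - t *\<^sub>R \<Theta> s) \<bullet> \<xi> + s * \<tau>)))"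
  have u: "cmod (u p) \<le> B" for p
    using B by (cases p) (simp add: u_def norm_mult del: of_real_add)
  have uc: "continuous_on UNIV u"
    unfolding u_def case_prod_unfold
    by (intro continuous_intros continuous_on_compose2[OF \<rho>(1)] continuous_on_compose2[OF \<Theta>]) auto
  have fk: "integrable lborel (\<lambda>(y, s). f y * \<kappa> s)"
    using integrable_pair_mult[OF f \<kappa>] by (simp add: lborel_prod)
  have "integrable (lborel \<Otimes>\<^sub>M lborel) (\<lambda>(q, t). (case q of (y, s) \<Rightarrow> f y * \<kappa> s) * h t)"
    by (rule integrable_pair_mult[OF fk h])
  then have "integrable lborel (\<lambda>p. (case p of (q, t) \<Rightarrow> (case q of (y, s) \<Rightarrow> f y * \<kappa> s) * h t) * u (fst (fst p), snd (fst p), snd p))"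
    unfolding lborel_prod
  proof (rule integrable_times_bounded)
    show "(\<lambda>p::('a \<times> real) \<times> real. u (fst (fst p), snd (fst p), snd p)) \<in> borel_measurable lborel"
    proof -
      have "continuous_on UNIV (\<lambda>p::('a \<times> real) \<times> real. u (fst (fst p), snd (fst p), snd p))"
        by (intro continuous_on_compose2[OF uc] continuous_intros) auto
      from borel_measurable_continuous_onI[OF this] show ?thesis by simp
    qed
  qed (rule u)
  then show "integrable lborel (osc \<Theta> f \<rho> \<kappa> h \<zeta>)"
    by (simp add: osc_def \<zeta> u_def case_prod_unfold)
  fix t
  have "integrable lborel (\<lambda>q. (case q of (y, s) \<Rightarrow> f y * \<kappa> s) * h t * u (fst q, snd q, t))"
  proof (rule integrable_times_bounded)
    show "(\<lambda>q. u (fst q, snd q, t)) \<in> borel_measurable lborel"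
    proof -
      have "continuous_on UNIV (\<lambda>q. u (fst q, snd q, t))"
        by (intro continuous_on_compose2[OF uc] continuous_intros) auto
      from borel_measurable_continuous_onI[OF this] show ?thesis by simp
    qed
  qed (use fk u in auto)
  then show "integrable lborel (\<lambda>q. osc \<Theta> f \<rho> \<kappa> h \<zeta> (q, t))"
    by (simp add: osc_def \<zeta> u_def case_prod_unfold)
qed

text \<open>One order of integration per estimate: t innermost for \<open>osc_radial\<close>, y
  innermost for \<open>osc_local\<close>, s innermost for \<open>osc_angular\<close>. Joint
  integrability controls only almost every slice in t, whence the assumption on all slices.\<close>

lemma osc_fubini:
  fixes P :: "('a::euclidean_space \<times> real) \<times> real \<Rightarrow> complex"
  assumes P: "integrable lborel P" and Pt: "\<And>t. integrable lborel (\<lambda>q. P (q, t))"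
  shows "integral\<^sup>L lborel P = (LINT q|lborel. LINT t|lborel. P (q, t))"
    and "integral\<^sup>L lborel P = (LINT t|lborel. LINT s|lborel. LINT y|lborel. P ((y, s), t))"
    and "integral\<^sup>L lborel P = (LINT t|lborel. LINT y|lborel. LINT s|lborel. P ((y, s), t))"
proof -
  have i: "integrable (lborel \<Otimes>\<^sub>M lborel) (\<lambda>(q, t). P (q, t))" using P by (simp add: lborel_prod)
  have it: "integrable (lborel \<Otimes>\<^sub>M lborel) (\<lambda>(y, s). P ((y, s), t))" for t
    using Pt[of t] by (simp add: lborel_prod case_prod_unfold)
  show "integral\<^sup>L lborel P = (LINT q|lborel. LINT t|lborel. P (q, t))"
    using lborel_pair.integral_fst'[OF i] by (simp add: lborel_prod)
  have 1: "integral\<^sup>L lborel P = (LINT t|lborel. LINT q|lborel. P (q, t))"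
    using lborel_pair.integral_snd[OF i] by (simp add: lborel_prod)
  show "integral\<^sup>L lborel P = (LINT t|lborel. LINT s|lborel. LINT y|lborel. P ((y, s), t))"
    unfolding 1 using lborel_pair.integral_snd[OF it] by (simp add: lborel_prod case_prod_unfold)
  show "integral\<^sup>L lborel P = (LINT t|lborel. LINT y|lborel. LINT s|lborel. P ((y, s), t))"
    unfolding 1 using lborel_pair.integral_fst'[OF it] by (simp add: lborel_prod case_prod_unfold)
qed

text \<open>The left side is the pullback of \<open>osc\<close> under the shear with t integrated
  out. Beyond T the cutoff and the support of f leave nothing, so the half-line can be truncated and
  its indicator becomes an integrable weight.\<close>

lemma ft_ray:
  fixes \<Theta> :: "real \<Rightarrow> 'a::euclidean_space"
  assumes \<Theta>: "continuous_on UNIV \<Theta>" and f: "integrable lborel f"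
    and \<rho>: "continuous_on UNIV \<rho>" "compact K" "\<And>x. x \<notin> K \<Longrightarrow> \<rho> x = 0"
    and \<kappa>: "integrable lborel \<kappa>"
    and T: "\<And>x s t. \<rho> x \<noteq> 0 \<Longrightarrow> f (x + t *\<^sub>R \<Theta> s) \<noteq> 0 \<Longrightarrow> t \<le> T"
  shows "integrable lborel (\<lambda>(x, s). ray \<Theta> f (x, s) * (\<rho> x * \<kappa> s * exp (- \<i> * of_real (x \<bullet> \<xi> + s * \<tau>))))"
    and "(LINT q|lborel. (case q of (x, s) \<Rightarrow> ray \<Theta> f (x, s) * (\<rho> x * \<kappa> s * exp (- \<i> * of_real (x \<bullet> \<xi> + s * \<tau>)))))
      = integral\<^sup>L lborel (osc \<Theta> f \<rho> \<kappa> (indicator {0..T}) (\<xi>, \<tau>))"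
proof -
  let ?P = "osc \<Theta> f \<rho> \<kappa> (indicator {0..T}) (\<xi>, \<tau>)"
  have "integrable lborel (indicator {0..T} :: real \<Rightarrow> real)"
    by (rule integrable_real_indicator) (auto simp: emeasure_lborel_Icc_eq)
  then have "integrable lborel (\<lambda>t. complex_of_real (indicator {0..T} t))" by (rule integrable_of_real)
  then have h: "integrable lborel (indicator {0..T} :: real \<Rightarrow> complex)"
    by (simp add: of_real_indicator)
  have [measurable]: "f \<in> borel_measurable borel" using f by auto
  have P: "integrable lborel ?P" by (rule integrable_osc(1)[OF \<Theta> f \<rho>(1,2) _ \<kappa> h]) (rule \<rho>(3))
  then have Pm[measurable]: "?P \<in> borel_measurable borel" by auto
  note [measurable] = shear_measurable[OF \<Theta>]
  have i: "integrable lborel (\<lambda>p. ?P (shear \<Theta> p))"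
    by (subst integrable_distr_eq[symmetric, of _ _ borel]) (simp_all add: distr_shear[OF \<Theta>] P)
  have e: "integral\<^sup>L lborel ?P = (LINT p|lborel. ?P (shear \<Theta> p))"
    by (subst distr_shear[OF \<Theta>, symmetric], subst integral_distr) simp_all
  have "(LINT t|lborel. ?P (shear \<Theta> ((x, s), t)))
      = ray \<Theta> f (x, s) * (\<rho> x * \<kappa> s * exp (- \<i> * of_real (x \<bullet> \<xi> + s * \<tau>)))" for x s
  proof -
    let ?c = "\<rho> x * \<kappa> s * exp (- \<i> * of_real (x \<bullet> \<xi> + s * \<tau>))"
    have [measurable]: "(\<lambda>t. f (x + t *\<^sub>R \<Theta> s)) \<in> borel_measurable borel"
    proof -
      have "(\<lambda>t. x + t *\<^sub>R \<Theta> s) \<in> borel_measurable borel"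
        by (intro borel_measurable_continuous_onI continuous_intros)
      then show ?thesis by measurable
    qed
    have "ray \<Theta> f (x, s) = (LINT t|lborel. indicator {0..} t *\<^sub>R f (x + t *\<^sub>R \<Theta> s))"
      unfolding ray_def set_lebesgue_integral_def by (simp add: integral_completion)
    then have "ray \<Theta> f (x, s) * ?c = (LINT t|lborel. (indicator {0..} t *\<^sub>R f (x + t *\<^sub>R \<Theta> s)) * ?c)"
      by (simp only: integral_mult_left_zero)
    also have "\<dots> = (LINT t|lborel. ?P (shear \<Theta> ((x, s), t)))"
      using T[of x _ s]
      by (intro Bochner_Integration.integral_cong refl)
         (force simp: osc_def shear_def mult_ac split: split_indicator)
    finally show ?thesis by simp
  qed
  then have eq: "(\<lambda>q. LINT t|lborel. ?P (shear \<Theta> (q, t))) =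
      (\<lambda>(x, s). ray \<Theta> f (x, s) * (\<rho> x * \<kappa> s * exp (- \<i> * of_real (x \<bullet> \<xi> + s * \<tau>))))"
    by (auto simp: fun_eq_iff)
  have i': "integrable (lborel \<Otimes>\<^sub>M lborel) (\<lambda>p. ?P (shear \<Theta> p))" using i by (simp add: lborel_prod)
  show "integrable lborel (\<lambda>(x, s). ray \<Theta> f (x, s) * (\<rho> x * \<kappa> s * exp (- \<i> * of_real (x \<bullet> \<xi> + s * \<tau>))))"
    using lborel_pair.integrable_fst'[OF i'] unfolding eq .
  show "(LINT q|lborel. (case q of (x, s) \<Rightarrow> ray \<Theta> f (x, s) * (\<rho> x * \<kappa> s * exp (- \<i> * of_real (x \<bullet> \<xi> + s * \<tau>)))))
      = integral\<^sup>L lborel ?P"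
    using lborel_pair.integral_fst'[OF i'] unfolding eq e by (simp add: lborel_prod)
qed

section \<open>Decay of the oscillatory integrals\<close>

lemma power_decay_imp_shifted:
  fixes F :: "'z \<Rightarrow> real \<Rightarrow> real"
  assumes "\<And>N. \<exists>C. \<forall>z\<in>Z. \<forall>l>0. F z l * l ^ N \<le> C" and nn: "\<And>z l. F z l \<ge> 0"
  shows "\<exists>C. \<forall>z\<in>Z. \<forall>l>0. F z l * (1 + l) ^ N \<le> C"
proof -
  obtain A B where A: "\<And>z l. z \<in> Z \<Longrightarrow> l > 0 \<Longrightarrow> F z l * l ^ 0 \<le> A"
    and B: "\<And>z l. z \<in> Z \<Longrightarrow> l > 0 \<Longrightarrow> F z l * l ^ N \<le> B"
    using assms(1) by meson
  have "F z l * (1 + l) ^ N \<le> 2 ^ N * (A + B)" if "z \<in> Z" "l > 0" for z l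
  proof -
    have "F z l * (1 + l) ^ N \<le> F z l * (2 ^ N * (1 + l ^ N))"
      using that by (intro mult_left_mono one_plus_power_le nn) auto
    also have "\<dots> = 2 ^ N * (F z l * l ^ 0 + F z l * l ^ N)" by (simp add: algebra_simps)
    also have "\<dots> \<le> 2 ^ N * (A + B)" using A[OF that] B[OF that] by (intro mult_left_mono add_mono) auto
    finally show ?thesis .
  qed
  then show ?thesis by blast
qed

lemma lborel_integral_eq_Icc:
  fixes g :: "real \<Rightarrow> complex"
  assumes "continuous_on UNIV g" "\<And>s. s \<notin> {c..d} \<Longrightarrow> g s = 0"
  shows "(LINT s|lborel. g s) = integral {c..d} g"
proof -
  have "integrable lborel g" by (rule integrable_compact_support[OF assms(1) compact_Icc assms(2)])
  then have "(LINT s|lborel. g s) = integral UNIV g" by (rule integral_lborel[symmetric])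
  also have "g = (\<lambda>s. if s \<in> {c..d} then g s else 0)" using assms(2) by auto
  then have "integral UNIV g = integral {c..d} g" by (metis integral_restrict_UNIV)
  finally show ?thesis .
qed

lemma cball_Pair:
  assumes "(x, y) \<in> cball (v, w) r" shows "x \<in> cball v r" "y \<in> cball w r"
  using assms dist_fst_le[of "(v, w)" "(x, y)"] dist_snd_le[of "(v, w)" "(x, y)"] by auto

text \<open>With y innermost, fixed s and t give scalar weights and a unimodular factor times the
  transform of a shifted cutoff times f, where the cutoff allows f to be replaced by w. The last
  component of the frequency enters the unimodular factor only, hence \<tau> is arbitrary. The half
  radius comes from \<open>rapid_ft_mult\<close>.\<close>

lemma osc_local:
  fixes \<Theta> :: "real \<Rightarrow> 'a::euclidean_space"
  assumes \<Theta>: "continuous_on UNIV \<Theta>" and f: "integrable lborel f" and w: "integrable lborel w"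
    and \<rho>: "smooth_on UNIV \<rho>" "compact K" "\<And>x. x \<notin> K \<Longrightarrow> \<rho> x = 0"
    and \<kappa>: "integrable lborel \<kappa>" and h: "integrable lborel h"
    and r: "r > 0" "rapid v r (ft w)"
    and eq: "\<And>y s t. h t \<noteq> 0 \<Longrightarrow> \<kappa> s \<noteq> 0 \<Longrightarrow> \<rho> (y - t *\<^sub>R \<Theta> s) * f y = \<rho> (y - t *\<^sub>R \<Theta> s) * w y"
  shows "rapid (v, \<tau>) (r/2) (\<lambda>\<zeta>. integral\<^sup>L lborel (osc \<Theta> f \<rho> \<kappa> h \<zeta>))"
  unfolding rapid_def
proof
  fix N
  have \<rho>c: "continuous_on UNIV \<rho>" by (rule smooth_on_cont[OF \<rho>(1)])
  obtain C where C: "\<And>s z l. z \<in> cball v (r/2) \<Longrightarrow> l > 0 \<Longrightarrow>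
      cmod (ft (\<lambda>y. \<rho> (y - s) * w y) (l *\<^sub>R z)) * (1 + l) ^ N \<le> C"
    using rapid_ft_mult[OF \<rho>(1,2) _ w r, of N] \<rho>(3) by blast
  define I where "I = (\<lambda>g :: real \<Rightarrow> complex. LINT s|lborel. cmod (g s))"
  have "cmod (integral\<^sup>L lborel (osc \<Theta> f \<rho> \<kappa> h (l *\<^sub>R z))) * (1 + l) ^ N \<le> I h * (I \<kappa> * C)"
    if z: "z \<in> cball (v, \<tau>) (r/2)" and l: "l > 0" for z l
  proof -
    define x u where "x = fst z" and "u = snd z"
    then have zz: "z = (x, u)" by simp
    have x: "x \<in> cball v (r/2)" using z cball_Pair unfolding zz by blast
    let ?D = "C / (1 + l) ^ N"
    have inner: "cmod (LINT y|lborel. osc \<Theta> f \<rho> \<kappa> h (l *\<^sub>R z) ((y, s), t)) \<le> cmod (h t) * (cmod (\<kappa> s) * ?D)" for s t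
    proof (cases "h t = 0 \<or> \<kappa> s = 0")
      case True
      then show ?thesis by (auto simp: osc_def zz)
    next
      case False
      define k where "k = \<kappa> s * h t * exp (\<i> * of_real ((t *\<^sub>R \<Theta> s) \<bullet> (l *\<^sub>R x) - s * (l * u)))"
      have "osc \<Theta> f \<rho> \<kappa> h (l *\<^sub>R z) ((y, s), t) =
          k * (\<rho> (y - t *\<^sub>R \<Theta> s) * w y * exp (- \<i> * of_real (y \<bullet> (l *\<^sub>R x))))" for y
      proof -
        have "exp (- \<i> * of_real ((y - t *\<^sub>R \<Theta> s) \<bullet> (l *\<^sub>R x) + s * (l * u))) =
          exp (\<i> * of_real ((t *\<^sub>R \<Theta> s) \<bullet> (l *\<^sub>R x) - s * (l * u))) * exp (- \<i> * of_real (y \<bullet> (l *\<^sub>R x)))"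
          unfolding exp_add[symmetric] by (simp add: inner_diff_left algebra_simps)
        then have "osc \<Theta> f \<rho> \<kappa> h (l *\<^sub>R z) ((y, s), t) =
          (\<rho> (y - t *\<^sub>R \<Theta> s) * f y) * (k * exp (- \<i> * of_real (y \<bullet> (l *\<^sub>R x))))"
          unfolding osc_def zz k_def by (simp only: scaleR_Pair case_prod_conv real_scaleR_def mult_ac)
        also have "\<rho> (y - t *\<^sub>R \<Theta> s) * f y = \<rho> (y - t *\<^sub>R \<Theta> s) * w y" using eq False by blast
        finally show ?thesis by (simp only: mult_ac)
      qed
      then have "(LINT y|lborel. osc \<Theta> f \<rho> \<kappa> h (l *\<^sub>R z) ((y, s), t)) = k * ft (\<lambda>y. \<rho> (y - t *\<^sub>R \<Theta> s) * w y) (l *\<^sub>R x)"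
        by (simp only: integral_mult_right_zero ft_def)
      then have e: "cmod (LINT y|lborel. osc \<Theta> f \<rho> \<kappa> h (l *\<^sub>R z) ((y, s), t))
         = cmod (h t) * (cmod (\<kappa> s) * cmod (ft (\<lambda>y. \<rho> (y - t *\<^sub>R \<Theta> s) * w y) (l *\<^sub>R x)))"
        by (simp add: norm_mult k_def del: of_real_diff)
      have "cmod (ft (\<lambda>y. \<rho> (y - t *\<^sub>R \<Theta> s) * w y) (l *\<^sub>R x)) \<le> ?D"
        using C[OF x l, of "t *\<^sub>R \<Theta> s"] l by (simp add: field_simps)
      then show ?thesis unfolding e by (intro mult_left_mono norm_ge_zero)
    qed
    have "cmod (integral\<^sup>L lborel (osc \<Theta> f \<rho> \<kappa> h (l *\<^sub>R z)))
        = cmod (LINT t|lborel. LINT s|lborel. LINT y|lborel. osc \<Theta> f \<rho> \<kappa> h (l *\<^sub>R z) ((y, s), t))"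
      using osc_fubini(2)[OF integrable_osc[OF \<Theta> f \<rho>c \<rho>(2) _ \<kappa> h, of "l *\<^sub>R z"]] \<rho>(3) by simp
    also have "\<dots> \<le> (LINT t|lborel. cmod (h t) * (I \<kappa> * ?D))"
    proof (rule integral_norm_le_integral)
      show "integrable lborel (\<lambda>t. cmod (h t) * (I \<kappa> * ?D))" using h by simp
      fix t
      have "cmod (LINT s|lborel. LINT y|lborel. osc \<Theta> f \<rho> \<kappa> h (l *\<^sub>R z) ((y, s), t))
        \<le> (LINT s|lborel. cmod (h t) * (cmod (\<kappa> s) * ?D))"
        by (rule integral_norm_le_integral) (use \<kappa> inner in auto)
      then show "cmod (LINT s|lborel. LINT y|lborel. osc \<Theta> f \<rho> \<kappa> h (l *\<^sub>R z) ((y, s), t)) \<le> cmod (h t) * (I \<kappa> * ?D)"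
        by (simp add: I_def)
    qed
    also have "\<dots> = I h * (I \<kappa> * C) / (1 + l) ^ N" by (simp add: I_def)
    finally show ?thesis using l by (simp add: field_simps)
  qed
  then show "\<exists>C. \<forall>z\<in>cball (v, \<tau>) (r/2). \<forall>l>0. cmod (integral\<^sup>L lborel (osc \<Theta> f \<rho> \<kappa> h (l *\<^sub>R z))) * (1 + l) ^ N \<le> C"
    by blast
qed

text \<open>With s innermost, nonstationary phase applies with parameters y, t and the covector, all
  confined to compact sets. As t is only a parameter, \<open>h\<close> may be discontinuous.\<close>

lemma osc_angular:
  fixes \<Theta> \<Theta>' :: "real \<Rightarrow> 'a::euclidean_space"
  assumes \<Theta>: "smooth_on UNIV \<Theta>" "smooth_on UNIV \<Theta>'" "\<And>s. (\<Theta> has_vector_derivative \<Theta>' s) (at s)"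
    and f: "integrable lborel f" "\<And>y. y \<notin> cball 0 R \<Longrightarrow> f y = 0"
    and \<rho>: "smooth_on UNIV \<rho>" "compact K" "\<And>x. x \<notin> K \<Longrightarrow> \<rho> x = 0"
    and \<kappa>: "smooth_on UNIV \<kappa>" "\<And>s. s \<notin> {c'..d'} \<Longrightarrow> \<kappa> s = 0" and cd: "c < c'" "c \<le> d" "d' < d"
    and h: "integrable lborel h" "compact S" "\<And>t. t \<notin> S \<Longrightarrow> h t = 0"
    and nz: "\<And>t s z. t \<in> S \<Longrightarrow> s \<in> {c..d} \<Longrightarrow> z \<in> cball \<omega> r \<Longrightarrow> t * (\<Theta>' s \<bullet> fst z) - snd z \<noteq> 0"
  shows "rapid \<omega> r (\<lambda>\<zeta>. integral\<^sup>L lborel (osc \<Theta> f \<rho> \<kappa> h \<zeta>))"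
  unfolding rapid_def
proof
  fix N
  have \<rho>c: "continuous_on UNIV \<rho>" by (rule smooth_on_cont[OF \<rho>(1)])
  have \<kappa>c: "continuous_on UNIV \<kappa>" by (rule smooth_on_cont[OF \<kappa>(1)])
  have \<Theta>c: "continuous_on UNIV \<Theta>" by (rule smooth_on_cont[OF \<Theta>(1)])
  have \<kappa>0: "\<kappa> s = 0" if "s \<notin> {c..d}" for s using \<kappa>(2)[of s] that cd by force
  have \<kappa>i: "integrable lborel \<kappa>" by (rule integrable_compact_support[OF \<kappa>c compact_Icc \<kappa>0])
  \<comment> \<open>Arguments are read as ((y, t, (x, u)), s), where (x, u) is the covector before
    scaling by l: q = t (Theta'(s) . x) - u is the derivative in s of p = t (Theta(s) . x) - s u,
    and a is \<rho>(y - t Theta(s)) \<kappa>(s).\<close>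
  define q :: "('a \<times> real \<times> 'a \<times> real) \<times> real \<Rightarrow> real" where
    "q = (\<lambda>x. fst (snd (fst x)) * (\<Theta>' (snd x) \<bullet> fst (snd (snd (fst x)))) - snd (snd (snd (fst x))))"
  define p :: "('a \<times> real \<times> 'a \<times> real) \<times> real \<Rightarrow> real" where
    "p = (\<lambda>x. fst (snd (fst x)) * (\<Theta> (snd x) \<bullet> fst (snd (snd (fst x)))) - snd x * snd (snd (snd (fst x))))"
  define a :: "('a \<times> real \<times> 'a \<times> real) \<times> real \<Rightarrow> complex" where
    "a = (\<lambda>x. \<rho> (fst (fst x) - fst (snd (fst x)) *\<^sub>R \<Theta> (snd x)) * \<kappa> (snd x))"
  define Q where "Q = {x. q x \<noteq> 0}"
  have qs: "smooth_on UNIV q" unfolding q_def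
    by (intro smooth_on_diff smooth_on_mult smooth_on_inner smooth_on_compose[OF \<Theta>(2)]
        smooth_on_fst smooth_on_snd smooth_on_id open_UNIV)
  have as: "smooth_on UNIV a" unfolding a_def
    by (intro smooth_on_diff smooth_on_mult smooth_on_scaleR smooth_on_compose[OF \<rho>(1)]
        smooth_on_compose[OF \<kappa>(1)] smooth_on_compose[OF \<Theta>(1)] smooth_on_fst smooth_on_snd smooth_on_id open_UNIV)
  have Q: "open Q" unfolding Q_def
    by (intro open_Collect_neq smooth_on_cont[OF qs] continuous_on_const)
  define Z where "Z = cball (0::'a) R \<times> S \<times> cball \<omega> r"
  define J where "J = (\<lambda>z l. cmod (integral {c..d} (\<lambda>s. a (z, s) * exp (\<i> * of_real (l * p (z, s))))))"
  have J0: "J z l \<ge> 0" for z l unfolding J_def by simp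
  have J: "\<exists>C. \<forall>z\<in>Z. \<forall>l>0. J z l * l ^ N \<le> C" for N
    unfolding J_def
  proof (rule nonstationary_phase[where S = Q and q = q and c' = c' and d' = d'])
    show "smooth_on Q q" "smooth_on Q a" using qs as Q by (auto intro: smooth_on_subset)
    show "compact Z" unfolding Z_def by (intro compact_Times h compact_cball)
    show "Z \<times> {c..d} \<subseteq> Q" using nz by (auto simp: Z_def Q_def q_def)
    show "a (z, s) = 0" if "s \<notin> {c'..d'}" for z s using \<kappa>(2)[OF that] by (simp add: a_def)
    show "((\<lambda>s. p (z, s)) has_real_derivative q (z, s)) (at s)" for z s
    proof -
      have "((\<lambda>s. \<Theta> s \<bullet> w) has_real_derivative \<Theta>' s \<bullet> w) (at s)" for w
        using bounded_linear.has_vector_derivative[OF bounded_linear_inner_left \<Theta>(3)]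
        by (simp add: has_real_derivative_iff_has_vector_derivative)
      then show ?thesis unfolding p_def q_def by (auto intro!: derivative_eq_intros)
    qed
  qed (use cd in \<open>auto simp: Q_def\<close>)
  from power_decay_imp_shifted[of Z J N, OF J J0] obtain C where
    C: "\<And>z l. z \<in> Z \<Longrightarrow> l > 0 \<Longrightarrow> J z l * (1 + l) ^ N \<le> C"
    by blast
  define If Ih where "If = (LINT y|lborel. cmod (f y))" and "Ih = (LINT t|lborel. cmod (h t))"
  have "cmod (integral\<^sup>L lborel (osc \<Theta> f \<rho> \<kappa> h (l *\<^sub>R z))) * (1 + l) ^ N \<le> Ih * (If * C)"
    if z: "z \<in> cball \<omega> r" and l: "l > 0" for z l
  proof -
    define x u where "x = fst z" and "u = snd z"
    then have zz: "z = (x, u)" by simp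
    let ?D = "C / (1 + l) ^ N"
    have inner: "cmod (LINT s|lborel. osc \<Theta> f \<rho> \<kappa> h (l *\<^sub>R z) ((y, s), t)) \<le> cmod (h t) * (cmod (f y) * ?D)" for y t
    proof (cases "h t = 0 \<or> f y = 0")
      case True
      then show ?thesis by (auto simp: osc_def zz)
    next
      case False
      then have Zz: "(y, t, z) \<in> Z" using f(2) h(3) z unfolding Z_def by blast
      define k where "k = f y * h t * exp (- \<i> * of_real (y \<bullet> (l *\<^sub>R x)))"
      let ?g = "\<lambda>s. a ((y, t, z), s) * exp (\<i> * of_real (l * p ((y, t, z), s)))"
      have "osc \<Theta> f \<rho> \<kappa> h (l *\<^sub>R z) ((y, s), t) = k * ?g s" for s
      proof -
        have "exp (- \<i> * of_real ((y - t *\<^sub>R \<Theta> s) \<bullet> (l *\<^sub>R x) + s * (l * u))) =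
          exp (- \<i> * of_real (y \<bullet> (l *\<^sub>R x))) * exp (\<i> * of_real (l * p ((y, t, z), s)))"
          unfolding exp_add[symmetric] p_def by (simp add: inner_diff_left algebra_simps zz)
        then show ?thesis
          unfolding osc_def zz k_def a_def by (simp add: mult_ac)
      qed
      then have "(LINT s|lborel. osc \<Theta> f \<rho> \<kappa> h (l *\<^sub>R z) ((y, s), t)) = k * (LINT s|lborel. ?g s)"
        by (simp only: integral_mult_right_zero)
      also have "(LINT s|lborel. ?g s) = integral {c..d} ?g"
      proof (rule lborel_integral_eq_Icc)
        show "continuous_on UNIV ?g" unfolding p_def a_def
          by (intro continuous_intros continuous_on_compose2[OF \<rho>c] continuous_on_compose2[OF \<kappa>c] continuous_on_compose2[OF \<Theta>c]) auto
      qed (simp add: a_def \<kappa>0)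
      finally have "cmod (LINT s|lborel. osc \<Theta> f \<rho> \<kappa> h (l *\<^sub>R z) ((y, s), t)) = cmod k * J (y, t, z) l"
        by (simp add: norm_mult J_def)
      also have "cmod k = cmod (h t) * cmod (f y)" by (simp add: k_def norm_mult)
      finally have e: "cmod (LINT s|lborel. osc \<Theta> f \<rho> \<kappa> h (l *\<^sub>R z) ((y, s), t))
        = cmod (h t) * (cmod (f y) * J (y, t, z) l)" by (simp only: mult.assoc)
      have "J (y, t, z) l \<le> ?D" using C[OF Zz l] l by (simp add: field_simps)
      then show ?thesis unfolding e by (intro mult_left_mono norm_ge_zero)
    qed
    have "cmod (integral\<^sup>L lborel (osc \<Theta> f \<rho> \<kappa> h (l *\<^sub>R z)))
        = cmod (LINT t|lborel. LINT y|lborel. LINT s|lborel. osc \<Theta> f \<rho> \<kappa> h (l *\<^sub>R z) ((y, s), t))"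
      using osc_fubini(3)[OF integrable_osc[OF \<Theta>c f(1) \<rho>c \<rho>(2) _ \<kappa>i h(1), of "l *\<^sub>R z"]] \<rho>(3) by simp
    also have "\<dots> \<le> (LINT t|lborel. cmod (h t) * (If * ?D))"
    proof (rule integral_norm_le_integral)
      show "integrable lborel (\<lambda>t. cmod (h t) * (If * ?D))" using h by simp
      fix t
      have "cmod (LINT y|lborel. LINT s|lborel. osc \<Theta> f \<rho> \<kappa> h (l *\<^sub>R z) ((y, s), t))
        \<le> (LINT y|lborel. cmod (h t) * (cmod (f y) * ?D))"
        by (rule integral_norm_le_integral) (use f inner in auto)
      then show "cmod (LINT y|lborel. LINT s|lborel. osc \<Theta> f \<rho> \<kappa> h (l *\<^sub>R z) ((y, s), t)) \<le> cmod (h t) * (If * ?D)"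
        by (simp add: If_def)
    qed
    also have "\<dots> = Ih * (If * C) / (1 + l) ^ N" by (simp add: Ih_def)
    finally show ?thesis using l by (simp add: field_simps)
  qed
  then show "\<exists>C. \<forall>z\<in>cball \<omega> r. \<forall>l>0. cmod (integral\<^sup>L lborel (osc \<Theta> f \<rho> \<kappa> h (l *\<^sub>R z))) * (1 + l) ^ N \<le> C"
    by blast
qed

text \<open>With t innermost the phase is linear in t with slope Theta(s) . x. In the application
  the amplitude is switched off at the lower end by h and at the upper end by the spatial cutoff,
  which has then left the support of f; \<open>h0\<close> expresses both at once.\<close>

lemma osc_radial:
  fixes \<Theta> :: "real \<Rightarrow> 'a::euclidean_space"
  assumes \<Theta>: "smooth_on UNIV \<Theta>"
    and f: "integrable lborel f" "\<And>y. y \<notin> cball 0 R \<Longrightarrow> f y = 0"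
    and \<rho>: "smooth_on UNIV \<rho>" "compact K" "\<And>x. x \<notin> K \<Longrightarrow> \<rho> x = 0"
    and \<kappa>: "integrable lborel \<kappa>" "compact S" "\<And>s. s \<notin> S \<Longrightarrow> \<kappa> s = 0"
    and h: "smooth_on UNIV h"
    and h0: "\<And>y s t. y \<in> ball 0 (R + 1) \<Longrightarrow> t \<notin> {c'..d'} \<Longrightarrow> h t * \<rho> (y - t *\<^sub>R \<Theta> s) = 0"
    and cd: "c < c'" "c \<le> d" "d' < d"
    and nz: "\<And>s z. s \<in> S \<Longrightarrow> z \<in> cball \<omega> r \<Longrightarrow> \<Theta> s \<bullet> fst z \<noteq> 0"
  shows "rapid \<omega> r (\<lambda>\<zeta>. integral\<^sup>L lborel (osc \<Theta> f \<rho> \<kappa> (\<lambda>t. indicator {c..d} t * h t) \<zeta>))"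
  unfolding rapid_def
proof
  fix N
  let ?h = "\<lambda>t. indicator {c..d} t * h t"
  have \<rho>c: "continuous_on UNIV \<rho>" by (rule smooth_on_cont[OF \<rho>(1)])
  have hc: "continuous_on UNIV h" by (rule smooth_on_cont[OF h])
  have \<Theta>c: "continuous_on UNIV \<Theta>" by (rule smooth_on_cont[OF \<Theta>])
  have hi: "integrable lborel ?h"
  proof -
    have "integrable lborel (\<lambda>t. indicator {c..d} t *\<^sub>R h t)"
      by (intro borel_integrable_compact compact_Icc continuous_on_subset[OF hc]) auto
    then show ?thesis by (rule Bochner_Integration.integrable_cong[THEN iffD1, rotated -1]) (auto split: split_indicator)
  qed
  \<comment> \<open>Arguments are now read as ((y, s, (x, u)), t): s has become a parameter, and q
    does not depend on t.\<close>
  define q :: "('a \<times> real \<times> 'a \<times> real) \<times> real \<Rightarrow> real" where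
    "q = (\<lambda>x. \<Theta> (fst (snd (fst x))) \<bullet> fst (snd (snd (fst x))))"
  define p :: "('a \<times> real \<times> 'a \<times> real) \<times> real \<Rightarrow> real" where
    "p = (\<lambda>x. snd x * q x)"
  define a :: "('a \<times> real \<times> 'a \<times> real) \<times> real \<Rightarrow> complex" where
    "a = (\<lambda>x. h (snd x) * \<rho> (fst (fst x) - snd x *\<^sub>R \<Theta> (fst (snd (fst x)))))"
  \<comment> \<open>The domain must be open, while \<open>h0\<close> makes the amplitude vanish only
    for y in a ball; the margin between R and R + 1 fits an open ball around the closed one used in
    \<open>Z\<close>.\<close>
  define Q where "Q = {x. q x \<noteq> 0} \<inter> {x. norm (fst (fst x)) < R + 1}"
  have qs: "smooth_on UNIV q" unfolding q_def
    by (intro smooth_on_inner smooth_on_compose[OF \<Theta>] smooth_on_fst smooth_on_snd smooth_on_id open_UNIV)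
  have as: "smooth_on UNIV a" unfolding a_def
    by (intro smooth_on_diff smooth_on_mult smooth_on_scaleR smooth_on_compose[OF \<rho>(1)]
        smooth_on_compose[OF h] smooth_on_compose[OF \<Theta>] smooth_on_fst smooth_on_snd smooth_on_id open_UNIV)
  have Q: "open Q" unfolding Q_def
    by (intro open_Int open_Collect_neq open_Collect_less smooth_on_cont[OF qs] continuous_intros)
  define Z where "Z = cball (0::'a) R \<times> S \<times> cball \<omega> r"
  define J where "J = (\<lambda>z l. cmod (integral {c..d} (\<lambda>s. a (z, s) * exp (\<i> * of_real (l * p (z, s))))))"
  have J0: "J z l \<ge> 0" for z l unfolding J_def by simp
  have J: "\<exists>C. \<forall>z\<in>Z. \<forall>l>0. J z l * l ^ N \<le> C" for N
    unfolding J_def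
  proof (rule nonstationary_phase[where S = Q and q = q and c' = c' and d' = d'])
    show "smooth_on Q q" "smooth_on Q a" using qs as Q by (auto intro: smooth_on_subset)
    show "compact Z" unfolding Z_def by (intro compact_Times \<kappa> compact_cball)
    show "Z \<times> {c..d} \<subseteq> Q" using nz by (auto simp: Z_def Q_def q_def)
    show "a (z, t) = 0" if "(z, t) \<in> Q" "t \<notin> {c'..d'}" for z t
      using h0[OF _ that(2), of "fst z"] that(1) by (auto simp: a_def Q_def)
    show "((\<lambda>s. p (z, s)) has_real_derivative q (z, s)) (at s)" for z s
      unfolding p_def q_def by (auto intro!: derivative_eq_intros)
  qed (use cd in \<open>auto simp: Q_def\<close>)
  from power_decay_imp_shifted[of Z J N, OF J J0] obtain C where
    C: "\<And>z l. z \<in> Z \<Longrightarrow> l > 0 \<Longrightarrow> J z l * (1 + l) ^ N \<le> C"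
    by blast
  define I where "I = (LINT w|lborel. cmod (case w of (y, s) \<Rightarrow> f y * \<kappa> s))"
  have fk: "integrable lborel (\<lambda>(y, s). f y * \<kappa> s)"
    using integrable_pair_mult[OF f(1) \<kappa>(1)] by (simp add: lborel_prod)
  have "cmod (integral\<^sup>L lborel (osc \<Theta> f \<rho> \<kappa> ?h (l *\<^sub>R z))) * (1 + l) ^ N \<le> I * C"
    if z: "z \<in> cball \<omega> r" and l: "l > 0" for z l
  proof -
    define x u where "x = fst z" and "u = snd z"
    then have zz: "z = (x, u)" by simp
    let ?D = "C / (1 + l) ^ N"
    have inner: "cmod (LINT t|lborel. osc \<Theta> f \<rho> \<kappa> ?h (l *\<^sub>R z) ((y, s), t)) \<le> cmod (f y * \<kappa> s) * ?D" for y s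
    proof (cases "\<kappa> s = 0 \<or> f y = 0")
      case True
      then show ?thesis by (auto simp: osc_def zz)
    next
      case False
      then have Zz: "(y, s, z) \<in> Z" using f(2) \<kappa>(3) z unfolding Z_def by blast
      then have yR: "y \<in> ball 0 (R + 1)" by (auto simp: Z_def)
      have a0: "a ((y, s, z), t) = 0" if "t \<notin> {c..d}" for t
        using h0[OF yR, of t s] that cd by (force simp: a_def)
      define k where "k = f y * \<kappa> s * exp (- \<i> * of_real (y \<bullet> (l *\<^sub>R x) + s * (l * u)))"
      let ?g = "\<lambda>t. a ((y, s, z), t) * exp (\<i> * of_real (l * p ((y, s, z), t)))"
      have "osc \<Theta> f \<rho> \<kappa> ?h (l *\<^sub>R z) ((y, s), t) = k * ?g t" for t
      proof -
        have "exp (- \<i> * of_real ((y - t *\<^sub>R \<Theta> s) \<bullet> (l *\<^sub>R x) + s * (l * u))) =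
          exp (- \<i> * of_real (y \<bullet> (l *\<^sub>R x) + s * (l * u))) * exp (\<i> * of_real (l * p ((y, s, z), t)))"
          unfolding exp_add[symmetric] p_def q_def by (simp add: inner_diff_left algebra_simps zz)
        then have "osc \<Theta> f \<rho> \<kappa> ?h (l *\<^sub>R z) ((y, s), t) = k * (indicator {c..d} t * ?g t)"
          unfolding osc_def zz k_def a_def by (simp add: mult_ac)
        \<comment> \<open>The truncation serves to make the weight integrable and is invisible here:
          for this y the amplitude already vanishes outside {c..d}.\<close>
        also have "indicator {c..d} t * ?g t = ?g t" using a0[of t] by (auto split: split_indicator)
        finally show ?thesis .
      qed
      then have "(LINT t|lborel. osc \<Theta> f \<rho> \<kappa> ?h (l *\<^sub>R z) ((y, s), t)) = k * (LINT t|lborel. ?g t)"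
        by (simp only: integral_mult_right_zero)
      also have "(LINT t|lborel. ?g t) = integral {c..d} ?g"
      proof (rule lborel_integral_eq_Icc)
        show "continuous_on UNIV ?g" unfolding p_def q_def a_def
          by (intro continuous_intros continuous_on_compose2[OF \<rho>c] continuous_on_compose2[OF hc] continuous_on_compose2[OF \<Theta>c]) auto
      qed (simp add: a0)
      finally have "cmod (LINT t|lborel. osc \<Theta> f \<rho> \<kappa> ?h (l *\<^sub>R z) ((y, s), t)) = cmod k * J (y, s, z) l"
        by (simp add: norm_mult J_def)
      also have "cmod k = cmod (f y * \<kappa> s)" by (simp add: k_def norm_mult del: of_real_add)
      finally have e: "cmod (LINT t|lborel. osc \<Theta> f \<rho> \<kappa> ?h (l *\<^sub>R z) ((y, s), t))
        = cmod (f y * \<kappa> s) * J (y, s, z) l" .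
      have "J (y, s, z) l \<le> ?D" using C[OF Zz l] l by (simp add: field_simps)
      then show ?thesis unfolding e by (intro mult_left_mono norm_ge_zero)
    qed
    have "cmod (integral\<^sup>L lborel (osc \<Theta> f \<rho> \<kappa> ?h (l *\<^sub>R z)))
        = cmod (LINT w|lborel. LINT t|lborel. osc \<Theta> f \<rho> \<kappa> ?h (l *\<^sub>R z) (w, t))"
      using osc_fubini(1)[OF integrable_osc[OF \<Theta>c f(1) \<rho>c \<rho>(2) _ \<kappa>(1) hi, of "l *\<^sub>R z"]] \<rho>(3) by simp
    also have "\<dots> \<le> (LINT w|lborel. cmod (case w of (y, s) \<Rightarrow> f y * \<kappa> s) * ?D)"
    proof (rule integral_norm_le_integral)
      show "integrable lborel (\<lambda>w. cmod (case w of (y, s) \<Rightarrow> f y * \<kappa> s) * ?D)"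
        by (intro integrable_mult_left integrable_norm fk)
    qed (use inner in auto)
    also have "\<dots> = I * C / (1 + l) ^ N" by (simp add: I_def)
    finally show ?thesis using l by (simp add: field_simps)
  qed
  then show "\<exists>C. \<forall>z\<in>cball \<omega> r. \<forall>l>0. cmod (integral\<^sup>L lborel (osc \<Theta> f \<rho> \<kappa> ?h (l *\<^sub>R z))) * (1 + l) ^ N \<le> C"
    by blast
qed

section \<open>Cutoffs and microlocal smoothness\<close>

text \<open>The squared distance keeps the argument smooth at the centre. The height is not
  normalised: a localising cutoff has to be nonzero at its point, not equal to 1.\<close>

definition bump :: "'a::euclidean_space \<Rightarrow> real \<Rightarrow> 'a \<Rightarrow> complex" where
  "bump x0 \<delta> x = of_real (flat_exp (\<delta>\<^sup>2 - (x - x0) \<bullet> (x - x0)))"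

lemma smooth_bump: "smooth_on UNIV (bump x0 \<delta>)"
  unfolding bump_def power2_eq_square
  by (intro smooth_on_of_real smooth_on_flat_exp smooth_on_diff smooth_on_inner smooth_on_const
      smooth_on_id open_UNIV)

lemma bump_eq_0_iff:
  assumes "\<delta> > 0" shows "bump x0 \<delta> x = 0 \<longleftrightarrow> dist x0 x \<ge> \<delta>"
proof -
  have "\<delta>\<^sup>2 - (x - x0) \<bullet> (x - x0) > 0 \<longleftrightarrow> (dist x0 x)\<^sup>2 < \<delta>\<^sup>2"
  proof -
    have "dist x0 x = norm (x - x0)" by (metis dist_norm dist_commute)
    then show ?thesis by (simp only: power2_norm_eq_inner diff_gt_0_iff_gt)
  qed
  also have "\<dots> \<longleftrightarrow> dist x0 x < \<delta>"
    by (metis assms less_imp_le power2_less_imp_less power_strict_mono pos2 zero_le_dist)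
  finally show ?thesis
    using flat_exp_pos[of "\<delta>\<^sup>2 - (x - x0) \<bullet> (x - x0)"] flat_exp_0[of "\<delta>\<^sup>2 - (x - x0) \<bullet> (x - x0)"]
    unfolding bump_def of_real_eq_0_iff by linarith
qed

lemma bump_supp: "\<delta> > 0 \<Longrightarrow> x \<notin> cball x0 \<delta> \<Longrightarrow> bump x0 \<delta> x = 0"
  by (simp add: bump_eq_0_iff)

text \<open>A microlocal cutoff is only known to be nonzero at its point; multiplying by g undoes it
  nearby. A is positive on the open ball of radius 2 \<epsilon> and B vanishes on the closed ball of
  radius \<epsilon>, so A / (A + B) is a smooth plateau, which is divided by
  \<open>\<rho>\<close>.\<close>

lemma local_reciprocal:
  fixes \<rho> :: "'a::euclidean_space \<Rightarrow> complex"
  assumes \<rho>: "smooth_on UNIV \<rho>" "\<rho> y0 \<noteq> 0"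
  obtains g \<epsilon> where "smooth_on UNIV g" "\<epsilon> > 0" "\<And>y. y \<notin> cball y0 (2 * \<epsilon>) \<Longrightarrow> g y = 0"
    "\<And>y. y \<in> ball y0 \<epsilon> \<Longrightarrow> g y * \<rho> y = 1"
proof -
  have "open {y. \<rho> y \<noteq> 0}" by (intro open_Collect_neq smooth_on_cont[OF \<rho>(1)] continuous_on_const)
  then obtain d where d: "d > 0" "ball y0 d \<subseteq> {y. \<rho> y \<noteq> 0}" using \<rho>(2) open_contains_ball by blast
  \<comment> \<open>Since 2 \<epsilon> < d, the ball where \<open>\<rho>\<close> is nonzero and the
    exterior of the support of A cover the space; g is smooth on each of these two open
    sets.\<close>
  define \<epsilon> where "\<epsilon> = d / 3"
  have \<epsilon>: "\<epsilon> > 0" using d by (simp add: \<epsilon>_def)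
  define A B where "A = (\<lambda>y. complex_of_real (flat_exp ((2 * \<epsilon>)\<^sup>2 - (y - y0) \<bullet> (y - y0))))"
    and "B = (\<lambda>y. complex_of_real (flat_exp ((y - y0) \<bullet> (y - y0) - \<epsilon>\<^sup>2)))"
  have A: "smooth_on UNIV A" and B: "smooth_on UNIV B"
    unfolding A_def B_def by (intro smooth_on_of_real smooth_on_flat_exp smooth_on_diff
        smooth_on_inner smooth_on_const smooth_on_id open_UNIV)+
  have N: "(y - y0) \<bullet> (y - y0) = (dist y0 y)\<^sup>2" for y
    by (metis dist_commute dist_norm power2_norm_eq_inner)
  have AB: "A y + B y \<noteq> 0" for y
  proof -
    have "flat_exp ((2 * \<epsilon>)\<^sup>2 - (y - y0) \<bullet> (y - y0)) > 0 \<or> flat_exp ((y - y0) \<bullet> (y - y0) - \<epsilon>\<^sup>2) > 0"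
    proof (cases "(y - y0) \<bullet> (y - y0) > \<epsilon>\<^sup>2")
      case False
      then have "(2 * \<epsilon>)\<^sup>2 - (y - y0) \<bullet> (y - y0) > 0"
      proof -
        have "(2 * \<epsilon>)\<^sup>2 = 4 * \<epsilon>\<^sup>2" "\<epsilon>\<^sup>2 > 0" using \<epsilon> by simp_all
        then show ?thesis using False by linarith
      qed
      then show ?thesis using flat_exp_pos by blast
    qed (simp add: flat_exp_pos)
    then have "flat_exp ((2 * \<epsilon>)\<^sup>2 - (y - y0) \<bullet> (y - y0)) + flat_exp ((y - y0) \<bullet> (y - y0) - \<epsilon>\<^sup>2) \<noteq> 0"
      using flat_exp_nonneg[of "(2 * \<epsilon>)\<^sup>2 - (y - y0) \<bullet> (y - y0)"] flat_exp_nonneg[of "(y - y0) \<bullet> (y - y0) - \<epsilon>\<^sup>2"] by linarith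
    then show ?thesis unfolding A_def B_def of_real_add[symmetric] of_real_eq_0_iff .
  qed
  have A0: "A y = 0" if "y \<notin> ball y0 (2 * \<epsilon>)" for y
  proof -
    have "(2 * \<epsilon>)\<^sup>2 \<le> (dist y0 y)\<^sup>2" using that \<epsilon> by (intro power_mono) auto
    then show ?thesis by (simp add: A_def N flat_exp_0)
  qed
  define g where "g = (\<lambda>y. if y \<in> ball y0 d then A y / ((A y + B y) * \<rho> y) else 0)"
  have "smooth_on (ball y0 d) (\<lambda>y. A y / ((A y + B y) * \<rho> y))"
    using d(2) AB by (intro smooth_on_divide smooth_on_mult smooth_on_add smooth_on_subset[OF A]
        smooth_on_subset[OF B] smooth_on_subset[OF \<rho>(1)]) auto
  then have 1: "smooth_on (ball y0 d) g" by (rule smooth_on_cong) (simp add: g_def)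
  have "smooth_on (- cball y0 (2 * \<epsilon>)) (\<lambda>_. 0 :: complex)" by (rule smooth_on_const) auto
  then have 2: "smooth_on (- cball y0 (2 * \<epsilon>)) g" by (rule smooth_on_cong) (auto simp: g_def A0)
  have "ball y0 d \<union> - cball y0 (2 * \<epsilon>) = UNIV" using d by (auto simp: \<epsilon>_def)
  then have 3: "smooth_on UNIV g" using smooth_on_Un[OF 1 2] by simp
  show thesis
  proof (rule that[OF 3 \<epsilon>])
    show "g y = 0" if "y \<notin> cball y0 (2 * \<epsilon>)" for y using A0[of y] that by (auto simp: g_def)
    show "g y * \<rho> y = 1" if "y \<in> ball y0 \<epsilon>" for y
    proof -
      have "(dist y0 y)\<^sup>2 \<le> \<epsilon>\<^sup>2" using that by (intro power_mono) auto
      then have "B y = 0" by (simp add: B_def N flat_exp_0)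
      moreover have "y \<in> ball y0 d" using that d by (auto simp: \<epsilon>_def)
      ultimately show ?thesis using AB[of y] d by (auto simp: g_def)
    qed
  qed
qed

text \<open>The form in which microlocal smoothness is used: f itself, not a multiple of it,
  coincides near y with an integrable function whose transform decays around v, so
  \<open>osc_local\<close> can exchange the two.\<close>

definition locally_rapid :: "('a::euclidean_space \<Rightarrow> complex) \<Rightarrow> 'a \<Rightarrow> 'a \<Rightarrow> bool" where
  "locally_rapid f y v \<longleftrightarrow> (\<exists>\<epsilon> r w. \<epsilon> > 0 \<and> r > 0 \<and> integrable lborel w \<and> rapid v r (ft w) \<and>
     (\<forall>x\<in>ball y \<epsilon>. w x = f x))"

text \<open>The given cutoff yields decay for the product of \<open>\<rho>\<close> with f only.
  Multiplication by a local reciprocal of \<open>\<rho>\<close> restores f near y, and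
  \<open>rapid_ft_mult\<close> preserves the decay at the price of half the radius.\<close>

lemma microlocally_smooth_imp_locally_rapid:
  fixes f :: "'a::euclidean_space \<Rightarrow> complex"
  assumes ms: "microlocally_smooth (regular_distribution f) y v" and v: "v \<noteq> 0"
    and f0: "integrable lborel f0" "AE x in lebesgue. f x = f0 x"
  shows "locally_rapid f0 y v"
proof -
  obtain \<rho> \<Gamma> where \<rho>: "test_function \<rho>" "\<rho> y \<noteq> 0" and \<Gamma>: "open \<Gamma>" "v \<in> \<Gamma>" "\<And>\<eta> c. \<eta> \<in> \<Gamma> \<Longrightarrow> c > 0 \<Longrightarrow> c *\<^sub>R \<eta> \<in> \<Gamma>"
    and dec: "\<And>N. \<exists>C. \<forall>\<eta>\<in>\<Gamma>. cmod (fourier_localized (regular_distribution f) \<rho> \<eta>) \<le> C / (1 + norm \<eta>) ^ N"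
    using ms unfolding microlocally_smooth_def by blast
  have \<rho>s: "smooth_on UNIV \<rho>" and \<rho>K: "compact (closure {x. \<rho> x \<noteq> 0})" using \<rho>(1) by (auto simp: test_function_iff)
  have \<rho>0: "\<rho> x = 0" if "x \<notin> closure {x. \<rho> x \<noteq> 0}" for x using that closure_subset[of "{x. \<rho> x \<noteq> 0}"] by auto
  have \<rho>c: "continuous_on UNIV \<rho>" by (rule smooth_on_cont[OF \<rho>s])
  obtain B where B: "\<And>x. cmod (\<rho> x) \<le> B" using bounded_compact_support[OF \<rho>c \<rho>K \<rho>0] by blast
  define w1 where "w1 = (\<lambda>x. f0 x * \<rho> x)"
  have w1: "integrable lborel w1" unfolding w1_def
    by (rule integrable_times_bounded[OF f0(1) _ B]) (use borel_measurable_continuous_onI[OF \<rho>c] in simp)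
  have ftw1: "ft w1 \<eta> = fourier_localized (regular_distribution f) \<rho> \<eta>" for \<eta>
  proof -
    have [measurable]: "w1 \<in> borel_measurable borel" using w1 by auto
    have "fourier_localized (regular_distribution f) \<rho> \<eta> = (LINT x|lebesgue. w1 x * exp (- \<i> * of_real (x \<bullet> \<eta>)))"
      unfolding fourier_localized_def regular_distribution_def w1_def
      by (rule integral_cong_AE_lebesgue) (use f0(2) in \<open>eventually_elim, simp\<close>)
    also have "\<dots> = ft w1 \<eta>" unfolding ft_def by (rule integral_completion) simp
    finally show ?thesis by simp
  qed
  obtain r0 where r0: "r0 > 0" "cball v r0 \<subseteq> \<Gamma>" using \<Gamma>(1,2) open_contains_cball by blast
  define r where "r = min r0 (norm v / 2)"
  have r: "r > 0" "r \<le> r0" "r \<le> norm v / 2" using r0 v by (auto simp: r_def)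
  \<comment> \<open>On the ball, r <= |v|/2 gives |z| >= |v|/2 >= m, hence m (1 + l) <= 1 + |l z|:
    decay in the norm of the frequency becomes decay in l. Positivity of m rests on v being
    nonzero.\<close>
  define m where "m = min 1 (norm v / 2)"
  have m: "m > 0" "m \<le> 1" "m \<le> norm v / 2" using v by (auto simp: m_def)
  have "rapid v r (ft w1)"
    unfolding rapid_def
  proof
    fix N
    obtain C where C: "\<And>\<eta>. \<eta> \<in> \<Gamma> \<Longrightarrow> cmod (ft w1 \<eta>) \<le> C / (1 + norm \<eta>) ^ N"
      using dec[of N] unfolding ftw1 by blast
    have "cmod (ft w1 (l *\<^sub>R z)) * (1 + l) ^ N \<le> \<bar>C\<bar> / m ^ N" if z: "z \<in> cball v r" and l: "l > 0" for z l
    proof -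
      have "z \<in> \<Gamma>" using z r r0 by auto
      then have "cmod (ft w1 (l *\<^sub>R z)) \<le> C / (1 + norm (l *\<^sub>R z)) ^ N" using C \<Gamma>(3) l by blast
      also have "\<dots> \<le> \<bar>C\<bar> / (1 + norm (l *\<^sub>R z)) ^ N" by (intro divide_right_mono) (auto intro!: zero_le_power)
      also have "\<dots> \<le> \<bar>C\<bar> / (m * (1 + l)) ^ N"
      proof (intro divide_left_mono power_mono)
        have "norm v \<le> norm z + r" using z norm_triangle_sub[of v z] by (simp add: dist_norm)
        then have "m \<le> norm z" using r m by linarith
        then have "l * m \<le> l * norm z" using l by (intro mult_left_mono) auto
        moreover have "norm (l *\<^sub>R z) = l * norm z" "m * (1 + l) = m + l * m"
          using l by (simp_all add: algebra_simps)
        ultimately show "m * (1 + l) \<le> 1 + norm (l *\<^sub>R z)" using m by linarith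
      qed (use m l in \<open>auto intro!: mult_pos_pos zero_less_power add_pos_nonneg\<close>)
      finally have "cmod (ft w1 (l *\<^sub>R z)) \<le> \<bar>C\<bar> / (m * (1 + l)) ^ N" .
      then show ?thesis using m l unfolding power_mult_distrib by (simp add: field_simps)
    qed
    then show "\<exists>C. \<forall>z\<in>cball v r. \<forall>l>0. cmod (ft w1 (l *\<^sub>R z)) * (1 + l) ^ N \<le> C" by blast
  qed
  note rap = this
  obtain g \<epsilon> where g: "smooth_on UNIV g" "\<epsilon> > 0" "\<And>x. x \<notin> cball y (2 * \<epsilon>) \<Longrightarrow> g x = 0"
    "\<And>x. x \<in> ball y \<epsilon> \<Longrightarrow> g x * \<rho> x = 1"
    using local_reciprocal[OF \<rho>s \<rho>(2)] by blast
  define w where "w = (\<lambda>x. g x * w1 x)"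
  have gc: "continuous_on UNIV g" by (rule smooth_on_cont[OF g(1)])
  obtain B' where B': "\<And>x. cmod (g x) \<le> B'"
    using bounded_compact_support[OF gc compact_cball g(3)] by blast
  have "integrable lborel (\<lambda>x. w1 x * g x)"
    by (rule integrable_times_bounded[OF w1 _ B']) (use borel_measurable_continuous_onI[OF gc] in simp)
  then have w: "integrable lborel w" by (simp add: w_def mult.commute)
  have "\<exists>C. \<forall>z\<in>cball v (r/2). \<forall>l>0. cmod (ft w (l *\<^sub>R z)) * (1 + l) ^ N \<le> C" for N
  proof -
    obtain C where C: "\<And>s z l. z \<in> cball v (r/2) \<Longrightarrow> l > 0 \<Longrightarrow>
      cmod (ft (\<lambda>y. g (y - s) * w1 y) (l *\<^sub>R z)) * (1 + l) ^ N \<le> C"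
      using rapid_ft_mult[OF g(1) compact_cball _ w1 r(1) rap, of y "2 * \<epsilon>" N] g(3) by blast
    show ?thesis using C[of _ _ 0] unfolding w_def by (intro exI[of _ C]) auto
  qed
  then have "rapid v (r/2) (ft w)" by (simp add: rapid_def)
  moreover have "w x = f0 x" if "x \<in> ball y \<epsilon>" for x
    using g(4)[OF that] by (simp add: w_def w1_def mult_ac)
  ultimately show ?thesis unfolding locally_rapid_def using w g(2) r(1)
    by - (rule exI[of _ \<epsilon>], rule exI[of _ "r/2"], rule exI[of _ w], auto)
qed

lemma rapid_mono: "rapid v r F \<Longrightarrow> r' \<le> r \<Longrightarrow> rapid v r' F"
  unfolding rapid_def by (meson subset_cball subsetD)

lemma rapid_add:
  assumes "rapid v r F" "rapid v r G" shows "rapid v r (\<lambda>\<zeta>. F \<zeta> + G \<zeta>)"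
  unfolding rapid_def
proof
  fix N
  obtain C D where C: "\<And>z l. z \<in> cball v r \<Longrightarrow> l > 0 \<Longrightarrow> cmod (F (l *\<^sub>R z)) * (1 + l) ^ N \<le> C"
    and D: "\<And>z l. z \<in> cball v r \<Longrightarrow> l > 0 \<Longrightarrow> cmod (G (l *\<^sub>R z)) * (1 + l) ^ N \<le> D"
    using assms unfolding rapid_def by meson
  have "cmod (F (l *\<^sub>R z) + G (l *\<^sub>R z)) * (1 + l) ^ N \<le> C + D" if "z \<in> cball v r" "l > 0" for z l
  proof -
    have "cmod (F (l *\<^sub>R z) + G (l *\<^sub>R z)) * (1 + l) ^ N
        \<le> (cmod (F (l *\<^sub>R z)) + cmod (G (l *\<^sub>R z))) * (1 + l) ^ N"
      using that by (intro mult_right_mono norm_triangle_ineq) auto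
    also have "\<dots> \<le> C + D" using C[OF that] D[OF that] by (simp add: distrib_right)
    finally show ?thesis .
  qed
  then show "\<exists>C. \<forall>z\<in>cball v r. \<forall>l>0. cmod (F (l *\<^sub>R z) + G (l *\<^sub>R z)) * (1 + l) ^ N \<le> C" by blast
qed

lemma rapid_cmult:
  assumes "rapid v r F" shows "rapid v r (\<lambda>\<zeta>. k * F \<zeta>)"
  unfolding rapid_def
proof
  fix N
  obtain C where C: "\<And>z l. z \<in> cball v r \<Longrightarrow> l > 0 \<Longrightarrow> cmod (F (l *\<^sub>R z)) * (1 + l) ^ N \<le> C"
    using assms unfolding rapid_def by meson
  have "cmod (k * F (l *\<^sub>R z)) * (1 + l) ^ N \<le> cmod k * C" if "z \<in> cball v r" "l > 0" for z l
    using mult_left_mono[OF C[OF that] norm_ge_zero[of k]] by (simp add: norm_mult mult.assoc)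
  then show "\<exists>C. \<forall>z\<in>cball v r. \<forall>l>0. cmod (k * F (l *\<^sub>R z)) * (1 + l) ^ N \<le> C" by blast
qed

lemma integral_osc_add:
  assumes "integrable lborel (osc \<Theta> f \<rho> \<kappa> h \<zeta>)" "integrable lborel (osc \<Theta> f \<rho> \<kappa> h' \<zeta>)"
  shows "integral\<^sup>L lborel (osc \<Theta> f \<rho> \<kappa> (\<lambda>t. h t + h' t) \<zeta>) =
    integral\<^sup>L lborel (osc \<Theta> f \<rho> \<kappa> h \<zeta>) + integral\<^sup>L lborel (osc \<Theta> f \<rho> \<kappa> h' \<zeta>)"
  by (subst Bochner_Integration.integral_add[OF assms, symmetric])
     (rule Bochner_Integration.integral_cong, auto simp: osc_def case_prod_unfold algebra_simps)

section \<open>Families of rays\<close>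

lemma bump_supp_Icc: "\<delta> > 0 \<Longrightarrow> s \<notin> {s0 - \<delta>..s0 + \<delta>} \<Longrightarrow> bump s0 \<delta> s = 0" for s s0 :: real
  by (auto simp: bump_eq_0_iff dist_real_def)

lemma integrable_bump: "\<delta> > 0 \<Longrightarrow> integrable lborel (bump x0 \<delta>)"
  by (rule integrable_compact_support[OF smooth_on_cont[OF smooth_bump] compact_cball bump_supp])

lemma integrable_indicator_times:
  fixes h :: "real \<Rightarrow> complex"
  assumes "h \<in> borel_measurable borel" "\<And>t. cmod (h t) \<le> B" "S \<in> sets borel" "S \<subseteq> {a..b}"
  shows "integrable lborel (\<lambda>t. indicator S t * h t)"
proof (rule integrable_times_bounded)
  have "emeasure lborel S \<le> emeasure lborel {a..b}" using assms by (intro emeasure_mono) auto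
  then have "emeasure lborel S < \<infinity>"
    by (rule order_le_less_trans) (auto simp: emeasure_lborel_Icc_eq)
  then have "integrable lborel (indicator S :: real \<Rightarrow> real)" using assms by (intro integrable_real_indicator) auto
  then have "integrable lborel (\<lambda>t. complex_of_real (indicator S t))" by (rule integrable_of_real)
  then show "integrable lborel (indicator S :: real \<Rightarrow> complex)" by (simp add: of_real_indicator)
qed (use assms in auto)

text \<open>Collects what the two branches of the V share; each is an instance with its own rotation
  angle, and \<open>f\<close> stands for the representative that vanishes off a ball.\<close>

locale ray_family =
  fixes \<Theta> \<Theta>' :: "real \<Rightarrow> 'a::euclidean_space" and f :: "'a \<Rightarrow> complex" and R :: real
  assumes \<Theta>: "smooth_on UNIV \<Theta>" "smooth_on UNIV \<Theta>'" "\<And>s. (\<Theta> has_vector_derivative \<Theta>' s) (at s)"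
    and norm_\<Theta>: "\<And>s. norm (\<Theta> s) = 1"
    and f: "integrable lborel f" "\<And>y. y \<notin> cball 0 R \<Longrightarrow> f y = 0" and R: "R > 0"
begin

lemma continuous_\<Theta>: "continuous_on UNIV \<Theta>"
  by (rule smooth_on_cont[OF \<Theta>(1)])

lemma integrable_osc_bump:
  assumes "\<delta> > 0" "integrable lborel h"
  shows "integrable lborel (osc \<Theta> f (bump x0 \<delta>) (bump s0 \<delta>) h \<zeta>)"
  by (rule integrable_osc(1)[OF continuous_\<Theta> f(1) smooth_on_cont[OF smooth_bump] compact_cball[of x0 \<delta>]])
     (use assms in \<open>auto intro: bump_supp integrable_bump\<close>)

text \<open>The phase derivative is nonzero at (s0, \<omega>) for all t in a compact set, hence on a
  uniform neighbourhood. The aperture r is fixed before \<open>h\<close>, since it depends on the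
  set \<open>S\<close> and not on the weight.\<close>

lemma angular:
  assumes S: "compact S" and nz: "\<And>t. t \<in> S \<Longrightarrow> t * (\<Theta>' s0 \<bullet> fst \<omega>) - snd \<omega> \<noteq> 0"
  shows "\<exists>\<delta>0>0. \<forall>\<delta>. 0 < \<delta> \<and> \<delta> \<le> \<delta>0 \<longrightarrow> (\<exists>r>0. \<forall>h. integrable lborel h \<longrightarrow> (\<forall>t. t \<notin> S \<longrightarrow> h t = 0) \<longrightarrow>
    rapid \<omega> r (\<lambda>\<zeta>. integral\<^sup>L lborel (osc \<Theta> f (bump x0 \<delta>) (bump s0 \<delta>) h \<zeta>)))"
proof -
  let ?q = "\<lambda>p :: real \<times> real \<times> 'a \<times> real. fst p * (\<Theta>' (fst (snd p)) \<bullet> fst (snd (snd p))) - snd (snd (snd p))"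
  have "continuous_on UNIV ?q"
    by (intro continuous_intros continuous_on_compose2[OF smooth_on_cont[OF \<Theta>(2)]]) auto
  then have U: "open {p. ?q p \<noteq> 0}" by (intro open_Collect_neq continuous_on_const)
  have K: "compact (S \<times> {s0} \<times> {\<omega>})" by (intro compact_Times S compact_sing)
  have "S \<times> {s0} \<times> {\<omega>} \<subseteq> {p. ?q p \<noteq> 0}" using nz by auto
  from compact_subset_open_imp_ball_epsilon_subset[OF K U this] obtain e where e: "e > 0" "(\<Union>p\<in>S \<times> {s0} \<times> {\<omega>}. ball p e) \<subseteq> {p. ?q p \<noteq> 0}"
    by blast
  have key: "t * (\<Theta>' s \<bullet> fst z) - snd z \<noteq> 0"
    if "t \<in> S" "\<bar>s - s0\<bar> \<le> e/2" "z \<in> cball \<omega> (e/4)" for t s z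
  proof -
    have "dist (t, s0, \<omega>) (t, s, z) \<le> dist s0 s + dist \<omega> z"
      by (simp add: dist_Pair_Pair sqrt_sum_squares_le_sum)
    also have "\<dots> < e" using that e(1) by (auto simp: dist_real_def abs_minus_commute)
    finally have "(t, s, z) \<in> {p. ?q p \<noteq> 0}" using e(2) that(1) by (intro subsetD[OF e(2)]) auto
    then show ?thesis by simp
  qed
  show ?thesis
  \<comment> \<open>Integration by parts runs over twice the radius of the cutoff, so that its ends
    lie outside the support; 2 \<delta> <= e/2 and e/4 for the covector add up to less than
    e.\<close>
  proof (rule exI[of _ "e/4"], rule conjI, (use e in simp), intro allI impI)
    fix \<delta> assume \<delta>: "0 < \<delta> \<and> \<delta> \<le> e/4"
    show "\<exists>r>0. \<forall>h. integrable lborel h \<longrightarrow> (\<forall>t. t \<notin> S \<longrightarrow> h t = 0) \<longrightarrow>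
      rapid \<omega> r (\<lambda>\<zeta>. integral\<^sup>L lborel (osc \<Theta> f (bump x0 \<delta>) (bump s0 \<delta>) h \<zeta>))"
    proof (rule exI[of _ "e/4"], rule conjI, (use e in simp), intro allI impI)
      fix h :: "real \<Rightarrow> complex" assume h: "integrable lborel h" "\<forall>t. t \<notin> S \<longrightarrow> h t = 0"
      show "rapid \<omega> (e/4) (\<lambda>\<zeta>. integral\<^sup>L lborel (osc \<Theta> f (bump x0 \<delta>) (bump s0 \<delta>) h \<zeta>))"
      proof (rule osc_angular[OF \<Theta> f(1) _ smooth_bump compact_cball[of x0 \<delta>] _ smooth_bump,
            where c = "s0 - 2 * \<delta>" and d = "s0 + 2 * \<delta>" and c' = "s0 - \<delta>" and d' = "s0 + \<delta>" and S = S])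
        show "t * (\<Theta>' s \<bullet> fst z) - snd z \<noteq> 0" if "t \<in> S" "s \<in> {s0 - 2 * \<delta>..s0 + 2 * \<delta>}" "z \<in> cball \<omega> (e/4)" for t s z
        proof (rule key[OF that(1) _ that(3)])
          have "\<bar>s - s0\<bar> \<le> 2 * \<delta>" using that(2) by (auto simp: abs_le_iff)
          then show "\<bar>s - s0\<bar> \<le> e/2" using \<delta> by simp
        qed
      qed (use \<delta> h S f(2) in \<open>auto simp: bump_supp bump_supp_Icc\<close>)
    qed
  qed
qed

text \<open>For (t, s) near (t0, s0), a nonzero cutoff at y - t Theta(s) forces y into the ball
  where f agrees with the rapidly decaying piece.\<close>

lemma local_part:
  assumes lr: "locally_rapid f (x0 + t0 *\<^sub>R \<Theta> s0) v"
  shows "\<exists>\<delta>0>0. \<exists>r>0. \<forall>\<delta> h. 0 < \<delta> \<and> \<delta> \<le> \<delta>0 \<longrightarrow> integrable lborel h \<longrightarrow> (\<forall>t. \<bar>t - t0\<bar> > \<delta>0 \<longrightarrow> h t = 0) \<longrightarrow>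
    rapid (v, \<tau>) r (\<lambda>\<zeta>. integral\<^sup>L lborel (osc \<Theta> f (bump x0 \<delta>) (bump s0 \<delta>) h \<zeta>))"
proof -
  obtain \<epsilon> r w where w: "\<epsilon> > 0" "r > 0" "integrable lborel w" "rapid v r (ft w)"
    "\<And>y. y \<in> ball (x0 + t0 *\<^sub>R \<Theta> s0) \<epsilon> \<Longrightarrow> w y = f y"
    using lr unfolding locally_rapid_def by blast
  have "continuous_on UNIV (\<lambda>p. fst p *\<^sub>R \<Theta> (snd p))"
    by (intro continuous_intros continuous_on_compose2[OF continuous_\<Theta>]) auto
  then have "isCont (\<lambda>p. fst p *\<^sub>R \<Theta> (snd p)) (t0, s0)" by (simp add: continuous_on_eq_continuous_at)
  then obtain d where d: "d > 0" "\<And>p. dist p (t0, s0) < d \<Longrightarrow> dist (fst p *\<^sub>R \<Theta> (snd p)) (t0 *\<^sub>R \<Theta> s0) < \<epsilon>/2"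
    unfolding continuous_at_eps_delta using w(1) by (metis fst_conv half_gt_zero snd_conv)
  \<comment> \<open>One half of \<epsilon> is for the spatial cutoff, the other for the displacement
    of the ray point; d/3 because |t - t0| + |s - s0| must stay below d.\<close>
  define \<delta>0 where "\<delta>0 = min (\<epsilon>/2) (d/3)"
  have \<delta>0: "\<delta>0 > 0" "\<delta>0 \<le> \<epsilon>/2" "\<delta>0 \<le> d/3" using w d by (auto simp: \<delta>0_def)
  show ?thesis
  proof (rule exI[of _ \<delta>0], rule conjI, rule \<delta>0(1), rule exI[of _ "r/2"], intro conjI allI impI)
    fix \<delta> and h :: "real \<Rightarrow> complex"
    assume \<delta>: "0 < \<delta> \<and> \<delta> \<le> \<delta>0" and h: "integrable lborel h" "\<forall>t. \<bar>t - t0\<bar> > \<delta>0 \<longrightarrow> h t = 0"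
    show "rapid (v, \<tau>) (r/2) (\<lambda>\<zeta>. integral\<^sup>L lborel (osc \<Theta> f (bump x0 \<delta>) (bump s0 \<delta>) h \<zeta>))"
    proof (rule osc_local[OF continuous_\<Theta> f(1) w(3) smooth_bump compact_cball[of x0 \<delta>] _ _ h(1) w(2,4)])
      show "integrable lborel (bump s0 \<delta>)" using \<delta> by (intro integrable_bump) auto
      show "bump x0 \<delta> x = 0" if "x \<notin> cball x0 \<delta>" for x using that \<delta> by (intro bump_supp) auto
      fix y s t assume nz: "h t \<noteq> 0" "bump s0 \<delta> s \<noteq> 0"
      show "bump x0 \<delta> (y - t *\<^sub>R \<Theta> s) * f y = bump x0 \<delta> (y - t *\<^sub>R \<Theta> s) * w y"
      proof (cases "bump x0 \<delta> (y - t *\<^sub>R \<Theta> s) = 0")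
        case False
        then have 1: "dist x0 (y - t *\<^sub>R \<Theta> s) < \<epsilon>/2" using \<delta> \<delta>0 by (simp add: bump_eq_0_iff)
        have "\<bar>t - t0\<bar> \<le> \<delta>0" using h(2) nz(1) by force
        moreover have "\<bar>s - s0\<bar> \<le> \<delta>0" using nz(2) \<delta> by (auto simp: bump_eq_0_iff dist_real_def)
        moreover have "dist (t, s) (t0, s0) \<le> \<bar>t - t0\<bar> + \<bar>s - s0\<bar>"
          by (simp add: dist_Pair_Pair dist_real_def sqrt_sum_squares_le_sum_abs)
        ultimately have "dist (t, s) (t0, s0) < d" using \<delta>0 by linarith
        from d(2)[OF this] have 2: "dist (t *\<^sub>R \<Theta> s) (t0 *\<^sub>R \<Theta> s0) < \<epsilon>/2" by simp
        have "dist (x0 + t0 *\<^sub>R \<Theta> s0) y \<le> dist x0 (y - t *\<^sub>R \<Theta> s) + dist (t *\<^sub>R \<Theta> s) (t0 *\<^sub>R \<Theta> s0)"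
          unfolding dist_norm using norm_triangle_ineq[of "x0 - (y - t *\<^sub>R \<Theta> s)" "t0 *\<^sub>R \<Theta> s0 - t *\<^sub>R \<Theta> s"]
          by (simp add: norm_minus_commute algebra_simps)
        with 1 2 show ?thesis using w(5)[of y] by simp
      qed simp
    qed
  qed (use w \<delta>0 in auto)
qed

text \<open>From any point near \<open>x0\<close>, the ray has left the support of \<open>f\<close> before time \<open>tmax x0 - 1\<close>.\<close>

definition tmax :: "'a \<Rightarrow> real" where "tmax x0 = R + norm x0 + 3"

text \<open>A nonzero cutoff would give t = |t Theta(s)| < \<delta> + |y| + |x0| < R + |x0| + 2. The
  constant 3 in \<open>tmax\<close> leaves one further unit, the strict margin at the upper end in
  \<open>radial\<close>.\<close>

lemma bump_far:
  assumes "0 < \<delta>" "\<delta> \<le> 1" "norm y < R + 1" "t > tmax x0 - 1"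
  shows "bump x0 \<delta> (y - t *\<^sub>R \<Theta> s) = 0"
proof -
  have "norm (t *\<^sub>R \<Theta> s) = t" using assms R norm_\<Theta> by (simp add: tmax_def add_pos_nonneg) (smt (verit) norm_ge_zero)
  moreover have "norm (t *\<^sub>R \<Theta> s) \<le> norm (x0 - (y - t *\<^sub>R \<Theta> s)) + norm y + norm x0"
    using norm_triangle_ineq4[of "x0 - (y - t *\<^sub>R \<Theta> s)" "x0 - y"] norm_triangle_ineq4[of x0 y] by simp
  ultimately have "dist x0 (y - t *\<^sub>R \<Theta> s) \<ge> \<delta>" unfolding dist_norm using assms by (simp add: tmax_def)
  then show ?thesis using assms by (simp add: bump_eq_0_iff)
qed

lemma radial:
  assumes nz: "\<Theta> s0 \<bullet> fst \<omega> \<noteq> 0"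
  shows "\<exists>\<delta>0>0. \<exists>r>0. \<forall>\<delta> h. 0 < \<delta> \<and> \<delta> \<le> \<delta>0 \<longrightarrow> smooth_on UNIV h \<longrightarrow> (\<forall>t\<le>0. h t = 0) \<longrightarrow>
    rapid \<omega> r (\<lambda>\<zeta>. integral\<^sup>L lborel (osc \<Theta> f (bump x0 \<delta>) (bump s0 \<delta>) (\<lambda>t. indicator {-1..tmax x0} t * h t) \<zeta>))"
proof -
  let ?q = "\<lambda>p :: real \<times> 'a \<times> real. \<Theta> (fst p) \<bullet> fst (snd p)"
  have "continuous_on UNIV ?q"
    by (intro continuous_intros continuous_on_compose2[OF continuous_\<Theta>]) auto
  then have U: "open {p. ?q p \<noteq> 0}" by (intro open_Collect_neq continuous_on_const)
  have "(s0, \<omega>) \<in> {p. ?q p \<noteq> 0}" using nz by simp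
  with U obtain e where e: "e > 0" "ball (s0, \<omega>) e \<subseteq> {p. ?q p \<noteq> 0}" by (meson open_contains_ball)
  have key: "\<Theta> s \<bullet> fst z \<noteq> 0" if "\<bar>s - s0\<bar> \<le> e/4" "z \<in> cball \<omega> (e/4)" for s z
  proof -
    have "dist (s0, \<omega>) (s, z) \<le> dist s0 s + dist \<omega> z"
      by (simp add: dist_Pair_Pair sqrt_sum_squares_le_sum)
    also have "\<dots> < e" using that e(1) by (auto simp: dist_real_def abs_minus_commute)
    finally have "(s, z) \<in> {p. ?q p \<noteq> 0}" by (intro subsetD[OF e(2)]) auto
    then show ?thesis by simp
  qed
  show ?thesis
  proof (rule exI[of _ "min 1 (e/4)"], rule conjI, (use e in simp), rule exI[of _ "e/4"], intro conjI allI impI)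
    fix \<delta> and h :: "real \<Rightarrow> complex"
    assume \<delta>: "0 < \<delta> \<and> \<delta> \<le> min 1 (e/4)" and h: "smooth_on UNIV h" "\<forall>t\<le>0. h t = 0"
    show "rapid \<omega> (e/4) (\<lambda>\<zeta>. integral\<^sup>L lborel (osc \<Theta> f (bump x0 \<delta>) (bump s0 \<delta>) (\<lambda>t. indicator {-1..tmax x0} t * h t) \<zeta>))"
    \<comment> \<open>The amplitude lives on [0, tmax - 1], since h vanishes for t <= 0 and
      \<open>bump_far\<close> applies beyond; the interval [-1, tmax] surrounds it with margin 1 on
      both sides.\<close>
    proof (rule osc_radial[OF \<Theta>(1) f(1) _ smooth_bump compact_cball[of x0 \<delta>] _ _ _ _ h(1),
          where c' = 0 and d' = "tmax x0 - 1" and S = "{s0 - \<delta>..s0 + \<delta>}" and R = R])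
      show "h t * bump x0 \<delta> (y - t *\<^sub>R \<Theta> s) = 0" if "y \<in> ball 0 (R + 1)" "t \<notin> {0..tmax x0 - 1}" for y s t
        using bump_far[of \<delta> y x0 t s] h(2) \<delta> that by (cases "t \<le> 0") auto
      show "\<Theta> s \<bullet> fst z \<noteq> 0" if "s \<in> {s0 - \<delta>..s0 + \<delta>}" "z \<in> cball \<omega> (e/4)" for s z
      proof (rule key[OF _ that(2)])
        have "\<bar>s - s0\<bar> \<le> \<delta>" using that(1) by (auto simp: abs_le_iff)
        then show "\<bar>s - s0\<bar> \<le> e/4" using \<delta> by simp
      qed
      show "- 1 \<le> tmax x0" using R norm_ge_zero[of x0] unfolding tmax_def by linarith
    qed (use \<delta> f(2) in \<open>auto simp: bump_supp bump_supp_Icc integrable_bump\<close>)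
  qed (use e in auto)
qed

end

lemma integrable_indicator_subset:
  assumes "S \<in> sets borel" "S \<subseteq> {a..b}"
  shows "integrable lborel (indicator S :: real \<Rightarrow> complex)"
  using integrable_indicator_times[of "\<lambda>_. 1" 1 S a b] assms by simp

text \<open>E vanishes for t <= 0 and F for t >= \<open>\<delta>1\<close>, never both, so E / (E +
  F) is a smooth transition. It separates the endpoint t = 0 from the rest of the ray.\<close>

lemma smooth_step:
  assumes "\<delta>1 > 0"
  obtains k :: "real \<Rightarrow> complex" where "smooth_on UNIV k" "\<And>t. t \<le> 0 \<Longrightarrow> k t = 0" "\<And>t. t \<ge> \<delta>1 \<Longrightarrow> k t = 1"
    "\<And>t. cmod (k t) \<le> 1"
proof -
  define E F where "E = (\<lambda>t. flat_exp t)" and "F = (\<lambda>t. flat_exp (\<delta>1 - t))"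
  define k where "k = (\<lambda>t. complex_of_real (E t / (E t + F t)))"
  have nn: "E t \<ge> 0" "F t \<ge> 0" for t by (auto simp: E_def F_def flat_exp_nonneg)
  have pos: "E t + F t > 0" for t
    using assms nn[of t] flat_exp_pos[of t] flat_exp_pos[of "\<delta>1 - t"] unfolding E_def F_def by fastforce
  show thesis
  proof (rule that)
    show "smooth_on UNIV k" unfolding k_def E_def F_def
      using pos[unfolded E_def F_def, THEN less_imp_neq]
      by (intro smooth_on_of_real smooth_on_divide smooth_on_add smooth_on_flat_exp smooth_on_diff
          smooth_on_const smooth_on_id open_UNIV) auto
    show "k t = 0" if "t \<le> 0" for t using that by (simp add: k_def E_def flat_exp_0)
    show "k t = 1" if "t \<ge> \<delta>1" for t using that pos[of t] by (simp add: k_def F_def flat_exp_0)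
    show "cmod (k t) \<le> 1" for t
      using pos[of t] nn[of t] unfolding k_def norm_of_real by simp
  qed
qed

context ray_family
begin

abbreviation osc_bump :: "'a \<Rightarrow> real \<Rightarrow> real \<Rightarrow> (real \<Rightarrow> complex) \<Rightarrow> 'a \<times> real \<Rightarrow> complex" where
  "osc_bump x0 s0 \<delta> h \<zeta> \<equiv> integral\<^sup>L lborel (osc \<Theta> f (bump x0 \<delta>) (bump s0 \<delta>) h \<zeta>)"

lemma rapid_split:
  assumes "\<delta> > 0" "integrable lborel h1" "integrable lborel h2" "\<And>t. h t = h1 t + h2 t"
    and "r1 > 0" "rapid \<omega> r1 (osc_bump x0 s0 \<delta> h1)" "r2 > 0" "rapid \<omega> r2 (osc_bump x0 s0 \<delta> h2)"
  shows "\<exists>r>0. rapid \<omega> r (osc_bump x0 s0 \<delta> h)"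
proof -
  have "h = (\<lambda>t. h1 t + h2 t)" using assms(4) by auto
  then have "osc_bump x0 s0 \<delta> h = (\<lambda>\<zeta>. osc_bump x0 s0 \<delta> h1 \<zeta> + osc_bump x0 s0 \<delta> h2 \<zeta>)"
    using integral_osc_add[OF integrable_osc_bump integrable_osc_bump] assms(1-3) by auto
  moreover have "rapid \<omega> (min r1 r2) (\<lambda>\<zeta>. osc_bump x0 s0 \<delta> h1 \<zeta> + osc_bump x0 s0 \<delta> h2 \<zeta>)"
    by (intro rapid_add rapid_mono[OF assms(6)] rapid_mono[OF assms(8)]) auto
  ultimately show ?thesis using assms(5,7) by (intro exI[of _ "min r1 r2"]) auto
qed

text \<open>Near t = 0 the angular derivative t (Theta' . v) - \<tau> is close to -\<tau>. For
  nonzero \<tau> the angular estimate applies; for \<tau> = 0 the hypothesis at x0 itself gives the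
  local one. Both allow h to jump at 0.\<close>

lemma near_origin:
  assumes H: "\<tau> = 0 \<Longrightarrow> locally_rapid f x0 v"
  shows "\<exists>\<delta>1>0. \<exists>\<delta>2>0. \<forall>\<delta>. 0 < \<delta> \<and> \<delta> \<le> \<delta>2 \<longrightarrow> (\<exists>r>0. \<forall>h. integrable lborel h \<longrightarrow>
    (\<forall>t. t \<notin> {0..\<delta>1} \<longrightarrow> h t = 0) \<longrightarrow> rapid (v, \<tau>) r (osc_bump x0 s0 \<delta> h))"
proof (cases "\<tau> = 0")
  case True
  have "locally_rapid f (x0 + 0 *\<^sub>R \<Theta> s0) v" using H True by simp
  from local_part[OF this, of \<tau>] obtain \<delta>1 r where *: "\<delta>1 > 0" "r > 0"
    "\<And>\<delta> h. 0 < \<delta> \<Longrightarrow> \<delta> \<le> \<delta>1 \<Longrightarrow> integrable lborel h \<Longrightarrow> (\<forall>t. \<bar>t - 0\<bar> > \<delta>1 \<longrightarrow> h t = 0) \<Longrightarrow>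
      rapid (v, \<tau>) r (osc_bump x0 s0 \<delta> h)"
    by blast
  show ?thesis
  proof (rule exI[of _ \<delta>1], rule conjI, rule *, rule exI[of _ \<delta>1], rule conjI, rule *, intro allI impI)
    fix \<delta> assume \<delta>: "0 < \<delta> \<and> \<delta> \<le> \<delta>1"
    show "\<exists>r>0. \<forall>h. integrable lborel h \<longrightarrow> (\<forall>t. t \<notin> {0..\<delta>1} \<longrightarrow> h t = 0) \<longrightarrow> rapid (v, \<tau>) r (osc_bump x0 s0 \<delta> h)"
      using \<delta> *(2) by (intro exI[of _ r] conjI allI impI *(3)) (auto simp: abs_if split: if_splits)
  qed
next
  case False
  define a where "a = \<Theta>' s0 \<bullet> v"
  \<comment> \<open>Makes |t (Theta' . v)| <= |\<tau>|/2 on the interval; the 1 in the denominator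
    covers Theta' . v = 0.\<close>
  define \<delta>1 where "\<delta>1 = \<bar>\<tau>\<bar> / (2 * (1 + \<bar>a\<bar>))"
  have \<delta>1: "\<delta>1 > 0" using False by (simp add: \<delta>1_def add_pos_nonneg)
  have "t * (\<Theta>' s0 \<bullet> fst (v, \<tau>)) - snd (v, \<tau>) \<noteq> 0" if "t \<in> {0..\<delta>1}" for t
  proof -
    have "\<bar>t * a\<bar> \<le> \<delta>1 * (1 + \<bar>a\<bar>)" unfolding abs_mult using that by (intro mult_mono) auto
    also have "\<dots> = \<bar>\<tau>\<bar> / 2" by (simp add: \<delta>1_def field_simps)
    finally show ?thesis using False by (auto simp: a_def)
  qed
  from angular[OF compact_Icc this] obtain \<delta>2 where "\<delta>2 > 0" "\<And>\<delta>. 0 < \<delta> \<and> \<delta> \<le> \<delta>2 \<Longrightarrow>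
    \<exists>r>0. \<forall>h. integrable lborel h \<longrightarrow> (\<forall>t. t \<notin> {0..\<delta>1} \<longrightarrow> h t = 0) \<longrightarrow> rapid (v, \<tau>) r (osc_bump x0 s0 \<delta> h)"
    by blast
  with \<delta>1 show ?thesis by blast
qed

text \<open>In the stationary case \<open>nd\<close> gives a nonzero slope Theta' . v, so t0 is the
  only zero of the angular derivative and \<open>H2\<close> is applied at that one point. In the
  transversal case \<open>H2\<close> says nothing and the angular derivative may vanish at some t >
  0; there the radial estimate takes over, whatever the singularities of f.\<close>

lemma ray_rapid:
  assumes nd: "\<And>s w. \<Theta> s \<bullet> w = 0 \<Longrightarrow> \<Theta>' s \<bullet> w = 0 \<Longrightarrow> w = 0" and \<omega>: "(v, \<tau>) \<noteq> 0"
    and H1: "v \<noteq> 0 \<Longrightarrow> \<tau> = 0 \<Longrightarrow> locally_rapid f x0 v"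
    and H2: "\<And>\<alpha>. v \<noteq> 0 \<Longrightarrow> \<alpha> \<ge> 0 \<Longrightarrow> \<Theta> s0 \<bullet> v = 0 \<Longrightarrow> \<tau> = \<alpha> * (\<Theta>' s0 \<bullet> v) \<Longrightarrow>
      locally_rapid f (x0 + \<alpha> *\<^sub>R \<Theta> s0) v"
  shows "\<exists>\<delta>0>0. \<forall>\<delta>. 0 < \<delta> \<and> \<delta> \<le> \<delta>0 \<longrightarrow> (\<exists>r>0. rapid (v, \<tau>) r (osc_bump x0 s0 \<delta> (indicator {0..tmax x0})))"
proof -
  define T where "T = tmax x0"
  have iT: "integrable lborel (indicator {0..T} :: real \<Rightarrow> complex)"
    by (rule integrable_indicator_subset) auto
  consider (nonstat) "\<And>t. t \<in> {0..T} \<Longrightarrow> t * (\<Theta>' s0 \<bullet> v) - \<tau> \<noteq> 0"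
    | (stat) t0 where "\<Theta> s0 \<bullet> v = 0" "t0 \<in> {0..T}" "t0 * (\<Theta>' s0 \<bullet> v) = \<tau>"
    | (transversal) "\<Theta> s0 \<bullet> v \<noteq> 0"
    by force
  then show ?thesis
  proof cases
    case nonstat
    from angular[OF compact_Icc, of 0 T s0 "(v, \<tau>)" x0] nonstat
    obtain \<delta>0 where "\<delta>0 > 0" and *: "\<And>\<delta>. 0 < \<delta> \<and> \<delta> \<le> \<delta>0 \<Longrightarrow> \<exists>r>0. \<forall>h. integrable lborel h \<longrightarrow>
      (\<forall>t. t \<notin> {0..T} \<longrightarrow> h t = 0) \<longrightarrow> rapid (v, \<tau>) r (osc_bump x0 s0 \<delta> h)"
      by auto
    moreover have "\<exists>r>0. rapid (v, \<tau>) r (osc_bump x0 s0 \<delta> (indicator {0..T}))" if \<delta>: "0 < \<delta> \<and> \<delta> \<le> \<delta>0" for \<delta>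
      using *[OF \<delta>] iT by (metis indicator_simps(2))
    ultimately show ?thesis unfolding T_def by blast
  next
    case stat
    have v: "v \<noteq> 0" using \<omega> stat(3) by (auto simp: zero_prod_def)
    then have a: "\<Theta>' s0 \<bullet> v \<noteq> 0" using nd stat(1) by blast
    have "locally_rapid f (x0 + t0 *\<^sub>R \<Theta> s0) v" using H2[OF v _ stat(1)] stat(2,3) by simp
    from local_part[OF this, of \<tau>] obtain \<delta>1 r1 where 1: "\<delta>1 > 0" "r1 > 0"
      "\<And>\<delta> h. 0 < \<delta> \<and> \<delta> \<le> \<delta>1 \<Longrightarrow> integrable lborel h \<Longrightarrow> (\<forall>t. \<bar>t - t0\<bar> > \<delta>1 \<longrightarrow> h t = 0) \<Longrightarrow>
        rapid (v, \<tau>) r1 (osc_bump x0 s0 \<delta> h)"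
      by blast
    \<comment> \<open>The sharp cuts at distance \<open>\<delta>1\<close> from t0 are harmless:
      neither the angular nor the local estimate integrates by parts in t.\<close>
    define S where "S = {0..T} - ball t0 \<delta>1"
    have S: "compact S" unfolding S_def by (intro compact_diff compact_Icc open_ball)
    have "t * (\<Theta>' s0 \<bullet> fst (v, \<tau>)) - snd (v, \<tau>) \<noteq> 0" if "t \<in> S" for t
    proof -
      have "t \<noteq> t0" using that 1(1) by (auto simp: S_def)
      then show ?thesis using stat(3) a by auto
    qed
    from angular[OF S this] obtain \<delta>2 where \<delta>2: "\<delta>2 > 0" and 2: "\<And>\<delta>. 0 < \<delta> \<and> \<delta> \<le> \<delta>2 \<Longrightarrow>
      \<exists>r>0. \<forall>h. integrable lborel h \<longrightarrow> (\<forall>t. t \<notin> S \<longrightarrow> h t = 0) \<longrightarrow> rapid (v, \<tau>) r (osc_bump x0 s0 \<delta> h)"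
      by blast
    have i1: "integrable lborel (indicator ({0..T} \<inter> ball t0 \<delta>1) :: real \<Rightarrow> complex)"
      and i2: "integrable lborel (indicator S :: real \<Rightarrow> complex)"
      by (rule integrable_indicator_subset[of _ 0 T], auto simp: S_def)+
    have "\<exists>r>0. rapid (v, \<tau>) r (osc_bump x0 s0 \<delta> (indicator {0..T}))" if \<delta>: "0 < \<delta> \<and> \<delta> \<le> min \<delta>1 \<delta>2" for \<delta>
    proof -
      from 2[of \<delta>] \<delta> i2 obtain r2 where r2: "r2 > 0" "rapid (v, \<tau>) r2 (osc_bump x0 s0 \<delta> (indicator S))"
        by (metis indicator_simps(2) min.bounded_iff)
      have "rapid (v, \<tau>) r1 (osc_bump x0 s0 \<delta> (indicator ({0..T} \<inter> ball t0 \<delta>1)))"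
        using \<delta> by (intro 1(3) i1) (auto simp: dist_real_def abs_minus_commute split: split_indicator)
      then show ?thesis
        using \<delta> by (intro rapid_split[OF _ i1 i2 _ 1(2) _ r2]) (auto simp: S_def split: split_indicator)
    qed
    with 1(1) \<delta>2 show ?thesis unfolding T_def by (intro exI[of _ "min \<delta>1 \<delta>2"]) auto
  next
    case transversal
    then have v: "v \<noteq> 0" by auto
    from near_origin[of \<tau> x0 v s0] H1[OF v]
    obtain \<delta>1 \<delta>2 where \<delta>1: "\<delta>1 > 0" and \<delta>2: "\<delta>2 > 0" and 2: "\<And>\<delta>. 0 < \<delta> \<and> \<delta> \<le> \<delta>2 \<Longrightarrow>
      \<exists>r>0. \<forall>h. integrable lborel h \<longrightarrow> (\<forall>t. t \<notin> {0..\<delta>1} \<longrightarrow> h t = 0) \<longrightarrow> rapid (v, \<tau>) r (osc_bump x0 s0 \<delta> h)"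
      by blast
    obtain k where k: "smooth_on UNIV k" "\<And>t. t \<le> 0 \<Longrightarrow> k t = 0" "\<And>t. t \<ge> \<delta>1 \<Longrightarrow> k t = 1" "\<And>t. cmod (k t) \<le> 1"
      using smooth_step[OF \<delta>1] by metis
    have kc: "continuous_on UNIV k" by (rule smooth_on_cont[OF k(1)])
    have "\<Theta> s0 \<bullet> fst (v, \<tau>) \<noteq> 0" using transversal by simp
    from radial[OF this, of x0] k(1,2) obtain \<delta>3 r3 where 3: "\<delta>3 > 0" "r3 > 0"
      "\<And>\<delta>. 0 < \<delta> \<and> \<delta> \<le> \<delta>3 \<Longrightarrow> rapid (v, \<tau>) r3 (osc_bump x0 s0 \<delta> (\<lambda>t. indicator {-1..T} t * k t))"
      unfolding T_def by blast
    \<comment> \<open>The weight with 1 - k lives on the short interval at 0. As k vanishes for t <=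
      0, truncating it at -1 agrees with truncating it at 0, and the two weights add up to the
      indicator of {0..T}.\<close>
    let ?h1 = "\<lambda>t. indicator {0..T} t * (1 - k t)" and ?h2 = "\<lambda>t. indicator {-1..T} t * k t"
    have i1: "integrable lborel ?h1"
    proof (rule integrable_indicator_times)
      show "cmod (1 - k t) \<le> 2" for t using norm_triangle_ineq4[of 1 "k t"] k(4)[of t] by simp
    qed (auto intro!: borel_measurable_continuous_onI continuous_intros kc)
    have i2: "integrable lborel ?h2"
      by (rule integrable_indicator_times[OF _ k(4)]) (auto intro!: borel_measurable_continuous_onI kc)
    have "\<exists>r>0. rapid (v, \<tau>) r (osc_bump x0 s0 \<delta> (indicator {0..T}))" if \<delta>: "0 < \<delta> \<and> \<delta> \<le> min \<delta>2 \<delta>3" for \<delta>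
    proof -
      have "0 < \<delta> \<and> \<delta> \<le> \<delta>2" using \<delta> by auto
      from 2[OF this] obtain r2 where r2: "r2 > 0" "\<And>h. integrable lborel h \<Longrightarrow>
        (\<forall>t. t \<notin> {0..\<delta>1} \<longrightarrow> h t = 0) \<Longrightarrow> rapid (v, \<tau>) r2 (osc_bump x0 s0 \<delta> h)" by blast
      have R1: "rapid (v, \<tau>) r2 (osc_bump x0 s0 \<delta> ?h1)"
        by (rule r2(2)[OF i1]) (use k(3) in \<open>auto split: split_indicator\<close>)
      have R2: "rapid (v, \<tau>) r3 (osc_bump x0 s0 \<delta> ?h2)" using 3(3)[of \<delta>] \<delta> by simp
      have "indicator {0..T} t = ?h1 t + ?h2 t" for t
        using k(2)[of t] by (auto split: split_indicator)
      then show ?thesis using \<delta> by (intro rapid_split[OF _ i1 i2 _ r2(1) R1 3(2) R2]) auto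
    qed
    with \<delta>2 3(1) show ?thesis unfolding T_def by (intro exI[of _ "min \<delta>2 \<delta>3"]) auto
  qed
qed

lemma tmax_bound:
  assumes "0 < \<delta>" "\<delta> \<le> 1" "bump x0 \<delta> x \<noteq> 0" "f (x + t *\<^sub>R \<Theta> s) \<noteq> 0"
  shows "t \<le> tmax x0"
proof -
  have "dist x0 x < \<delta>" using assms by (simp add: bump_eq_0_iff)
  then have "norm x \<le> norm x0 + \<delta>" using norm_triangle_sub[of x x0] by (simp add: dist_norm norm_minus_commute)
  moreover have "norm (x + t *\<^sub>R \<Theta> s) \<le> R" using f(2) assms(4) by force
  moreover have "\<bar>t\<bar> = norm (t *\<^sub>R \<Theta> s)" using norm_\<Theta> by simp
  moreover have "norm (t *\<^sub>R \<Theta> s) \<le> norm (x + t *\<^sub>R \<Theta> s) + norm x"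
    using norm_triangle_ineq4[of "x + t *\<^sub>R \<Theta> s" x] by simp
  ultimately show ?thesis using assms unfolding tmax_def by linarith
qed

end

section \<open>Directions in the plane and the two branches of the V-line transform\<close>

definition dir :: "real \<Rightarrow> real^2" where "dir \<theta> = vector [cos \<theta>, sin \<theta>]"
definition dir_perp :: "real \<Rightarrow> real^2" where "dir_perp \<theta> = vector [- sin \<theta>, cos \<theta>]"

text \<open>A combination of fixed vectors is the form to which the smoothness and derivative rules
  for sums and scalings apply.\<close>

lemma vector_2_axis: "vector [a, b] = (a *\<^sub>R axis 1 1 + b *\<^sub>R axis 2 1 :: real^2)"
  by (simp add: vec_eq_iff forall_2 axis_def)

lemma inner_vector_2: "(vector [a, b] :: real^2) \<bullet> w = a * w$1 + b * w$2"
  by (simp add: inner_vec_def sum_2)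

lemma dir_nondegenerate:
  assumes "dir \<theta> \<bullet> w = 0" "dir_perp \<theta> \<bullet> w = 0" shows "w = 0"
proof -
  have 1: "cos \<theta> * w$1 + sin \<theta> * w$2 = 0" and 2: "- sin \<theta> * w$1 + cos \<theta> * w$2 = 0"
    using assms unfolding dir_def dir_perp_def inner_vector_2 by simp_all
  have "w$1 = w$1 * ((sin \<theta>)\<^sup>2 + (cos \<theta>)\<^sup>2)" by simp
  also have "\<dots> = cos \<theta> * (cos \<theta> * w$1 + sin \<theta> * w$2) - sin \<theta> * (- sin \<theta> * w$1 + cos \<theta> * w$2)"
    by algebra
  finally have "w$1 = 0" using 1 2 by simp
  have "w$2 = w$2 * ((sin \<theta>)\<^sup>2 + (cos \<theta>)\<^sup>2)" by simp
  also have "\<dots> = sin \<theta> * (cos \<theta> * w$1 + sin \<theta> * w$2) + cos \<theta> * (- sin \<theta> * w$1 + cos \<theta> * w$2)"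
    by algebra
  finally have "w$2 = 0" using 1 2 by simp
  with \<open>w$1 = 0\<close> show ?thesis by (simp add: vec_eq_iff forall_2)
qed

lemma ray_family_dir:
  assumes "integrable lborel f" "\<And>y. y \<notin> cball 0 R \<Longrightarrow> f y = 0" "R > 0"
  shows "ray_family (\<lambda>s. dir (s + \<beta>)) (\<lambda>s. dir_perp (s + \<beta>)) f R"
proof
  show "smooth_on UNIV (\<lambda>s. dir (s + \<beta>))" "smooth_on UNIV (\<lambda>s. dir_perp (s + \<beta>))"
    unfolding dir_def dir_perp_def vector_2_axis
    by (intro smooth_on_add smooth_on_scaleR smooth_on_minus smooth_on_sin smooth_on_cos
        smooth_on_const smooth_on_id open_UNIV)+
  show "((\<lambda>s. dir (s + \<beta>)) has_vector_derivative dir_perp (s + \<beta>)) (at s)" for s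
    unfolding dir_def dir_perp_def vector_2_axis
    by (auto intro!: derivative_eq_intros)
  show "norm (dir (s + \<beta>)) = 1" for s
    by (simp add: norm_eq_1 dir_def inner_vector_2 power2_eq_square[symmetric])
qed (use assms in auto)


text \<open>The positive multiples of the open ball form an open conic neighbourhood. On it 1 + |l
  z| <= m (1 + l) with m = 1 + |\<omega>| + r, so decay in l gives decay in the norm.\<close>

lemma microlocally_smoothI:
  fixes u :: "('a::euclidean_space \<Rightarrow> complex) \<Rightarrow> complex"
  assumes \<rho>: "test_function \<rho>" "\<rho> x \<noteq> 0" and r: "r > 0" "rapid \<omega> r (fourier_localized u \<rho>)"
  shows "microlocally_smooth u x \<omega>"
proof -
  define \<Gamma> where "\<Gamma> = (\<Union>c\<in>{0<..}. (*\<^sub>R) c ` ball \<omega> r)"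
  have 1: "open \<Gamma>" unfolding \<Gamma>_def by (intro open_UN ballI open_scaling) auto
  have 2: "\<omega> \<in> \<Gamma>" unfolding \<Gamma>_def using r by (auto intro!: bexI[of _ 1] image_eqI[of _ _ \<omega>])
  have \<Gamma>D: "\<exists>l>0. \<exists>z\<in>ball \<omega> r. \<eta> = l *\<^sub>R z" if "\<eta> \<in> \<Gamma>" for \<eta>
    using that unfolding \<Gamma>_def by (elim UN_E imageE) auto
  have 3: "c *\<^sub>R \<eta> \<in> \<Gamma>" if \<eta>: "\<eta> \<in> \<Gamma>" and c: "c > 0" for \<eta> c
  proof -
    obtain l z where "l > 0" "z \<in> ball \<omega> r" "\<eta> = l *\<^sub>R z" using \<Gamma>D[OF \<eta>] by blast
    then show ?thesis unfolding \<Gamma>_def using c by (intro UN_I[of "c * l"] image_eqI[of _ _ z]) auto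
  qed
  define m where "m = 1 + norm \<omega> + r"
  have m: "m \<ge> 1" using r by (simp add: m_def)
  have "\<exists>C. \<forall>\<eta>\<in>\<Gamma>. cmod (fourier_localized u \<rho> \<eta>) \<le> C / (1 + norm \<eta>) ^ N" for N
  proof -
    obtain C where C: "\<And>z l. z \<in> cball \<omega> r \<Longrightarrow> l > 0 \<Longrightarrow> cmod (fourier_localized u \<rho> (l *\<^sub>R z)) * (1 + l) ^ N \<le> C"
      using r(2) unfolding rapid_def by metis
    have "cmod (fourier_localized u \<rho> \<eta>) \<le> (m ^ N * C) / (1 + norm \<eta>) ^ N" if mem: "\<eta> \<in> \<Gamma>" for \<eta>
    proof -
      obtain l z where l: "l > 0" and z: "z \<in> ball \<omega> r" and \<eta>: "\<eta> = l *\<^sub>R z" using \<Gamma>D[OF mem] by blast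
      have "norm z \<le> norm \<omega> + r" using z norm_triangle_sub[of z \<omega>] by (simp add: dist_norm norm_minus_commute)
      then have "norm z \<le> m" by (simp add: m_def)
      then have "l * norm z \<le> l * m" using l by (intro mult_left_mono) auto
      moreover have "norm \<eta> = l * norm z" using l by (simp add: \<eta>)
      ultimately have "1 + norm \<eta> \<le> m + l * m" using m by linarith
      also have "\<dots> = m * (1 + l)" by (simp add: algebra_simps)
      finally have "(1 + norm \<eta>) ^ N \<le> (m * (1 + l)) ^ N" by (intro power_mono) auto
      then have "cmod (fourier_localized u \<rho> \<eta>) * (1 + norm \<eta>) ^ N \<le> cmod (fourier_localized u \<rho> \<eta>) * (m * (1 + l)) ^ N"
        by (intro mult_left_mono) auto
      also have "\<dots> = m ^ N * (cmod (fourier_localized u \<rho> (l *\<^sub>R z)) * (1 + l) ^ N)"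
        by (simp add: power_mult_distrib \<eta> mult_ac)
      also have "\<dots> \<le> m ^ N * C" using C[of z l] z l m by (intro mult_left_mono) auto
      finally have "cmod (fourier_localized u \<rho> \<eta>) * (1 + norm \<eta>) ^ N \<le> m ^ N * C" .
      moreover have "(1 + norm \<eta>) ^ N > 0" by (intro zero_less_power add_pos_nonneg) auto
      ultimately show ?thesis by (simp only: pos_le_divide_eq)
    qed
    then show ?thesis by blast
  qed
  with \<rho> 1 2 3 show ?thesis unfolding microlocally_smooth_def by blast
qed

lemma test_function_bump_product:
  fixes x0 :: "'a::euclidean_space" and s0 :: real
  assumes "\<delta> > 0"
  shows "test_function (\<lambda>(x, s). bump x0 \<delta> x * bump s0 \<delta> s)"
  unfolding test_function_iff
proof
  show "smooth_on UNIV (\<lambda>(x, s). bump x0 \<delta> x * bump s0 \<delta> s)"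
    unfolding case_prod_unfold
    by (intro smooth_on_mult smooth_on_compose[OF smooth_bump] smooth_on_fst smooth_on_snd smooth_on_id open_UNIV)
  have "{p. (case p of (x, s) \<Rightarrow> bump x0 \<delta> x * bump s0 \<delta> s) \<noteq> 0} \<subseteq> cball x0 \<delta> \<times> cball s0 \<delta>"
    using bump_supp[OF assms, of _ x0] bump_supp[OF assms, of _ s0] by fastforce
  moreover have "bounded (cball x0 \<delta> \<times> cball s0 \<delta>)" by (intro bounded_Times bounded_cball)
  ultimately have "bounded {p. (case p of (x, s) \<Rightarrow> bump x0 \<delta> x * bump s0 \<delta> s) \<noteq> 0}"
    using bounded_subset by blast
  then show "compact (closure {p. (case p of (x, s) \<Rightarrow> bump x0 \<delta> x * bump s0 \<delta> s) \<noteq> 0})"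
    by (simp add: compact_closure)
qed

lemma (in ray_family) ray_rapid_of_not_in_W_set:
  assumes nd: "\<And>s w. \<Theta> s \<bullet> w = 0 \<Longrightarrow> \<Theta>' s \<bullet> w = 0 \<Longrightarrow> w = 0" and \<omega>: "(v, \<tau>) \<noteq> 0"
    and g: "AE x in lebesgue. g x = f x"
    and W1: "\<tau> = 0 \<Longrightarrow> (x0, v) \<notin> WF g"
    and W2: "\<And>\<alpha>. \<alpha> \<ge> 0 \<Longrightarrow> \<Theta> s0 \<bullet> v = 0 \<Longrightarrow> \<tau> = \<alpha> * (\<Theta>' s0 \<bullet> v) \<Longrightarrow> (x0 + \<alpha> *\<^sub>R \<Theta> s0, v) \<notin> WF g"
  shows "\<exists>\<delta>0>0. \<forall>\<delta>. 0 < \<delta> \<and> \<delta> \<le> \<delta>0 \<longrightarrow> (\<exists>r>0. rapid (v, \<tau>) r (osc_bump x0 s0 \<delta> (indicator {0..tmax x0})))"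
proof (rule ray_rapid[OF nd \<omega>])
  have *: "locally_rapid f y v" if "v \<noteq> 0" "(y, v) \<notin> WF g" for y
    using that microlocally_smooth_imp_locally_rapid[OF _ that(1) f(1) g]
    by (auto simp: wavefront_set_def)
  show "locally_rapid f x0 v" if "v \<noteq> 0" "\<tau> = 0" using * W1 that by blast
  show "locally_rapid f (x0 + \<alpha> *\<^sub>R \<Theta> s0) v" if "v \<noteq> 0" "\<alpha> \<ge> 0" "\<Theta> s0 \<bullet> v = 0" "\<tau> = \<alpha> * (\<Theta>' s0 \<bullet> v)" for \<alpha>
    using * W2 that by blast
qed

lemma Phi_eq_dir:
  "Phi \<psi> = (\<lambda>s. dir (s + (2 * \<psi> - pi/2)))" "Phi_perp \<psi> = (\<lambda>s. dir_perp (s + (2 * \<psi> - pi/2)))"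
  "Phi' = (\<lambda>s. dir (s + (- (pi/2))))" "Phi'_perp = (\<lambda>s. dir_perp (s + (- (pi/2))))"
  by (auto simp: Phi_def Phi_perp_def Phi'_def Phi'_perp_def dir_def dir_perp_def fun_eq_iff algebra_simps)

lemma V_line_eq_ray: "V_line \<psi> a b f q = of_real a * ray (Phi \<psi>) f q + of_real b * ray Phi' f q"
  by (cases q) (simp add: V_line_def ray_def scaleR_conv_of_real)

theorem theorem4p1:
  fixes f :: "real^2 \<Rightarrow> complex" and a b \<psi> :: real
  assumes "square_integrable f" and "compactly_supported f"
    and "a \<noteq> 0" and "b \<noteq> 0"
    and "0 < 2 * \<psi>" and "2 * \<psi> < pi"
  shows "WF (V_line \<psi> a b f) \<subseteq> W_set (Phi \<psi>) (Phi_perp \<psi>) f \<union> W_set Phi' Phi'_perp f"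
proof (rule subsetI, rule ccontr)
  fix p assume p: "p \<in> WF (V_line \<psi> a b f)"
    and np: "p \<notin> W_set (Phi \<psi>) (Phi_perp \<psi>) f \<union> W_set Phi' Phi'_perp f"
  obtain x0 s0 v \<tau> where p_eq: "p = ((x0, s0), (v, \<tau>))" by (metis surj_pair)
  have \<omega>: "(v, \<tau>) \<noteq> 0" and nms: "\<not> microlocally_smooth (regular_distribution (V_line \<psi> a b f)) (x0, s0) (v, \<tau>)"
    using p by (auto simp: wavefront_set_def p_eq)
  obtain f0 R where f0: "integrable lborel f0" and ff0: "AE x in lebesgue. f x = f0 x"
    and supp: "\<And>x. x \<notin> cball 0 R \<Longrightarrow> f0 x = 0" and R: "R > 0"
    using square_integrable_ex_borel[OF assms(1,2)] by metis
  interpret P: ray_family "Phi \<psi>" "Phi_perp \<psi>" f0 R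
    unfolding Phi_eq_dir by (rule ray_family_dir[OF f0 supp R])
  interpret P': ray_family "Phi'" "Phi'_perp" f0 R
    unfolding Phi_eq_dir by (rule ray_family_dir[OF f0 supp R])
  \<comment> \<open>Both sets of the union contain the same covectors (v, 0), so this one exclusion
    at x0 serves both branches.\<close>
  have W1: "\<tau> = 0 \<Longrightarrow> (x0, v) \<notin> WF f"
    and W2: "\<And>\<alpha>. \<alpha> \<ge> 0 \<Longrightarrow> Phi \<psi> s0 \<bullet> v = 0 \<Longrightarrow> \<tau> = \<alpha> * (Phi_perp \<psi> s0 \<bullet> v) \<Longrightarrow> (x0 + \<alpha> *\<^sub>R Phi \<psi> s0, v) \<notin> WF f"
    and W2': "\<And>\<alpha>. \<alpha> \<ge> 0 \<Longrightarrow> Phi' s0 \<bullet> v = 0 \<Longrightarrow> \<tau> = \<alpha> * (Phi'_perp s0 \<bullet> v) \<Longrightarrow> (x0 + \<alpha> *\<^sub>R Phi' s0, v) \<notin> WF f"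
    using np unfolding p_eq W_set_def by blast+
  have nd: "Phi \<psi> s \<bullet> w = 0 \<Longrightarrow> Phi_perp \<psi> s \<bullet> w = 0 \<Longrightarrow> w = 0"
    and nd': "Phi' s \<bullet> w = 0 \<Longrightarrow> Phi'_perp s \<bullet> w = 0 \<Longrightarrow> w = 0" for s w
    unfolding Phi_eq_dir by (erule (1) dir_nondegenerate)+
  \<comment> \<open>\<open>tmax\<close> depends on R and x0 only, so the same truncation serves both
    branches.\<close>
  let ?T = "P.tmax x0"
  have "\<exists>\<delta>0>0. \<forall>\<delta>. 0 < \<delta> \<and> \<delta> \<le> \<delta>0 \<longrightarrow> (\<exists>r>0. rapid (v, \<tau>) r (P.osc_bump x0 s0 \<delta> (indicator {0..?T})))"
    by (rule P.ray_rapid_of_not_in_W_set[OF _ \<omega> ff0]) (use nd W1 W2 in blast)+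
  then obtain \<delta>1 where \<delta>1: "\<delta>1 > 0" "\<And>\<delta>. 0 < \<delta> \<and> \<delta> \<le> \<delta>1 \<Longrightarrow> \<exists>r>0. rapid (v, \<tau>) r (P.osc_bump x0 s0 \<delta> (indicator {0..?T}))"
    by blast
  have "\<exists>\<delta>0>0. \<forall>\<delta>. 0 < \<delta> \<and> \<delta> \<le> \<delta>0 \<longrightarrow> (\<exists>r>0. rapid (v, \<tau>) r (P'.osc_bump x0 s0 \<delta> (indicator {0..?T})))"
    by (rule P'.ray_rapid_of_not_in_W_set[OF _ \<omega> ff0]) (use nd' W1 W2' in blast)+
  then obtain \<delta>2 where \<delta>2: "\<delta>2 > 0" "\<And>\<delta>. 0 < \<delta> \<and> \<delta> \<le> \<delta>2 \<Longrightarrow> \<exists>r>0. rapid (v, \<tau>) r (P'.osc_bump x0 s0 \<delta> (indicator {0..?T}))"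
    by blast
  \<comment> \<open>One radius for both branches, as their sum is localised by a single test
    function; the bound 1 is what \<open>tmax_bound\<close> asks for.\<close>
  define \<delta> where "\<delta> = min 1 (min \<delta>1 \<delta>2)"
  have \<delta>: "\<delta> > 0" "\<delta> \<le> 1" "\<delta> \<le> \<delta>1" "\<delta> \<le> \<delta>2" using \<delta>1(1) \<delta>2(1) by (auto simp: \<delta>_def)
  obtain r1 where r1: "r1 > 0" "rapid (v, \<tau>) r1 (P.osc_bump x0 s0 \<delta> (indicator {0..?T}))"
    using \<delta>1(2) \<delta> by blast
  obtain r2 where r2: "r2 > 0" "rapid (v, \<tau>) r2 (P'.osc_bump x0 s0 \<delta> (indicator {0..?T}))"
    using \<delta>2(2) \<delta> by blast
  define \<rho> where "\<rho> = (\<lambda>(x, s). bump x0 \<delta> x * bump s0 \<delta> s)"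
  have "fourier_localized (regular_distribution (V_line \<psi> a b f)) \<rho> \<zeta> =
      of_real a * P.osc_bump x0 s0 \<delta> (indicator {0..?T}) \<zeta> + of_real b * P'.osc_bump x0 s0 \<delta> (indicator {0..?T}) \<zeta>" for \<zeta>
  proof -
    obtain \<xi> \<sigma> where \<zeta>: "\<zeta> = (\<xi>, \<sigma>)" by force
    let ?F = "\<lambda>\<Theta> (x, s). ray \<Theta> f0 (x, s) * (bump x0 \<delta> x * bump s0 \<delta> s * exp (- \<i> * of_real (x \<bullet> \<xi> + s * \<sigma>)))"
    note bump = smooth_on_cont[OF smooth_bump, of x0 \<delta>] compact_cball[of x0 \<delta>]
    have supp: "\<And>x. x \<notin> cball x0 \<delta> \<Longrightarrow> bump x0 \<delta> x = 0" and \<kappa>: "integrable lborel (bump s0 \<delta>)"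
      using \<delta>(1) by (auto intro: bump_supp integrable_bump)
    have i1: "integrable lborel (?F (Phi \<psi>))"
      by (rule ft_ray(1)[where T = ?T, OF P.continuous_\<Theta> f0 bump _ \<kappa>]) (use supp P.tmax_bound[OF \<delta>(1,2)] in blast)+
    have e1: "integral\<^sup>L lborel (?F (Phi \<psi>)) = P.osc_bump x0 s0 \<delta> (indicator {0..?T}) \<zeta>"
      unfolding \<zeta> by (rule ft_ray(2)[OF P.continuous_\<Theta> f0 bump _ \<kappa>]) (use supp P.tmax_bound[OF \<delta>(1,2)] in blast)+
    have i2: "integrable lborel (?F Phi')"
      by (rule ft_ray(1)[where T = ?T, OF P'.continuous_\<Theta> f0 bump _ \<kappa>]) (use supp P'.tmax_bound[OF \<delta>(1,2)] in blast)+
    have e2: "integral\<^sup>L lborel (?F Phi') = P'.osc_bump x0 s0 \<delta> (indicator {0..?T}) \<zeta>"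
      unfolding \<zeta> by (rule ft_ray(2)[OF P'.continuous_\<Theta> f0 bump _ \<kappa>]) (use supp P'.tmax_bound[OF \<delta>(1,2)] in blast)+
    have "fourier_localized (regular_distribution (V_line \<psi> a b f)) \<rho> \<zeta> =
      (LINT q|lebesgue. of_real a * ?F (Phi \<psi>) q + of_real b * ?F Phi' q)"
      unfolding fourier_localized_def regular_distribution_def
    \<comment> \<open>The ray integrals of f and of its representative f0 agree for almost every (x,
      phi), which is enough under the integral.\<close>
    proof (rule integral_cong_AE_lebesgue)
      show "AE q in lebesgue. V_line \<psi> a b f q * (\<rho> q * exp (- \<i> * of_real (q \<bullet> \<zeta>))) =
         of_real a * ?F (Phi \<psi>) q + of_real b * ?F Phi' q"
        using ray_cong_AE[OF P.continuous_\<Theta> ff0] ray_cong_AE[OF P'.continuous_\<Theta> ff0]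
        by eventually_elim (auto simp: V_line_eq_ray \<rho>_def \<zeta> algebra_simps)
    qed
    also have "\<dots> = (LINT q|lborel. of_real a * ?F (Phi \<psi>) q + of_real b * ?F Phi' q)"
      by (rule integral_completion) (use i1 i2 in auto)
    also have "\<dots> = of_real a * integral\<^sup>L lborel (?F (Phi \<psi>)) + of_real b * integral\<^sup>L lborel (?F Phi')"
      using i1 i2 by simp
    finally show ?thesis unfolding e1 e2 .
  qed
  then have "fourier_localized (regular_distribution (V_line \<psi> a b f)) \<rho> =
      (\<lambda>\<zeta>. of_real a * P.osc_bump x0 s0 \<delta> (indicator {0..?T}) \<zeta> + of_real b * P'.osc_bump x0 s0 \<delta> (indicator {0..?T}) \<zeta>)"
    by blast
  moreover have "rapid (v, \<tau>) (min r1 r2)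
      (\<lambda>\<zeta>. of_real a * P.osc_bump x0 s0 \<delta> (indicator {0..?T}) \<zeta> + of_real b * P'.osc_bump x0 s0 \<delta> (indicator {0..?T}) \<zeta>)"
    by (intro rapid_add rapid_cmult rapid_mono[OF r1(2)] rapid_mono[OF r2(2)]) auto
  moreover have "test_function \<rho>" unfolding \<rho>_def by (rule test_function_bump_product[OF \<delta>(1)])
  moreover have "\<rho> (x0, s0) \<noteq> 0" using \<delta>(1) by (simp add: \<rho>_def bump_eq_0_iff)
  ultimately have "microlocally_smooth (regular_distribution (V_line \<psi> a b f)) (x0, s0) (v, \<tau>)"
    using r1(1) r2(1) by (intro microlocally_smoothI[of \<rho> _ "min r1 r2"]) auto
  with nms show False by blast
qed

end
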